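(* Let $n\geqslant 3$ and let $\psi_0,\psi_1,\psi_2\in L^2(\mathbb{R}^n)\cap L^{1,1}(\mathbb{R}^n)$. Then the solution $\psi$ to the linear Blackstock Cauchy problem $$\begin{cases}(\partial_t-\kappa\Delta)(\psi_{tt}-\Delta\psi-\delta\Delta\psi_t)+\kappa(\gamma-1)(b\nu-\kappa)\Delta^2\psi_t=0, & x\in\mathbb{R}^n,\ t>0,\\ \psi(0,x)=\psi_0(x),\ \psi_t(0,x)=\psi_1(x),\ \psi_{tt}(0,x)=\psi_2(x), & x\in\mathbb{R}^n,\end{cases}$$ fulfills, for all $t\geqslant 0$, the refined estimate $$\|(\psi-J_0\psi_0-J_1\psi_1-J_2\psi_2)(t,\cdot)\|_{L^2}\lesssim (1+t)^{-\frac12-\frac n4}\|\psi_0\|_{L^2\cap L^{1,1}}+(1+t)^{-\frac n4}\|\psi_1\|_{L^2\cap L^{1,1}}+(1+t)^{\frac12-\frac n4}\|\psi_2\|_{L^2\cap L^{1,1}}.$$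
   Context: Parameters: $b>0$, $\nu>0$, $\gamma\in(1,5/3]$, $\delta:=b\nu+(\gamma-1)\kappa$, and $0<\kappa\ll1$, i.e. $\kappa>0$ is sufficiently small with respect to the other parameters. Standing assumption: $\psi_2$ is nontrivial. The solution is obtained by solving, for each $\xi$, the linear third-order ODE in $t$ satisfied by the partial Fourier transform $\widehat\psi(t,\xi)$ with data $\widehat\psi_0,\widehat\psi_1,\widehat\psi_2$. $L^{1,1}$ is the space of $f\in L^1(\mathbb{R}^n)$ with $\|f\|_{L^{1,1}}:=\int_{\mathbb{R}^n}(1+|x|)|f(x)|\,\mathrm{d}x<\infty$; $\|f\|_{L^2\cap L^{1,1}}$ is the sum of the two norms. For $j=0,1,2$, $J_j=J_j(t)$ is the Fourier multiplier operator with symbol $\widehat J_j(t,|\xi|)$ (so $J_j\psi_j$ has Fourier transform $\widehat J_j\widehat\psi_j$), where $$\widehat J_0:=\mathrm{e}^{-\kappa|\xi|^2t},\quad \widehat J_1:=\frac{\sin(|\xi|t)}{|\xi|}\mathrm{e}^{-\frac\delta2|\xi|^2t},\quad \widehat J_2:=-\frac{\cos(|\xi|t)}{|\xi|^2}\mathrm{e}^{-\frac\delta2|\xi|^2t}+\frac1{|\xi|^2}\mathrm{e}^{-\kappa|\xi|^2t}.$$ $A\lesssim B$ means $A\leqslant CB$ with a constant $C>0$ independent of $t$ and of the initial data (it may depend on $n$ and on the parameters, including $\kappa$). *)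

theory Defs
  imports "HOL-Analysis.Analysis"
begin

definition in_L2 :: "(real^'n \<Rightarrow> complex) \<Rightarrow> bool" where
  "in_L2 f \<longleftrightarrow> f \<in> borel_measurable lborel \<and> integrable lborel (\<lambda>x. (cmod (f x))\<^sup>2)"

definition L2_norm :: "(real^'n \<Rightarrow> complex) \<Rightarrow> real" where
  "L2_norm f = sqrt (LINT x|lborel. (cmod (f x))\<^sup>2)"

definition in_L11 :: "(real^'n \<Rightarrow> complex) \<Rightarrow> bool" where
  "in_L11 f \<longleftrightarrow> f \<in> borel_measurable lborel \<and> integrable lborel (\<lambda>x. (1 + norm x) * cmod (f x))"

definition L11_norm :: "(real^'n \<Rightarrow> complex) \<Rightarrow> real" where
  "L11_norm f = (LINT x|lborel. (1 + norm x) * cmod (f x))"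

definition L2_L11_norm :: "(real^'n \<Rightarrow> complex) \<Rightarrow> real" where
  "L2_L11_norm f = L2_norm f + L11_norm f"

text \<open>The normalisation is the one for which the Laplacian has symbol \<open>-|\<xi>|\<^sup>2\<close>.\<close>

definition fourier :: "(real^'n \<Rightarrow> complex) \<Rightarrow> real^'n \<Rightarrow> complex" where
  "fourier f \<xi> = (LINT x|lborel. cis (- (x \<bullet> \<xi>)) * f x)"

text \<open>
  The Fourier--Plancherel transform, as a relation between representatives: \<open>g\<close> is the
  \<open>L\<^sup>2\<close>-limit of the transforms of the truncations of \<open>f\<close> to balls. By Plancherel's theorem
  each \<open>f\<close> in \<open>L\<^sup>2\<close> has such a \<open>g\<close>, each \<open>g\<close> in \<open>L\<^sup>2\<close> comes from such an \<open>f\<close>, and each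
  determines the other almost everywhere. For integrable \<open>f\<close>, \<open>g = fourier f\<close> almost everywhere.
\<close>

definition has_L2_fourier :: "(real^'n \<Rightarrow> complex) \<Rightarrow> (real^'n \<Rightarrow> complex) \<Rightarrow> bool" where
  "has_L2_fourier f g \<longleftrightarrow> in_L2 f \<and> in_L2 g \<and>
     ((\<lambda>R. L2_norm (\<lambda>\<xi>. g \<xi> - fourier (\<lambda>x. indicator (cball 0 R) x * f x) \<xi>)) \<longlongrightarrow> 0) at_top"

text \<open>
  \<open>g\<close> is (a representative of) the image of \<open>f\<close> under the Fourier multiplier operator with the
  radial symbol \<open>m\<close>. The value \<open>m 0\<close> is irrelevant, since \<open>{0}\<close> is a null set.
\<close>

definition multiplier_image ::
    "(real \<Rightarrow> real) \<Rightarrow> (real^'n \<Rightarrow> complex) \<Rightarrow> (real^'n \<Rightarrow> complex) \<Rightarrow> bool" where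
  "multiplier_image m f g \<longleftrightarrow> has_L2_fourier g (\<lambda>\<xi>. complex_of_real (m (norm \<xi>)) * fourier f \<xi>)"

definition delta :: "real \<Rightarrow> real \<Rightarrow> real \<Rightarrow> real \<Rightarrow> real" where
  "delta b \<nu> \<gamma> \<kappa> = b * \<nu> + (\<gamma> - 1) * \<kappa>"

definition J0_hat :: "real \<Rightarrow> real \<Rightarrow> real \<Rightarrow> real" where
  "J0_hat \<kappa> t r = exp (- \<kappa> * r\<^sup>2 * t)"

definition J1_hat :: "real \<Rightarrow> real \<Rightarrow> real \<Rightarrow> real" where
  "J1_hat \<delta> t r = sin (r * t) / r * exp (- (\<delta> / 2) * r\<^sup>2 * t)"

definition J2_hat :: "real \<Rightarrow> real \<Rightarrow> real \<Rightarrow> real \<Rightarrow> real" where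
  "J2_hat \<delta> \<kappa> t r =
     - cos (r * t) / r\<^sup>2 * exp (- (\<delta> / 2) * r\<^sup>2 * t) + 1 / r\<^sup>2 * exp (- \<kappa> * r\<^sup>2 * t)"

text \<open>
  The initial value problem obtained from the linear Blackstock equation
  \<open>(\<partial>\<^sub>t - \<kappa>\<Delta>)(\<psi>\<^sub>t\<^sub>t - \<Delta>\<psi> - \<delta>\<Delta>\<psi>\<^sub>t) + \<kappa>(\<gamma> - 1)(b\<nu> - \<kappa>)\<Delta>\<^sup>2\<psi>\<^sub>t = 0\<close> by partial Fourier transform,
  i.e. by replacing \<open>-\<Delta>\<close> with \<open>s = |\<xi>|\<^sup>2\<close>. The functions \<open>u'\<close> and \<open>u''\<close> are the
  derivatives of \<open>u\<close>, one-sided at \<open>0\<close>, and \<open>w\<close> is the second factor.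
\<close>

definition blackstock_ode ::
    "real \<Rightarrow> real \<Rightarrow> real \<Rightarrow> real \<Rightarrow> real \<Rightarrow> complex \<Rightarrow> complex \<Rightarrow> complex \<Rightarrow> (real \<Rightarrow> complex) \<Rightarrow> bool" where
  "blackstock_ode b \<nu> \<gamma> \<kappa> s u0 u1 u2 u \<longleftrightarrow>
     (\<exists>u' u''.
        (\<forall>t\<ge>0. (u has_vector_derivative u' t) (at t within {0..})) \<and>
        (\<forall>t\<ge>0. (u' has_vector_derivative u'' t) (at t within {0..})) \<and>
        continuous_on {0..} u'' \<and>
        u 0 = u0 \<and> u' 0 = u1 \<and> u'' 0 = u2 \<and>
        (let w = (\<lambda>t. u'' t + of_real s * u t + of_real (delta b \<nu> \<gamma> \<kappa> * s) * u' t) in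
         \<forall>t>0. \<exists>w'. (w has_vector_derivative w') (at t) \<and>
           w' + of_real (\<kappa> * s) * w t
              + of_real (\<kappa> * (\<gamma> - 1) * (b * \<nu> - \<kappa>) * s\<^sup>2) * u' t = 0))"

definition blackstock_solution ::
    "real \<Rightarrow> real \<Rightarrow> real \<Rightarrow> real \<Rightarrow> (real^'n \<Rightarrow> complex) \<Rightarrow> (real^'n \<Rightarrow> complex) \<Rightarrow> (real^'n \<Rightarrow> complex)
      \<Rightarrow> (real \<Rightarrow> real^'n \<Rightarrow> complex) \<Rightarrow> bool" where
  "blackstock_solution b \<nu> \<gamma> \<kappa> \<psi>0 \<psi>1 \<psi>2 \<psi> \<longleftrightarrow>
     (\<exists>\<psi>_hat.
        (\<forall>t\<ge>0. has_L2_fourier (\<psi> t) (\<psi>_hat t)) \<and>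
        (\<forall>\<xi>. blackstock_ode b \<nu> \<gamma> \<kappa> ((norm \<xi>)\<^sup>2)
               (fourier \<psi>0 \<xi>) (fourier \<psi>1 \<xi>) (fourier \<psi>2 \<xi>) (\<lambda>t. \<psi>_hat t \<xi>)))"

end

(* On the Fourier side the problem is, for each frequency, a third-order linear ODE in time with
   s = |xi|^2. For small kappa its characteristic cubic has a real root -m satisfying
   kappa s / (1 + gamma b nu kappa s) <= m <= min (kappa s) (1 / (b nu)), so that the operator splits as
   (d/dt + m)(d^2/dt^2 + p d/dt + q). Away from frequency zero a Lyapunov function for the second-order
   factor gives exponential decay, uniformly in the frequency. Near frequency zero the solution is explicit,
   and expanding m, p, q in s gives the pointwise bound
   e^{-a |xi|^2 t} (|xi| |u0| + |u1| + |u2| / |xi|) for the difference from the profile.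
   Taking L^2 norms with |u_j| bounded by the L^1 norm of psi_j at low frequencies, and by Plancherel at
   high frequencies, yields the three rates. *)

theory Submission
  imports Defs "HOL-Probability.Characteristic_Functions"
begin

section \<open>Gaussian integrals and the Fourier transform on Euclidean space\<close>

text \<open>The obstacle is uniformity in the frequency. Near zero the quadratic factor is
  underdamped, but elsewhere its roots and -m may coincide, so partial fractions would give
  constants that blow up. The factorization is therefore used in two orders: \<open>u' + m u\<close>
  solves the second-order equation and is controlled by energy, while
  \<open>u'' + p u' + q u\<close> solves the first-order one and gives the explicit solution near
  zero. The two upper bounds on m have separate purposes. Since q m = \<kappa> s^2, the bound m <=
  \<kappa> s gives q >= s, and m <= 1 / (b \<nu>) gives q >= b \<nu> \<kappa> s^2; the latter keeps
  p^2 / q bounded as s grows, so that no derivatives of the data are lost. Comparing exponents and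
  phases with those of the profile costs a factor s t; it is absorbed by giving up half of the
  exponential rate. The weight |u2| / |xi| makes the dimension enter: |xi|^(-2) is locally
  integrable exactly for n >= 3. Plancherel is proved from Gaussian means of the squared transform,
  which the autocorrelation of f turns into means of a function near its value at 0.\<close>

lemma integrable_lborel_affine:
  fixes f :: "'a::euclidean_space \<Rightarrow> 'b::{banach, second_countable_topology}"
  assumes f: "integrable lborel f" and c: "c \<noteq> 0"
  shows "integrable lborel (\<lambda>x. f (t + c *\<^sub>R x))"
proof -
  have [measurable]: "f \<in> borel_measurable borel"
    using f by auto
  have "integrable (density (distr lborel borel (\<lambda>x. t + c *\<^sub>R x)) (\<lambda>_. \<bar>c\<bar>^DIM('a))) f"
    using f lborel_affine[OF c, of t] by simp
  then have "integrable lborel (\<lambda>x. \<bar>c\<bar>^DIM('a) *\<^sub>R f (t + c *\<^sub>R x))"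
    by (subst (asm) integrable_density) (auto simp: integrable_distr_eq)
  from integrable_scaleR_right[OF this, of "inverse (\<bar>c\<bar>^DIM('a))"] show ?thesis
    using c by simp
qed

lemma integral_lborel_affine:
  fixes f :: "'a::euclidean_space \<Rightarrow> 'b::{banach, second_countable_topology}"
  assumes f: "f \<in> borel_measurable borel" and c: "c \<noteq> 0"
  shows "integral\<^sup>L lborel f = \<bar>c\<bar>^DIM('a) *\<^sub>R (LINT x|lborel. f (t + c *\<^sub>R x))"
proof -
  note f[measurable]
  show ?thesis
    by (subst lborel_affine[OF c, of t]) (simp add: integral_density integral_distr)
qed

text \<open>\<open>lborel\<close> is the image of the product of one-dimensional Lebesgue measures
  under the coordinate map, so this is Fubini for products. It serves both the Gaussian transform
  and the majorant of the singular weight.\<close>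

lemma integrable_lborel_prod:
  fixes f :: "'a::euclidean_space \<Rightarrow> real \<Rightarrow> 'b::{real_normed_field, banach, second_countable_topology}"
  assumes f: "\<And>b. b \<in> Basis \<Longrightarrow> integrable lborel (f b)"
  shows "integrable lborel (\<lambda>x::'a. \<Prod>b\<in>Basis. f b (x \<bullet> b))"
    and "(LINT x|lborel. (\<Prod>b\<in>Basis. f b (x \<bullet> b))) = (\<Prod>b\<in>(Basis :: 'a set). (LINT t|lborel. f b t))"
proof -
  interpret product_sigma_finite "\<lambda>_::'a. lborel :: real measure"
    by standard
  have [measurable]: "\<And>b. b \<in> Basis \<Longrightarrow> f b \<in> borel_measurable borel"
    using f by fastforce
  have m: "(\<lambda>x::'a. \<Prod>b\<in>Basis. f b (x \<bullet> b)) \<in> borel_measurable borel"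
    by measurable
  have m': "(\<lambda>g::'a \<Rightarrow> real. \<Sum>b\<in>Basis. g b *\<^sub>R b) \<in> (\<Pi>\<^sub>M b\<in>Basis. lborel) \<rightarrow>\<^sub>M borel"
    by measurable
  have eq: "(\<Prod>b\<in>Basis. f b ((\<Sum>c\<in>Basis. g c *\<^sub>R c) \<bullet> b)) = (\<Prod>b\<in>Basis. f b (g b))" for g :: "'a \<Rightarrow> real"
    by (intro prod.cong) auto
  show "integrable lborel (\<lambda>x::'a. \<Prod>b\<in>Basis. f b (x \<bullet> b))"
    by (subst lborel_eq, subst integrable_distr_eq[OF m' m])
       (use product_integrable_prod[OF finite_Basis f] in \<open>simp add: eq\<close>)
  show "(LINT x|lborel. (\<Prod>b\<in>Basis. f b (x \<bullet> b))) = (\<Prod>b\<in>(Basis :: 'a set). (LINT t|lborel. f b t))"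
    by (subst lborel_eq, subst integral_distr[OF m' m])
       (use product_integral_prod[OF finite_Basis f] in \<open>simp add: eq\<close>)
qed

lemma exp_norm_eq_prod:
  fixes x :: "'a::euclidean_space"
  shows "exp (- (c * (norm x)\<^sup>2)) = (\<Prod>b\<in>Basis. exp (- (c * (x \<bullet> b)\<^sup>2)))"
proof -
  have "(norm x)\<^sup>2 = (\<Sum>b\<in>Basis. (x \<bullet> b)\<^sup>2)"
    unfolding power2_norm_eq_inner by (subst euclidean_inner) (simp add: power2_eq_square)
  then show ?thesis
    by (simp add: exp_sum[symmetric] sum_distrib_left sum_negf)
qed

lemma integrable_gaussian_real:
  assumes "c > 0"
  shows "integrable lborel (\<lambda>x::real. exp (- (c * x\<^sup>2)))"
proof -
  have s: "sqrt (2 * c) \<noteq> 0"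
    using assms by simp
  have "integrable lborel (\<lambda>x. sqrt (2 * pi) * (std_normal_density x * x ^ 0))"
    by (intro integrable_mult_right integrable_std_normal_moment)
  then have "integrable lborel (\<lambda>x::real. exp (- x\<^sup>2 / 2))"
    by (simp add: std_normal_density_def)
  from lborel_integrable_real_affine[OF this s, of 0] show ?thesis
    using assms by (simp add: power_mult_distrib)
qed

lemma integrable_gaussian:
  assumes "c > 0"
  shows "integrable lborel (\<lambda>x::'a::euclidean_space. exp (- (c * (norm x)\<^sup>2)))"
  unfolding exp_norm_eq_prod using assms by (intro integrable_lborel_prod integrable_gaussian_real)

text \<open>Restates the known characteristic function of the standard normal distribution, taken at
  \<open>- z\<close> because of the sign convention in \<open>fourier\<close>.\<close>

lemma gaussian_fourier_real:
  "(LINT x|lborel. cis (- (x * z)) * of_real (exp (- (1/2 * x\<^sup>2)))) = of_real (sqrt (2 * pi) * exp (- (1/2 * z\<^sup>2)))"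
proof -
  have "char std_normal_distribution (- z) = of_real (exp (- (1/2 * z\<^sup>2)))"
    by (simp add: char_std_normal_distribution)
  also have "char std_normal_distribution (- z) = (LINT x|lborel. std_normal_density x *\<^sub>R iexp (- z * x))"
    unfolding char_def by (subst integral_density) (auto simp: normal_density_nonneg)
  also have "\<dots> = (LINT x|lborel. of_real (1 / sqrt (2 * pi)) * (cis (- (x * z)) * of_real (exp (- (1/2 * x\<^sup>2)))))"
    by (intro Bochner_Integration.integral_cong)
       (auto simp: std_normal_density_def cis_conv_exp scaleR_conv_of_real mult_ac)
  also have "\<dots> = of_real (1 / sqrt (2 * pi)) * (LINT x|lborel. cis (- (x * z)) * of_real (exp (- (1/2 * x\<^sup>2))))"
    by (rule integral_mult_right_zero)
  finally show ?thesis
    by (simp add: field_simps)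
qed

lemma cis_prod: "finite I \<Longrightarrow> cis (\<Sum>i\<in>I. f i) = (\<Prod>i\<in>I. cis (f i))"
  by (induction I rule: finite_induct) (auto simp: cis_mult[symmetric])

lemma integrable_cis_mult:
  assumes "integrable M f" and [measurable]: "g \<in> borel_measurable M"
  shows "integrable M (\<lambda>x. cis (g x) * f x)"
proof (rule Bochner_Integration.integrable_bound[OF assms(1)])
  note [measurable] = borel_measurable_integrable[OF assms(1)]
  have [measurable]: "cis \<in> borel_measurable borel"
    by (intro borel_measurable_continuous_onI continuous_intros)
  show "(\<lambda>x. cis (g x) * f x) \<in> borel_measurable M"
    by measurable
qed (auto simp: norm_mult)

lemma gaussian_fourier:
  "fourier (\<lambda>x::real^'n. of_real (exp (- (1/2 * (norm x)\<^sup>2)))) z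
     = of_real (sqrt (2 * pi) ^ CARD('n) * exp (- (1/2 * (norm z)\<^sup>2)))"
proof -
  have int: "integrable lborel (\<lambda>t::real. cis (- (t * (z \<bullet> b))) * complex_of_real (exp (- (1/2 * t\<^sup>2))))" for b
    by (intro integrable_cis_mult integrable_of_real integrable_gaussian_real) auto
  have "fourier (\<lambda>x::real^'n. of_real (exp (- (1/2 * (norm x)\<^sup>2)))) z =
     (LINT x|lborel. (\<Prod>b\<in>Basis. cis (- ((x \<bullet> b) * (z \<bullet> b))) * of_real (exp (- (1/2 * (x \<bullet> b)\<^sup>2)))))"
    unfolding fourier_def exp_norm_eq_prod prod.distrib
    by (subst euclidean_inner) (simp add: cis_prod[symmetric] sum_negf)
  also have "\<dots> = (\<Prod>b\<in>(Basis :: (real^'n) set). of_real (sqrt (2 * pi) * exp (- (1/2 * (z \<bullet> b)\<^sup>2))))"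
    by (subst integrable_lborel_prod(2)[OF int]) (simp only: gaussian_fourier_real)
  also have "\<dots> = of_real (sqrt (2 * pi) ^ CARD('n) * exp (- (1/2 * (norm z)\<^sup>2)))"
    unfolding exp_norm_eq_prod by (simp add: prod.distrib)
  finally show ?thesis .
qed

lemma integrable_pair_mult:
  fixes f :: "'a::euclidean_space \<Rightarrow> complex" and g :: "'b::euclidean_space \<Rightarrow> complex"
  assumes f: "integrable lborel f" and g: "integrable lborel g"
  shows "integrable (lborel \<Otimes>\<^sub>M lborel) (\<lambda>(x, y). f x * g y)"
proof (rule lborel_pair.Fubini_integrable)
  note [measurable] = borel_measurable_integrable[OF f] borel_measurable_integrable[OF g]
  show "(\<lambda>(x, y). f x * g y) \<in> borel_measurable (lborel \<Otimes>\<^sub>M lborel)"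
    by measurable
qed (use f g in \<open>auto simp: norm_mult\<close>)

lemma borel_measurable_fourier [measurable]:
  assumes [measurable]: "f \<in> borel_measurable lborel"
  shows "fourier f \<in> borel_measurable borel"
proof -
  have [measurable]: "cis \<in> borel_measurable borel"
    by (intro borel_measurable_continuous_onI continuous_intros)
  show ?thesis
    unfolding fourier_def[abs_def] by measurable
qed

lemma fourier_bound:
  assumes f: "integrable lborel f"
  shows "cmod (fourier f \<xi>) \<le> (LINT x|lborel. cmod (f x))"
proof -
  have "cmod (fourier f \<xi>) \<le> (LINT x|lborel. cmod (cis (- (x \<bullet> \<xi>)) * f x))"
    unfolding fourier_def by (rule integral_norm_bound)
  then show ?thesis
    by (simp add: norm_mult)
qed

text \<open>Fubini: the phase has modulus 1, so the double integrand is dominated by a product of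
  integrable functions. The Plancherel proof applies it to a Gaussian and an
  autocorrelation.\<close>

lemma fourier_multiplication_formula:
  fixes f g :: "real^'n \<Rightarrow> complex"
  assumes f: "integrable lborel f" and g: "integrable lborel g"
  shows "(LINT \<xi>|lborel. g \<xi> * fourier f \<xi>) = (LINT x|lborel. fourier g x * f x)"
proof -
  have "integrable (lborel \<Otimes>\<^sub>M lborel) (\<lambda>p. cis (- (snd p \<bullet> fst p)) * (case p of (\<xi>, x) \<Rightarrow> g \<xi> * f x))"
    by (intro integrable_cis_mult integrable_pair_mult f g) measurable
  then have int: "integrable (lborel \<Otimes>\<^sub>M lborel) (\<lambda>(\<xi>, x). cis (- (x \<bullet> \<xi>)) * g \<xi> * f x)"
    by (simp add: case_prod_beta' mult_ac)
  have "(LINT \<xi>|lborel. g \<xi> * fourier f \<xi>) = (LINT \<xi>|lborel. LINT x|lborel. cis (- (x \<bullet> \<xi>)) * g \<xi> * f x)"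
    unfolding fourier_def by (simp only: integral_mult_right_zero[symmetric] mult_ac)
  also have "\<dots> = (LINT x|lborel. LINT \<xi>|lborel. cis (- (x \<bullet> \<xi>)) * g \<xi> * f x)"
    by (rule lborel_pair.Fubini_integral[OF int, symmetric])
  also have "\<dots> = (LINT x|lborel. fourier g x * f x)"
    unfolding fourier_def by (simp add: inner_commute)
  finally show ?thesis .
qed

lemma borel_measurable_cnj [measurable]: "cnj \<in> borel_measurable borel"
  by (intro borel_measurable_continuous_onI continuous_intros)

text \<open>This is the convolution of f with x |-> cnj (f (-x)). Its value at 0 is the squared L2
  norm of f and its transform is the squared modulus of that of f, which is why it links both sides
  of Plancherel.\<close>

definition autocorrelation :: "('a::euclidean_space \<Rightarrow> complex) \<Rightarrow> 'a \<Rightarrow> complex" where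
  "autocorrelation f z = (LINT x|lborel. f x * cnj (f (x - z)))"

lemma lborel_reflect:
  fixes f :: "'a::euclidean_space \<Rightarrow> 'b::{banach, second_countable_topology}"
  assumes "f \<in> borel_measurable borel"
  shows "(LINT y|lborel. f y) = (LINT z|lborel. f (x - z))"
  using integral_lborel_affine[OF assms, of "-1" x] by simp

lemma lborel_translate:
  fixes f :: "'a::euclidean_space \<Rightarrow> 'b::{banach, second_countable_topology}"
  assumes "f \<in> borel_measurable borel"
  shows "(LINT y|lborel. f (y - z)) = (LINT y|lborel. f y)"
  using integral_lborel_affine[OF assms, of 1 "-z"] by simp

lemma integrable_translate:
  fixes f :: "'a::euclidean_space \<Rightarrow> 'b::{banach, second_countable_topology}"
  assumes "integrable lborel f"
  shows "integrable lborel (\<lambda>x. f (x - z))"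
  using integrable_lborel_affine[OF assms, of 1 "-z"] by simp

text \<open>Tonelli: for fixed x, the reflection z |-> x - z shows that the modulus integrates in z
  to |f x| times the L1 norm of f.\<close>

lemma autocorrelation_integrand:
  fixes f :: "'a::euclidean_space \<Rightarrow> complex"
  assumes f: "integrable lborel f"
  shows "integrable (lborel \<Otimes>\<^sub>M lborel) (\<lambda>(x, z). f x * cnj (f (x - z)))"
proof (rule lborel_pair.Fubini_integrable)
  note [measurable] = borel_measurable_integrable[OF f]
  show "(\<lambda>(x, z). f x * cnj (f (x - z))) \<in> borel_measurable (lborel \<Otimes>\<^sub>M lborel)"
    by measurable
  have r: "integrable lborel (\<lambda>z. f (x - z))" for x
    using integrable_lborel_affine[OF f, of "-1" x] by simp
  show "AE x in lborel. integrable lborel (\<lambda>z. case (x, z) of (x, z) \<Rightarrow> f x * cnj (f (x - z)))"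
    using r by simp
  have "(\<lambda>x. LINT z|lborel. norm (case (x, z) of (x, z) \<Rightarrow> f x * cnj (f (x - z))))
      = (\<lambda>x. cmod (f x) * (LINT z|lborel. cmod (f z)))"
    by (intro ext) (simp add: norm_mult lborel_reflect[of "\<lambda>z. cmod (f z)", symmetric])
  then show "integrable lborel (\<lambda>x. LINT z|lborel. norm (case (x, z) of (x, z) \<Rightarrow> f x * cnj (f (x - z))))"
    using f by simp
qed

lemma fourier_autocorrelation:
  fixes f :: "real^'n \<Rightarrow> complex"
  assumes f: "integrable lborel f"
  shows "integrable lborel (autocorrelation f)"
    and "fourier (autocorrelation f) \<xi> = of_real ((cmod (fourier f \<xi>))\<^sup>2)"
proof -
  note [measurable] = borel_measurable_integrable[OF f]
  have [measurable]: "cis \<in> borel_measurable borel"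
    by (intro borel_measurable_continuous_onI continuous_intros)
  note int = autocorrelation_integrand[OF f]
  show "integrable lborel (autocorrelation f)"
    unfolding autocorrelation_def[abs_def] using lborel_pair.integrable_snd[OF int] by simp
  have "integrable (lborel \<Otimes>\<^sub>M lborel) (\<lambda>p. cis (- (snd p \<bullet> \<xi>)) * (case p of (x, z) \<Rightarrow> f x * cnj (f (x - z))))"
    by (intro integrable_cis_mult int) measurable
  then have int': "integrable (lborel \<Otimes>\<^sub>M lborel) (\<lambda>(x, z). cis (- (z \<bullet> \<xi>)) * (f x * cnj (f (x - z))))"
    by (simp add: case_prod_beta' mult_ac)
  have reflect: "fourier f \<xi> = (LINT z|lborel. cis (- ((x - z) \<bullet> \<xi>)) * f (x - z))" for x
    unfolding fourier_def by (rule lborel_reflect) measurable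
  have inner: "(LINT z|lborel. a * cnj (cis (- ((x - z) \<bullet> \<xi>)) * f (x - z))) = a * cnj (fourier f \<xi>)" for a x
    by (subst reflect[of x]) (simp only: integral_mult_right_zero Bochner_Integration.integral_cnj)
  \<comment> \<open>Splitting the phase in z into one in x and a conjugate one in x - z decouples
    the double integral into \<open>fourier f \<xi>\<close> times its conjugate.\<close>
  have phase: "cis (- (x \<bullet> \<xi>)) * cnj (cis (- ((x - z) \<bullet> \<xi>))) = cis (- (z \<bullet> \<xi>))" for x z :: "real^'n"
    by (simp add: cis_cnj cis_mult inner_diff_left)
  have "fourier (autocorrelation f) \<xi> = (LINT z|lborel. LINT x|lborel. cis (- (z \<bullet> \<xi>)) * (f x * cnj (f (x - z))))"
    unfolding fourier_def autocorrelation_def by simp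
  also have "\<dots> = (LINT x|lborel. LINT z|lborel. cis (- (z \<bullet> \<xi>)) * (f x * cnj (f (x - z))))"
    by (rule lborel_pair.Fubini_integral[OF int'])
  also have "\<dots> = (LINT x|lborel. LINT z|lborel. cis (- (x \<bullet> \<xi>)) * f x * cnj (cis (- ((x - z) \<bullet> \<xi>)) * f (x - z)))"
    by (intro Bochner_Integration.integral_cong refl) (simp add: phase[symmetric] mult_ac)
  also have "\<dots> = (LINT x|lborel. cis (- (x \<bullet> \<xi>)) * f x * cnj (fourier f \<xi>))"
    by (simp only: inner)
  also have "\<dots> = fourier f \<xi> * cnj (fourier f \<xi>)"
    unfolding fourier_def[of f] by simp
  finally show "fourier (autocorrelation f) \<xi> = of_real ((cmod (fourier f \<xi>))\<^sup>2)"
    by (simp only: complex_norm_square)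
qed

section \<open>Translation continuity and the Plancherel theorem\<close>

lemma integrable_norm_diff_sq:
  fixes f g :: "'a \<Rightarrow> complex"
  assumes [measurable]: "f \<in> borel_measurable M" "g \<in> borel_measurable M"
    and f: "integrable M (\<lambda>x. (cmod (f x))\<^sup>2)" and g: "integrable M (\<lambda>x. (cmod (g x))\<^sup>2)"
  shows "integrable M (\<lambda>x. (cmod (f x - g x))\<^sup>2)"
    and "(LINT x|M. (cmod (f x - g x))\<^sup>2) \<le> 2 * (LINT x|M. (cmod (f x))\<^sup>2) + 2 * (LINT x|M. (cmod (g x))\<^sup>2)"
proof -
  have le: "(cmod (a - b))\<^sup>2 \<le> 2 * (cmod a)\<^sup>2 + 2 * (cmod b)\<^sup>2" for a b
  proof -
    have "(cmod (a - b))\<^sup>2 \<le> (cmod a + cmod b)\<^sup>2"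
      by (intro power_mono norm_triangle_ineq4) auto
    also have "\<dots> \<le> 2 * (cmod a)\<^sup>2 + 2 * (cmod b)\<^sup>2"
      using zero_le_power2[of "cmod a - cmod b"] by (simp add: power2_eq_square algebra_simps)
    finally show ?thesis .
  qed
  have int: "integrable M (\<lambda>x. 2 * (cmod (f x))\<^sup>2 + 2 * (cmod (g x))\<^sup>2)"
    using f g by simp
  show *: "integrable M (\<lambda>x. (cmod (f x - g x))\<^sup>2)"
    by (rule Bochner_Integration.integrable_bound[OF int]) (use le in \<open>auto intro: order_trans[OF _ abs_ge_self]\<close>)
  show "(LINT x|M. (cmod (f x - g x))\<^sup>2) \<le> 2 * (LINT x|M. (cmod (f x))\<^sup>2) + 2 * (LINT x|M. (cmod (g x))\<^sup>2)"
    using integral_mono[OF * int le] f g by simp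
qed

lemma L2_approx_bounded_support:
  fixes f :: "'a::euclidean_space \<Rightarrow> complex"
  assumes [measurable]: "f \<in> borel_measurable lborel"
    and f: "integrable lborel (\<lambda>x. (cmod (f x))\<^sup>2)" and e: "e > 0"
  obtains k :: nat where
    "(LINT x|lborel. (cmod (f x - (if norm x \<le> real k \<and> cmod (f x) \<le> real k then f x else 0)))\<^sup>2) < e"
proof -
  let ?h = "\<lambda>k x. if norm x \<le> real k \<and> cmod (f x) \<le> real k then f x else 0"
  have "(\<lambda>k. LINT x|lborel. (cmod (f x - ?h k x))\<^sup>2) \<longlonglongrightarrow> (LINT x|(lborel :: 'a measure). 0)"
  proof (rule integral_dominated_convergence[OF _ _ f])
    show "AE x in lborel. (\<lambda>k. (cmod (f x - ?h k x))\<^sup>2) \<longlonglongrightarrow> 0"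
    proof (intro AE_I2 tendsto_eventually)
      fix x
      obtain K where "max (norm x) (cmod (f x)) \<le> real K"
        using real_arch_simple by blast
      then show "\<forall>\<^sub>F k in sequentially. (cmod (f x - ?h k x))\<^sup>2 = 0"
        unfolding eventually_sequentially
        by (intro exI[of _ K]) auto
    qed
  qed auto
  then have "\<forall>\<^sub>F k in sequentially. (LINT x|lborel. (cmod (f x - ?h k x))\<^sup>2) < e"
    using order_tendstoD(2)[of _ 0 sequentially e] e by simp
  then show thesis
    using that by (auto simp: eventually_sequentially)
qed

text \<open>A truncation h of f is bounded with bounded support, and a measurable function is an
  almost everywhere limit of continuous ones. Those need be neither bounded nor supported in a
  common ball, so they are clipped in value and cut off in space before dominated convergence is
  applied.\<close>

lemma L2_approx_continuous_compact_support:
  fixes f :: "'a::euclidean_space \<Rightarrow> complex"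
  assumes [measurable]: "f \<in> borel_measurable lborel"
    and f: "integrable lborel (\<lambda>x. (cmod (f x))\<^sup>2)" and e: "e > 0"
  obtains \<phi> R M where "continuous_on UNIV \<phi>" "\<And>x. norm x > R \<Longrightarrow> \<phi> x = 0" "\<And>x. cmod (\<phi> x) \<le> M"
    "integrable lborel (\<lambda>x. (cmod (\<phi> x))\<^sup>2)" "(LINT x|lborel. (cmod (f x - \<phi> x))\<^sup>2) < e"
proof -
  obtain k where k: "(LINT x|lborel. (cmod (f x - (if norm x \<le> real k \<and> cmod (f x) \<le> real k then f x else 0)))\<^sup>2) < e / 4"
    by (rule L2_approx_bounded_support[OF assms(1) f, of "e / 4"]) (use e in auto)
  define h where "h = (\<lambda>x. if norm x \<le> real k \<and> cmod (f x) \<le> real k then f x else 0)"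
  have [measurable]: "h \<in> borel_measurable borel"
    unfolding h_def by measurable
  have h: "cmod (h x) \<le> k" "norm x > k \<Longrightarrow> h x = 0" for x
    by (auto simp: h_def)
  have h_sq: "integrable lborel (\<lambda>x. (cmod (h x))\<^sup>2)"
    by (rule Bochner_Integration.integrable_bound[OF f]) (auto simp: h_def)
  have "h \<in> borel_measurable lebesgue"
    by (rule measurable_completion) measurable
  then have "h measurable_on UNIV"
    by (intro lebesgue_measurable_imp_measurable_on) auto
  then obtain N g where N: "negligible N" and g: "\<And>n. continuous_on UNIV (g n)"
    and lim: "\<And>x. x \<notin> N \<Longrightarrow> (\<lambda>n. g n x) \<longlonglongrightarrow> h x"
    unfolding measurable_on_def by auto
  have "AE x in lebesgue. x \<notin> N"
    using N by (intro AE_not_in) (simp add: negligible_iff_null_sets)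
  then have aeN: "AE x in lborel. x \<notin> N"
    by (simp add: AE_completion_iff)
  \<comment> \<open>Radial projection onto the disc of radius k; it fixes the values of h. For
    \<open>k = 0\<close> the denominator may vanish, but T is then identically 0, hence the
    recurring case split.\<close>
  define T :: "complex \<Rightarrow> complex" where "T w = (real k / max (real k) (cmod w)) *\<^sub>R w" for w
  define cut :: "'a \<Rightarrow> real" where "cut x = max 0 (min 1 (real k + 1 - norm x))" for x
  define \<phi> where "\<phi> n x = cut x *\<^sub>R T (g n x)" for n x
  have max_nz: "max (real k) (cmod w) \<noteq> 0" if "k \<noteq> 0" for w
    using that by (intro less_imp_neq[symmetric]) (simp add: less_max_iff_disj)
  have T_le: "cmod (T w) \<le> k" for w
  proof (cases "k = 0")
    case False
    then have "max (real k) (cmod w) > 0"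
      by (simp add: less_max_iff_disj)
    then show ?thesis
      unfolding T_def by (simp add: divide_le_eq mult_left_mono)
  qed (auto simp: T_def)
  have chi: "0 \<le> cut x" "cut x \<le> 1" "norm x > k + 1 \<Longrightarrow> cut x = 0" "norm x \<le> k \<Longrightarrow> cut x = 1" for x
    by (auto simp: cut_def)
  have phi_le: "cmod (\<phi> n x) \<le> k" for n x
    using mult_mono[OF chi(2)[of x] T_le[of "g n x"]] chi(1)[of x] by (simp add: \<phi>_def)
  have phi_0: "norm x > k + 1 \<Longrightarrow> \<phi> n x = 0" for n x
    by (simp add: \<phi>_def chi)
  have phi_cont: "continuous_on UNIV (\<phi> n)" for n
  proof (cases "k = 0")
    case True
    then show ?thesis by (simp add: \<phi>_def T_def)
  next
    case False
    show ?thesis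
      unfolding \<phi>_def cut_def T_def by (intro continuous_intros g ballI max_nz False)
  qed
  have [measurable]: "\<phi> n \<in> borel_measurable borel" for n
    using phi_cont by (rule borel_measurable_continuous_onI)
  define w where "w = (\<lambda>x::'a. (2 * real k)\<^sup>2 * indicator (cball 0 (real k + 1)) x :: real)"
  have w: "integrable lborel w"
    unfolding w_def by (intro integrable_mult_right integrable_real_indicator emeasure_bounded_finite) simp_all
  have bound: "(cmod (h x - \<phi> n x))\<^sup>2 \<le> w x" for x n
  proof (cases "norm x \<le> k + 1")
    case True
    have "cmod (h x - \<phi> n x) \<le> 2 * real k"
      using norm_triangle_ineq4[of "h x" "\<phi> n x"] h(1)[of x] phi_le[of n x] by simp
    from power_mono[OF this norm_ge_zero, of 2] show ?thesis
      using True by (simp add: w_def)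
  next
    case False
    then show ?thesis
      using h(2)[of x] phi_0[of x n] by (simp add: w_def)
  qed
  have "(\<lambda>n. LINT x|lborel. (cmod (h x - \<phi> n x))\<^sup>2) \<longlonglongrightarrow> (LINT x|(lborel :: 'a measure). 0)"
  proof (rule integral_dominated_convergence[OF _ _ w])
    show "AE x in lborel. (\<lambda>n. (cmod (h x - \<phi> n x))\<^sup>2) \<longlonglongrightarrow> 0"
      using aeN
    proof eventually_elim
      case (elim x)
      have T_h: "T (h x) = h x"
        using h(1)[of x] by (cases "k = 0") (auto simp: T_def max_def)
      have "(\<lambda>n. T (g n x)) \<longlonglongrightarrow> T (h x)"
      proof (cases "k = 0")
        case False
        show ?thesis
          unfolding T_def by (intro tendsto_intros lim elim max_nz False)
      qed (simp add: T_def)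
      then have "(\<lambda>n. \<phi> n x) \<longlonglongrightarrow> cut x *\<^sub>R h x"
        unfolding \<phi>_def T_h by (intro tendsto_intros)
      also have "cut x *\<^sub>R h x = h x"
        using h(2)[of x] chi(4)[of x] by (cases "norm x \<le> k") auto
      finally have "(\<lambda>n. (cmod (h x - \<phi> n x))\<^sup>2) \<longlonglongrightarrow> (cmod (h x - h x))\<^sup>2"
        by (intro tendsto_intros)
      then show ?case by simp
    qed
  qed (use bound in auto)
  then have "\<forall>\<^sub>F n in sequentially. (LINT x|lborel. (cmod (h x - \<phi> n x))\<^sup>2) < e / 4"
    using order_tendstoD(2)[of _ 0 sequentially "e / 4"] e by simp
  then obtain n where n: "(LINT x|lborel. (cmod (h x - \<phi> n x))\<^sup>2) < e / 4"
    by (auto simp: eventually_sequentially)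
  have int: "integrable lborel (\<lambda>x. (cmod (h x - \<phi> n x))\<^sup>2)"
    by (rule Bochner_Integration.integrable_bound[OF w]) (use bound in \<open>auto intro: order_trans[OF _ abs_ge_self]\<close>)
  have phi_sq: "integrable lborel (\<lambda>x. (cmod (\<phi> n x))\<^sup>2)"
    using integrable_norm_diff_sq(1)[OF _ _ h_sq int] by simp
  have "(LINT x|lborel. (cmod (f x - \<phi> n x))\<^sup>2) =
        (LINT x|lborel. (cmod ((f x - h x) - (\<phi> n x - h x)))\<^sup>2)"
    by simp
  also have "\<dots> \<le> 2 * (LINT x|lborel. (cmod (f x - h x))\<^sup>2) + 2 * (LINT x|lborel. (cmod (\<phi> n x - h x))\<^sup>2)"
    by (intro integrable_norm_diff_sq f h_sq phi_sq) measurable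
  also have "\<dots> < e"
    using k n by (simp add: h_def norm_minus_commute)
  finally show thesis
    by (intro that[of "\<phi> n" "k + 1" k] phi_cont phi_le phi_sq) (auto intro: phi_0)
qed

text \<open>The claim holds for continuous compactly supported functions by dominated convergence
  and passes to f because translation preserves the L2 norm.\<close>

lemma L2_translation_continuous:
  fixes f :: "'a::euclidean_space \<Rightarrow> complex"
  assumes [measurable]: "f \<in> borel_measurable lborel"
    and f: "integrable lborel (\<lambda>x. (cmod (f x))\<^sup>2)" and z: "z \<longlonglongrightarrow> 0"
  shows "(\<lambda>k. LINT x|lborel. (cmod (f x - f (x - z k)))\<^sup>2) \<longlonglongrightarrow> 0"
proof (rule LIMSEQ_I)
  fix e :: real assume e: "e > 0"
  \<comment> \<open>Two uses of |x - y|^2 <= 2 |x|^2 + 2 |y|^2 multiply the approximation error by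
    8, so \<open>e / 16\<close> leaves half of e for the translation of \<phi>.\<close>
  obtain \<phi> R M where cont: "continuous_on UNIV \<phi>" and supp: "\<And>x. norm x > R \<Longrightarrow> \<phi> x = 0"
    and M: "\<And>x. cmod (\<phi> x) \<le> M" and phi_sq: "integrable lborel (\<lambda>x. (cmod (\<phi> x))\<^sup>2)"
    and close: "(LINT x|lborel. (cmod (f x - \<phi> x))\<^sup>2) < e / 16"
    by (rule L2_approx_continuous_compact_support[OF assms(1) f, of "e / 16"]) (use e in auto)
  have [measurable]: "\<phi> \<in> borel_measurable borel"
    using cont by (rule borel_measurable_continuous_onI)
  obtain B where B: "\<And>k. norm (z k) \<le> B"
    using convergent_imp_Bseq[of z] z by (auto simp: convergent_def Bseq_def)
  \<comment> \<open>Outside radius \<open>R + B\<close> both x and \<open>x - z k\<close> lie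
    outside the support of \<phi>, so one majorant works for every k.\<close>
  define w where "w = (\<lambda>x::'a. (2 * M)\<^sup>2 * indicator (cball 0 (R + B)) x :: real)"
  have w: "integrable lborel w"
    unfolding w_def by (intro integrable_mult_right integrable_real_indicator emeasure_bounded_finite) simp_all
  have "(\<lambda>k. LINT x|lborel. (cmod (\<phi> x - \<phi> (x - z k)))\<^sup>2) \<longlonglongrightarrow> (LINT x|(lborel :: 'a measure). 0)"
  proof (rule integral_dominated_convergence[OF _ _ w])
    show "AE x in lborel. (\<lambda>k. (cmod (\<phi> x - \<phi> (x - z k)))\<^sup>2) \<longlonglongrightarrow> 0"
    proof (rule AE_I2)
      fix x
      have "(\<lambda>k. x - z k) \<longlonglongrightarrow> x - 0"
        by (intro tendsto_intros z)
      then have "(\<lambda>k. \<phi> (x - z k)) \<longlonglongrightarrow> \<phi> x"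
        using cont by (auto intro!: isCont_tendsto_compose[of x \<phi>] simp: continuous_on_eq_continuous_at)
      then have "(\<lambda>k. (cmod (\<phi> x - \<phi> (x - z k)))\<^sup>2) \<longlonglongrightarrow> (cmod (\<phi> x - \<phi> x))\<^sup>2"
        by (intro tendsto_intros)
      then show "(\<lambda>k. (cmod (\<phi> x - \<phi> (x - z k)))\<^sup>2) \<longlonglongrightarrow> 0"
        by simp
    qed
    show "AE x in lborel. norm ((cmod (\<phi> x - \<phi> (x - z k)))\<^sup>2) \<le> w x" for k
    proof (rule AE_I2)
      fix x
      show "norm ((cmod (\<phi> x - \<phi> (x - z k)))\<^sup>2) \<le> w x"
      proof (cases "norm x \<le> R + B")
        case True
        have "cmod (\<phi> x - \<phi> (x - z k)) \<le> 2 * M"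
          using norm_triangle_ineq4[of "\<phi> x" "\<phi> (x - z k)"] M[of x] M[of "x - z k"] by simp
        from power_mono[OF this norm_ge_zero, of 2] show ?thesis
          using True by (simp add: w_def)
      next
        case False
        then have "norm x > R" "norm (x - z k) > R"
          using B[of k] norm_ge_zero[of "z k"] norm_triangle_ineq2[of x "z k"] by linarith+
        then show ?thesis
          by (simp add: supp w_def)
      qed
    qed
  qed auto
  then have "\<forall>\<^sub>F k in sequentially. (LINT x|lborel. (cmod (\<phi> x - \<phi> (x - z k)))\<^sup>2) < e / 4"
    using order_tendstoD(2)[of _ 0 sequentially "e / 4"] e by simp
  then obtain K where K: "\<And>k. k \<ge> K \<Longrightarrow> (LINT x|lborel. (cmod (\<phi> x - \<phi> (x - z k)))\<^sup>2) < e / 4"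
    by (auto simp: eventually_sequentially)
  have "norm ((LINT x|lborel. (cmod (f x - f (x - z k)))\<^sup>2) - 0) < e" if "k \<ge> K" for k
  proof -
    let ?d = "\<lambda>x. f x - \<phi> x"
    have d: "integrable lborel (\<lambda>x. (cmod (?d x))\<^sup>2)"
      by (intro integrable_norm_diff_sq f phi_sq) measurable
    have d': "integrable lborel (\<lambda>x. (cmod (?d (x - z k)))\<^sup>2)"
      by (rule integrable_translate[OF d])
    have p': "integrable lborel (\<lambda>x. (cmod (\<phi> (x - z k)))\<^sup>2)"
      by (rule integrable_translate[OF phi_sq])
    have dd: "integrable lborel (\<lambda>x. (cmod (?d x - ?d (x - z k)))\<^sup>2)"
      by (intro integrable_norm_diff_sq d d') measurable
    have pp: "integrable lborel (\<lambda>x. (cmod (\<phi> (x - z k) - \<phi> x))\<^sup>2)"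
      by (intro integrable_norm_diff_sq phi_sq p') measurable
    have "(LINT x|lborel. (cmod (f x - f (x - z k)))\<^sup>2)
        = (LINT x|lborel. (cmod ((?d x - ?d (x - z k)) - (\<phi> (x - z k) - \<phi> x)))\<^sup>2)"
      by (simp add: algebra_simps)
    also have "\<dots> \<le> 2 * (LINT x|lborel. (cmod (?d x - ?d (x - z k)))\<^sup>2) + 2 * (LINT x|lborel. (cmod (\<phi> (x - z k) - \<phi> x))\<^sup>2)"
      by (intro integrable_norm_diff_sq dd pp) measurable
    also have "(LINT x|lborel. (cmod (?d x - ?d (x - z k)))\<^sup>2)
        \<le> 2 * (LINT x|lborel. (cmod (?d x))\<^sup>2) + 2 * (LINT x|lborel. (cmod (?d (x - z k)))\<^sup>2)"
      by (intro integrable_norm_diff_sq d d') measurable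
    also have "(LINT x|lborel. (cmod (?d (x - z k)))\<^sup>2) = (LINT x|lborel. (cmod (?d x))\<^sup>2)"
      by (rule lborel_translate[of "\<lambda>x. (cmod (?d x))\<^sup>2"]) measurable
    finally have "(LINT x|lborel. (cmod (f x - f (x - z k)))\<^sup>2) < e"
      using close K[OF that] by (simp add: norm_minus_commute)
    then show ?thesis
      by simp
  qed
  then show "\<exists>K. \<forall>k\<ge>K. norm ((LINT x|lborel. (cmod (f x - f (x - z k)))\<^sup>2) - 0) < e"
    by blast
qed


text \<open>Polarisation makes the behaviour of the autocorrelation at \<open>0\<close> a matter of translation continuity alone.\<close>

lemma Re_autocorrelation:
  fixes f :: "'a::euclidean_space \<Rightarrow> complex"
  assumes [measurable]: "f \<in> borel_measurable lborel"
    and f: "integrable lborel (\<lambda>x. (cmod (f x))\<^sup>2)"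
  shows "Re (autocorrelation f z) =
    (LINT x|lborel. (cmod (f x))\<^sup>2) - (1/2) * (LINT x|lborel. (cmod (f x - f (x - z)))\<^sup>2)"
proof -
  have f': "integrable lborel (\<lambda>x. (cmod (f (x - z)))\<^sup>2)"
    by (rule integrable_translate[OF f])
  have d: "integrable lborel (\<lambda>x. (cmod (f x - f (x - z)))\<^sup>2)"
    by (intro integrable_norm_diff_sq f f') measurable
  have polar: "Re (a * cnj b) = ((cmod a)\<^sup>2 + (cmod b)\<^sup>2 - (cmod (a - b))\<^sup>2) / 2" for a b
    by (simp add: cmod_power2) (simp add: power2_eq_square algebra_simps)
  have le: "cmod (a * cnj b) \<le> (cmod a)\<^sup>2 + (cmod b)\<^sup>2" for a b
  proof -
    have "0 \<le> cmod a * cmod b" by simp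
    moreover have "2 * (cmod a * cmod b) \<le> (cmod a)\<^sup>2 + (cmod b)\<^sup>2"
      using zero_le_power2[of "cmod a - cmod b"] by (simp add: power2_eq_square algebra_simps)
    ultimately show ?thesis
      unfolding norm_mult complex_mod_cnj by linarith
  qed
  have int: "integrable lborel (\<lambda>x. f x * cnj (f (x - z)))"
    by (rule Bochner_Integration.integrable_bound[OF Bochner_Integration.integrable_add[OF f f']])
       (use le in \<open>auto intro: order_trans[OF _ abs_ge_self]\<close>)
  have "Re (autocorrelation f z) = (LINT x|lborel. Re (f x * cnj (f (x - z))))"
    unfolding autocorrelation_def using int by (simp only: integral_Re)
  also have "\<dots> = ((LINT x|lborel. (cmod (f x))\<^sup>2) + (LINT x|lborel. (cmod (f (x - z)))\<^sup>2)
      - (LINT x|lborel. (cmod (f x - f (x - z)))\<^sup>2)) / 2"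
    unfolding polar using f f' d by simp
  also have "(LINT x|lborel. (cmod (f (x - z)))\<^sup>2) = (LINT x|lborel. (cmod (f x))\<^sup>2)"
    by (rule lborel_translate[of "\<lambda>x. (cmod (f x))\<^sup>2"]) measurable
  finally show ?thesis
    by (simp add: field_simps)
qed

lemma fourier_gaussian_dilate:
  assumes k: "k > 0"
  shows "fourier (\<lambda>x::real^'n. of_real (exp (- (1/2 * (norm (x /\<^sub>R k))\<^sup>2)))) z
     = of_real (k ^ CARD('n) * (sqrt (2 * pi) ^ CARD('n) * exp (- (1/2 * (norm (k *\<^sub>R z))\<^sup>2))))"
proof -
  have [measurable]: "cis \<in> borel_measurable borel"
    by (intro borel_measurable_continuous_onI continuous_intros)
  have "fourier (\<lambda>x::real^'n. of_real (exp (- (1/2 * (norm (x /\<^sub>R k))\<^sup>2)))) z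
     = \<bar>k\<bar> ^ CARD('n) *\<^sub>R (LINT x|lborel. cis (- ((0 + k *\<^sub>R x) \<bullet> z)) * of_real (exp (- (1/2 * (norm ((0 + k *\<^sub>R x) /\<^sub>R k))\<^sup>2))))"
    unfolding fourier_def using k by (subst integral_lborel_affine[where c = k and t = 0]) auto
  also have "\<dots> = \<bar>k\<bar> ^ CARD('n) *\<^sub>R fourier (\<lambda>x::real^'n. of_real (exp (- (1/2 * (norm x)\<^sup>2)))) (k *\<^sub>R z)"
    unfolding fourier_def using k by (simp add: mult_ac)
  finally show ?thesis
    unfolding gaussian_fourier using k by (simp add: scaleR_conv_of_real)
qed

text \<open>The multiplication formula moves the transform from the autocorrelation to a Gaussian of
  width k. Substituting z = y / k then makes the Gaussian weight independent of k and leaves k only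
  in the argument of the autocorrelation, which tends to 0.\<close>

lemma plancherel_gaussian_mean:
  fixes f :: "real^'n \<Rightarrow> complex"
  assumes f1: "integrable lborel f" and f2: "integrable lborel (\<lambda>x. (cmod (f x))\<^sup>2)" and k: "k > 0"
  shows "integrable lborel (\<lambda>\<xi>. exp (- (1/2 * (norm (\<xi> /\<^sub>R k))\<^sup>2)) * (cmod (fourier f \<xi>))\<^sup>2)"
    and "(LINT \<xi>|lborel. exp (- (1/2 * (norm (\<xi> /\<^sub>R k))\<^sup>2)) * (cmod (fourier f \<xi>))\<^sup>2) =
      sqrt (2 * pi) ^ CARD('n) * (LINT y|lborel. exp (- (1/2 * (norm y)\<^sup>2)) * Re (autocorrelation f (y /\<^sub>R k)))"
proof -
  note [measurable] = borel_measurable_integrable[OF f1]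
  define g :: "real^'n \<Rightarrow> real" where "g \<xi> = exp (- (1/2 * (norm (\<xi> /\<^sub>R k))\<^sup>2))" for \<xi>
  have g: "integrable lborel g"
    using integrable_gaussian[of "1/2 / k\<^sup>2", where 'a = "real^'n"] k
    by (simp add: g_def[abs_def] power_mult_distrib power_inverse field_simps)
  have [measurable]: "fourier f \<in> borel_measurable borel"
    by (rule borel_measurable_fourier) measurable
  have "integrable lborel (\<lambda>\<xi>. g \<xi> * (LINT x|lborel. cmod (f x))\<^sup>2)"
    using g by simp
  then show int: "integrable lborel (\<lambda>\<xi>. exp (- (1/2 * (norm (\<xi> /\<^sub>R k))\<^sup>2)) * (cmod (fourier f \<xi>))\<^sup>2)"
    unfolding g_def[symmetric]
    by (rule Bochner_Integration.integrable_bound)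
       (auto simp: g_def abs_mult intro!: power_mono mult_left_mono fourier_bound f1)
  have A: "integrable lborel (autocorrelation f)"
    by (rule fourier_autocorrelation(1)[OF f1])
  note [measurable] = borel_measurable_integrable[OF A]
  have "of_real (LINT \<xi>|lborel. g \<xi> * (cmod (fourier f \<xi>))\<^sup>2)
      = (LINT \<xi>|lborel. of_real (g \<xi>) * fourier (autocorrelation f) \<xi>)"
    unfolding fourier_autocorrelation(2)[OF f1] by (simp flip: of_real_mult of_real_power)
  also have "\<dots> = (LINT z|lborel. fourier (\<lambda>\<xi>. of_real (g \<xi>)) z * autocorrelation f z)"
    using g by (intro fourier_multiplication_formula A) simp
  finally have "(LINT \<xi>|lborel. g \<xi> * (cmod (fourier f \<xi>))\<^sup>2)
      = Re (LINT z|lborel. fourier (\<lambda>\<xi>. of_real (g \<xi>)) z * autocorrelation f z)"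
    by (metis Re_complex_of_real)
  also have "(\<lambda>z. fourier (\<lambda>\<xi>. of_real (g \<xi>)) z * autocorrelation f z) =
      (\<lambda>z. (k * sqrt (2 * pi)) ^ CARD('n) *\<^sub>R (exp (- (1/2 * (norm (k *\<^sub>R z))\<^sup>2)) *\<^sub>R autocorrelation f z))"
    unfolding g_def fourier_gaussian_dilate[OF k] by (simp add: scaleR_conv_of_real power_mult_distrib mult_ac)
  also have "(LINT z|lborel. (k * sqrt (2 * pi)) ^ CARD('n) *\<^sub>R (exp (- (1/2 * (norm (k *\<^sub>R z))\<^sup>2)) *\<^sub>R autocorrelation f z))
     = (k * sqrt (2 * pi)) ^ CARD('n) *\<^sub>R (LINT z|lborel. exp (- (1/2 * (norm (k *\<^sub>R z))\<^sup>2)) *\<^sub>R autocorrelation f z)"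
    by (rule integral_scaleR_right)
  also have "(LINT z|lborel. exp (- (1/2 * (norm (k *\<^sub>R z))\<^sup>2)) *\<^sub>R autocorrelation f z)
     = \<bar>1/k\<bar> ^ CARD('n) *\<^sub>R (LINT y|lborel. exp (- (1/2 * (norm (k *\<^sub>R (0 + (1/k) *\<^sub>R y)))\<^sup>2)) *\<^sub>R autocorrelation f (0 + (1/k) *\<^sub>R y))"
    using k by (subst integral_lborel_affine[where c = "1/k" and t = 0]) auto
  also have "\<dots> = (1/k) ^ CARD('n) *\<^sub>R (LINT y|lborel. exp (- (1/2 * (norm y)\<^sup>2)) *\<^sub>R autocorrelation f (y /\<^sub>R k))"
    using k by (simp add: field_simps)
  finally have eq: "(LINT \<xi>|lborel. g \<xi> * (cmod (fourier f \<xi>))\<^sup>2) =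
      sqrt (2 * pi) ^ CARD('n) * Re (LINT y|lborel. exp (- (1/2 * (norm y)\<^sup>2)) *\<^sub>R autocorrelation f (y /\<^sub>R k))"
    using k by (simp add: power_mult_distrib power_divide)
  have "integrable lborel (\<lambda>y. autocorrelation f (y /\<^sub>R k))"
    using integrable_lborel_affine[OF A, of "inverse k" 0] k by simp
  then have "integrable lborel (\<lambda>y. exp (- (1/2 * (norm y)\<^sup>2)) *\<^sub>R autocorrelation f (y /\<^sub>R k))"
    by (rule Bochner_Integration.integrable_bound) (auto intro!: mult_left_le_one_le)
  then have "Re (LINT y|lborel. exp (- (1/2 * (norm y)\<^sup>2)) *\<^sub>R autocorrelation f (y /\<^sub>R k))
     = (LINT y|lborel. exp (- (1/2 * (norm y)\<^sup>2)) * Re (autocorrelation f (y /\<^sub>R k)))"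
    by (subst integral_Re[symmetric]) auto
  with eq show "(LINT \<xi>|lborel. exp (- (1/2 * (norm (\<xi> /\<^sub>R k))\<^sup>2)) * (cmod (fourier f \<xi>))\<^sup>2) =
      sqrt (2 * pi) ^ CARD('n) * (LINT y|lborel. exp (- (1/2 * (norm y)\<^sup>2)) * Re (autocorrelation f (y /\<^sub>R k)))"
    by (simp add: g_def)
qed

text \<open>Let the width k = j + 1 of the Gaussian mean tend to infinity. The frequency side
  increases to the desired integral; the space side converges by dominated convergence, because the
  real part of the autocorrelation tends to Q at 0.\<close>

theorem plancherel:
  fixes f :: "real^'n \<Rightarrow> complex"
  assumes f1: "integrable lborel f" and f2: "integrable lborel (\<lambda>x. (cmod (f x))\<^sup>2)"
  shows "integrable lborel (\<lambda>\<xi>. (cmod (fourier f \<xi>))\<^sup>2)"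
    and "(LINT \<xi>|lborel. (cmod (fourier f \<xi>))\<^sup>2) = (2 * pi) ^ CARD('n) * (LINT x|lborel. (cmod (f x))\<^sup>2)"
proof -
  note [measurable] = borel_measurable_integrable[OF f1]
  have [measurable]: "fourier f \<in> borel_measurable borel"
    by (rule borel_measurable_fourier) measurable
  note [measurable] = borel_measurable_integrable[OF fourier_autocorrelation(1)[OF f1]]
  define Q where "Q = (LINT x|lborel. (cmod (f x))\<^sup>2)"
  define G :: "real^'n \<Rightarrow> real" where "G y = exp (- (1/2 * (norm y)\<^sup>2))" for y
  have G: "integrable lborel G"
    unfolding G_def by (rule integrable_gaussian) simp
  \<comment> \<open>The mass of the Gaussian is read off from its transform at the origin.\<close>
  have "of_real (LINT y|lborel. G y) = fourier (\<lambda>y. of_real (G y)) 0"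
    by (simp add: fourier_def)
  also have "\<dots> = of_real (sqrt (2 * pi) ^ CARD('n))"
    unfolding G_def gaussian_fourier by simp
  finally have G_int: "(LINT y|lborel. G y) = sqrt (2 * pi) ^ CARD('n)"
    by (simp only: of_real_eq_iff)
  define u where "u j \<xi> = exp (- (1/2 * (norm (\<xi> /\<^sub>R real (Suc j)))\<^sup>2)) * (cmod (fourier f \<xi>))\<^sup>2" for j \<xi>
  have D: "integrable lborel (\<lambda>x. (cmod (f x - f (x - z)))\<^sup>2)" "(LINT x|lborel. (cmod (f x - f (x - z)))\<^sup>2) \<le> 4 * Q" for z
  proof -
    have "integrable lborel (\<lambda>x. (cmod (f (x - z)))\<^sup>2)"
      by (rule integrable_translate[OF f2])
    moreover have "(LINT x|lborel. (cmod (f (x - z)))\<^sup>2) = Q"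
      unfolding Q_def by (rule lborel_translate[of "\<lambda>x. (cmod (f x))\<^sup>2"]) measurable
    ultimately show "integrable lborel (\<lambda>x. (cmod (f x - f (x - z)))\<^sup>2)" "(LINT x|lborel. (cmod (f x - f (x - z)))\<^sup>2) \<le> 4 * Q"
      using integrable_norm_diff_sq[of f lborel "\<lambda>x. f (x - z)"] f2 by (auto simp: Q_def)
  qed
  have Re_A: "Re (autocorrelation f z) = Q - (1/2) * (LINT x|lborel. (cmod (f x - f (x - z)))\<^sup>2)" for z
    unfolding Q_def by (intro Re_autocorrelation f2) measurable
  \<comment> \<open>The polarisation formula replaces Cauchy-Schwarz: the subtracted term lies
    between 0 and 2 Q.\<close>
  have A_le: "\<bar>Re (autocorrelation f z)\<bar> \<le> Q" for z
    using D(2)[of z] unfolding Re_A by (simp add: abs_le_iff)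
  have "(\<lambda>j. LINT y|lborel. G y * Re (autocorrelation f (y /\<^sub>R real (Suc j)))) \<longlonglongrightarrow> (LINT y|lborel. G y * Q)"
  proof (rule integral_dominated_convergence)
    show "integrable lborel (\<lambda>y. G y * Q)"
      using G by simp
    show "AE y in lborel. (\<lambda>j. G y * Re (autocorrelation f (y /\<^sub>R real (Suc j)))) \<longlonglongrightarrow> G y * Q"
    proof (intro AE_I2 tendsto_intros)
      fix y :: "real^'n"
      have "(\<lambda>j. inverse (real (Suc j)) *\<^sub>R y) \<longlonglongrightarrow> 0 *\<^sub>R y"
        by (intro tendsto_intros LIMSEQ_inverse_real_of_nat)
      then have "(\<lambda>j. LINT x|lborel. (cmod (f x - f (x - y /\<^sub>R real (Suc j))))\<^sup>2) \<longlonglongrightarrow> 0"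
        by (intro L2_translation_continuous f2) auto
      then have "(\<lambda>j. Q - (1/2) * (LINT x|lborel. (cmod (f x - f (x - y /\<^sub>R real (Suc j))))\<^sup>2)) \<longlonglongrightarrow> Q - (1/2) * 0"
        by (intro tendsto_intros)
      then show "(\<lambda>j. Re (autocorrelation f (y /\<^sub>R real (Suc j)))) \<longlonglongrightarrow> Q"
        unfolding Re_A by simp
    qed
    show "AE y in lborel. norm (G y * Re (autocorrelation f (y /\<^sub>R real (Suc j)))) \<le> G y * Q" for j
      using A_le by (auto simp: G_def abs_mult intro!: mult_left_mono)
  qed (auto simp: G_def)
  then have "(\<lambda>j. sqrt (2 * pi) ^ CARD('n) * (LINT y|lborel. G y * Re (autocorrelation f (y /\<^sub>R real (Suc j)))))
      \<longlonglongrightarrow> sqrt (2 * pi) ^ CARD('n) * (LINT y|lborel. G y * Q)"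
    by (intro tendsto_intros)
  also have "sqrt (2 * pi) ^ CARD('n) * (LINT y|lborel. G y * Q) = (2 * pi) ^ CARD('n) * Q"
  proof -
    have "sqrt (2 * pi) ^ CARD('n) * sqrt (2 * pi) ^ CARD('n) = (sqrt (2 * pi) * sqrt (2 * pi)) ^ CARD('n)"
      by (rule power_mult_distrib[symmetric])
    then show ?thesis
      using G_int by (simp only: integral_mult_left_zero mult.assoc[symmetric]) simp
  qed
  finally have lim: "(\<lambda>j. integral\<^sup>L lborel (u j)) \<longlonglongrightarrow> (2 * pi) ^ CARD('n) * Q"
    unfolding u_def G_def by (subst plancherel_gaussian_mean(2)[OF f1 f2]) auto
  have *: "AE \<xi> in lborel. mono (\<lambda>j. u j \<xi>)"
  proof (intro AE_I2 monoI)
    fix i j :: nat and \<xi> :: "real^'n"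
    assume "i \<le> j"
    then have "norm (\<xi> /\<^sub>R real (Suc j)) \<le> norm (\<xi> /\<^sub>R real (Suc i))"
      by (auto intro!: mult_right_mono le_imp_inverse_le)
    then show "u i \<xi> \<le> u j \<xi>"
      unfolding u_def by (intro mult_right_mono) (auto intro: power_mono)
  qed
  have **: "AE \<xi> in lborel. (\<lambda>j. u j \<xi>) \<longlonglongrightarrow> (cmod (fourier f \<xi>))\<^sup>2"
  proof (rule AE_I2)
    fix \<xi> :: "real^'n"
    have "(\<lambda>j. inverse (real (Suc j)) *\<^sub>R \<xi>) \<longlonglongrightarrow> 0 *\<^sub>R \<xi>"
      by (intro tendsto_intros LIMSEQ_inverse_real_of_nat)
    then have "(\<lambda>j. u j \<xi>) \<longlonglongrightarrow> exp (- (1/2 * (norm (0 *\<^sub>R \<xi>))\<^sup>2)) * (cmod (fourier f \<xi>))\<^sup>2"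
      unfolding u_def by (intro tendsto_intros LIMSEQ_inverse_real_of_nat)
    then show "(\<lambda>j. u j \<xi>) \<longlonglongrightarrow> (cmod (fourier f \<xi>))\<^sup>2"
      by simp
  qed
  have ui: "integrable lborel (u j)" for j
    unfolding u_def by (rule plancherel_gaussian_mean(1)[OF f1 f2]) simp
  \<comment> \<open>Monotone convergence delivers both the integrability of the squared transform
    and its integral.\<close>
  note conv = integral_monotone_convergence_nonneg[OF ui * _ ** lim]
  show "integrable lborel (\<lambda>\<xi>. (cmod (fourier f \<xi>))\<^sup>2)"
    by (rule conv) (auto simp: u_def)
  show "(LINT \<xi>|lborel. (cmod (fourier f \<xi>))\<^sup>2) = (2 * pi) ^ CARD('n) * (LINT x|lborel. (cmod (f x))\<^sup>2)"
    unfolding Q_def[symmetric] by (rule conv) (auto simp: u_def)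
qed

section \<open>The L2 transform defined through truncations: differences and norm bound\<close>

lemma L2_norm_sq: "(L2_norm f)\<^sup>2 = (LINT x|lborel. (cmod (f x))\<^sup>2)"
  unfolding L2_norm_def by (simp add: integral_nonneg_AE)

lemma in_L2_diff:
  assumes "in_L2 f" "in_L2 g"
  shows "in_L2 (\<lambda>x. f x - g x)"
    and "(L2_norm (\<lambda>x. f x - g x))\<^sup>2 \<le> 2 * (L2_norm f)\<^sup>2 + 2 * (L2_norm g)\<^sup>2"
  using assms integrable_norm_diff_sq[of f lborel g] unfolding L2_norm_sq by (auto simp: in_L2_def)

lemma ball_truncation:
  fixes f :: "real^'n \<Rightarrow> complex"
  assumes f: "in_L2 f"
  defines "h \<equiv> \<lambda>R x. indicator (cball 0 R) x * f x"
  shows "integrable lborel (h R)" and "in_L2 (h R)"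
proof -
  have [measurable]: "f \<in> borel_measurable borel" and f2: "integrable lborel (\<lambda>x. (cmod (f x))\<^sup>2)"
    using f by (auto simp: in_L2_def)
  have b: "integrable lborel (\<lambda>x. indicator (cball (0 :: real^'n) R) x + (cmod (f x))\<^sup>2)"
    by (intro Bochner_Integration.integrable_add integrable_real_indicator emeasure_bounded_finite f2) simp_all
  \<comment> \<open>On a ball this bounds |f| by the integrable function 1 + |f|^2, so
    square-integrable functions become integrable after truncation.\<close>
  have le: "y \<le> 1 + y\<^sup>2" for y :: real
    using zero_le_power2[of "y - 1/2"] by (simp add: power2_eq_square algebra_simps)
  show "integrable lborel (h R)"
    by (rule Bochner_Integration.integrable_bound[OF b])
       (auto simp: h_def indicator_def intro!: AE_I2 le)
  show "in_L2 (h R)"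
    unfolding in_L2_def
  proof
    show "integrable lborel (\<lambda>x. (cmod (h R x))\<^sup>2)"
      by (rule Bochner_Integration.integrable_bound[OF f2]) (auto simp: h_def indicator_def)
  qed (auto simp: h_def indicator_def)
qed

lemma in_L2_fourier:
  fixes f :: "real^'n \<Rightarrow> complex"
  assumes "integrable lborel f" "in_L2 f"
  shows "in_L2 (fourier f)" and "(L2_norm (fourier f))\<^sup>2 = (2 * pi) ^ CARD('n) * (L2_norm f)\<^sup>2"
  using assms plancherel[of f] unfolding L2_norm_sq by (auto simp: in_L2_def)

text \<open>For truncations this is linearity of the integral, and the L2 limit preserves it. It
  lets the difference between the solution and its three profile terms be treated as a single
  transform pair.\<close>

lemma has_L2_fourier_diff:
  fixes f f' g g' :: "real^'n \<Rightarrow> complex"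
  assumes "has_L2_fourier f g" "has_L2_fourier f' g'"
  shows "has_L2_fourier (\<lambda>x. f x - f' x) (\<lambda>\<xi>. g \<xi> - g' \<xi>)"
proof -
  define F where "F f R = fourier (\<lambda>x. indicator (cball 0 R) x * f x)" for f :: "real^'n \<Rightarrow> complex" and R
  have L2: "in_L2 f" "in_L2 g" "in_L2 f'" "in_L2 g'"
    and lim: "((\<lambda>R. L2_norm (\<lambda>\<xi>. g \<xi> - F f R \<xi>)) \<longlongrightarrow> 0) at_top" "((\<lambda>R. L2_norm (\<lambda>\<xi>. g' \<xi> - F f' R \<xi>)) \<longlongrightarrow> 0) at_top"
    using assms by (auto simp: has_L2_fourier_def F_def)
  have F_L2: "in_L2 (F f R)" "in_L2 (F f' R)" for R
    unfolding F_def by (intro in_L2_fourier ball_truncation L2)+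
  have int: "integrable lborel (\<lambda>x. cis (- (x \<bullet> \<xi>)) * (indicator (cball 0 R) x * h x))" if "in_L2 h" for h :: "real^'n \<Rightarrow> complex" and R \<xi>
    by (intro integrable_cis_mult ball_truncation that) measurable
  have F_diff: "F (\<lambda>x. f x - f' x) R \<xi> = F f R \<xi> - F f' R \<xi>" for R \<xi>
    unfolding F_def fourier_def
    by (simp add: right_diff_distrib Bochner_Integration.integral_diff[OF int int] L2)
  have "((\<lambda>R. L2_norm (\<lambda>\<xi>. g \<xi> - g' \<xi> - F (\<lambda>x. f x - f' x) R \<xi>)) \<longlongrightarrow> 0) at_top"
  proof (rule tendsto_sandwich[OF _ _ tendsto_const])
    let ?b = "\<lambda>R. sqrt (2 * (L2_norm (\<lambda>\<xi>. g \<xi> - F f R \<xi>))\<^sup>2 + 2 * (L2_norm (\<lambda>\<xi>. g' \<xi> - F f' R \<xi>))\<^sup>2)"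
    have "(?b \<longlongrightarrow> sqrt (2 * 0\<^sup>2 + 2 * 0\<^sup>2)) at_top"
      by (intro tendsto_intros lim)
    then show "(?b \<longlongrightarrow> 0) at_top" by simp
    show "\<forall>\<^sub>F R in at_top. L2_norm (\<lambda>\<xi>. g \<xi> - g' \<xi> - F (\<lambda>x. f x - f' x) R \<xi>) \<le> ?b R"
    proof (intro always_eventually allI real_le_rsqrt)
      fix R
      have "(\<lambda>\<xi>. g \<xi> - g' \<xi> - F (\<lambda>x. f x - f' x) R \<xi>) = (\<lambda>\<xi>. (g \<xi> - F f R \<xi>) - (g' \<xi> - F f' R \<xi>))"
        by (simp add: F_diff algebra_simps)
      then show "(L2_norm (\<lambda>\<xi>. g \<xi> - g' \<xi> - F (\<lambda>x. f x - f' x) R \<xi>))\<^sup>2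
        \<le> 2 * (L2_norm (\<lambda>\<xi>. g \<xi> - F f R \<xi>))\<^sup>2 + 2 * (L2_norm (\<lambda>\<xi>. g' \<xi> - F f' R \<xi>))\<^sup>2"
        by (simp only:) (intro in_L2_diff L2 F_L2)
    qed
  qed (auto simp: L2_norm_def integral_nonneg_AE)
  then show ?thesis
    unfolding has_L2_fourier_def F_def by (intro conjI in_L2_diff L2)
qed

text \<open>The factor \<open>2\<close> comes from using \<open>\<bar>x - y\<bar>\<^sup>2 \<le> 2 \<bar>x\<bar>\<^sup>2 + 2 \<bar>y\<bar>\<^sup>2\<close> in place of Minkowski's inequality.\<close>

lemma has_L2_fourier_norm_le:
  fixes f g :: "real^'n \<Rightarrow> complex"
  assumes "has_L2_fourier f g"
  shows "(L2_norm f)\<^sup>2 \<le> 2 * (L2_norm g)\<^sup>2"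
proof -
  define h where "h R x = indicator (cball 0 R) x * f x" for R :: real and x
  have f: "in_L2 f" and g: "in_L2 g"
    and lim: "((\<lambda>R. L2_norm (\<lambda>\<xi>. g \<xi> - fourier (h R) \<xi>)) \<longlongrightarrow> 0) at_top"
    using assms by (auto simp: has_L2_fourier_def h_def[abs_def])
  have [measurable]: "f \<in> borel_measurable borel" and f2: "integrable lborel (\<lambda>x. (cmod (f x))\<^sup>2)"
    using f by (auto simp: in_L2_def)
  have h: "integrable lborel (h R)" "in_L2 (h R)" for R
    unfolding h_def[abs_def] by (intro ball_truncation f)+
  have [measurable]: "h R \<in> borel_measurable borel" for R
    using h(2) by (simp add: in_L2_def)
  have "(L2_norm (h R))\<^sup>2 \<le> 2 * (L2_norm g)\<^sup>2 + 2 * (L2_norm (\<lambda>\<xi>. g \<xi> - fourier (h R) \<xi>))\<^sup>2" for R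
  proof -
    have "1 \<le> (2 * pi) ^ CARD('n)"
      using pi_gt3 by (intro one_le_power) simp
    then have "1 * (L2_norm (h R))\<^sup>2 \<le> (2 * pi) ^ CARD('n) * (L2_norm (h R))\<^sup>2"
      by (intro mult_right_mono) auto
    also have "\<dots> = (L2_norm (fourier (h R)))\<^sup>2"
      by (rule in_L2_fourier(2)[OF h, symmetric])
    also have "fourier (h R) = (\<lambda>\<xi>. g \<xi> - (g \<xi> - fourier (h R) \<xi>))"
      by simp
    also have "(L2_norm \<dots>)\<^sup>2 \<le> 2 * (L2_norm g)\<^sup>2 + 2 * (L2_norm (\<lambda>\<xi>. g \<xi> - fourier (h R) \<xi>))\<^sup>2"
      by (intro in_L2_diff in_L2_fourier g h)
    finally show ?thesis by simp
  qed
  moreover have "((\<lambda>R. (L2_norm (h R))\<^sup>2) \<longlongrightarrow> (L2_norm f)\<^sup>2) at_top"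
    unfolding L2_norm_sq
  proof (rule integral_dominated_convergence_at_top[OF _ _ f2])
    show "AE x in lborel. ((\<lambda>R. (cmod (h R x))\<^sup>2) \<longlongrightarrow> (cmod (f x))\<^sup>2) at_top"
    proof (intro AE_I2 tendsto_eventually)
      fix x show "\<forall>\<^sub>F R in at_top. (cmod (h R x))\<^sup>2 = (cmod (f x))\<^sup>2"
        using eventually_ge_at_top[of "norm x"] by eventually_elim (simp add: h_def)
    qed
  qed (auto simp: h_def indicator_def)
  moreover have "((\<lambda>R. 2 * (L2_norm g)\<^sup>2 + 2 * (L2_norm (\<lambda>\<xi>. g \<xi> - fourier (h R) \<xi>))\<^sup>2) \<longlongrightarrow> 2 * (L2_norm g)\<^sup>2 + 2 * 0\<^sup>2) at_top"
    by (intro tendsto_intros lim)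
  ultimately have "(L2_norm f)\<^sup>2 \<le> 2 * (L2_norm g)\<^sup>2 + 2 * 0\<^sup>2"
    by (intro tendsto_le[OF trivial_limit_at_top_linorder]) auto
  then show ?thesis by simp
qed

section \<open>The third-order initial value problem\<close>

text \<open>The polynomial is the characteristic cubic evaluated at -m. It is nonnegative at the
  lower bound and nonpositive at both upper bounds, so the intermediate value theorem on the
  interval up to their minimum gives a root satisfying all three bounds.\<close>

lemma cubic_root:
  fixes \<beta> \<gamma> \<kappa> s :: real
  assumes \<beta>: "\<beta> > 0" and \<gamma>: "\<gamma> > 1" and \<kappa>: "\<kappa> > 0" and small: "\<gamma>\<^sup>2 * \<kappa> < 4 * (\<gamma> - 1) * \<beta>" and s: "s > 0"
  obtains m where "\<kappa> * s / (1 + \<gamma> * \<beta> * \<kappa> * s) \<le> m" "m \<le> \<kappa> * s" "m \<le> 1 / \<beta>"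
    "\<kappa> * s\<^sup>2 - (s + \<gamma> * \<beta> * \<kappa> * s\<^sup>2) * m + (\<beta> + \<gamma> * \<kappa>) * s * m\<^sup>2 - m ^ 3 = 0"
proof -
  define f where "f m = \<kappa> * s\<^sup>2 - (s + \<gamma> * \<beta> * \<kappa> * s\<^sup>2) * m + (\<beta> + \<gamma> * \<kappa>) * s * m\<^sup>2 - m ^ 3" for m
  define d where "d = 1 + \<gamma> * \<beta> * \<kappa> * s"
  have d: "d \<ge> 1"
    using assms by (simp add: d_def)
  \<comment> \<open>The zero of the affine part of f; what remains there is
    \<open>lo\<^sup>2\<close> times a nonnegative factor.\<close>
  define lo where "lo = \<kappa> * s / d"
  define hi where "hi = min (\<kappa> * s) (1 / \<beta>)"
  have lo1: "lo \<le> \<kappa> * s"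
    using d \<kappa> s by (simp add: lo_def divide_le_eq)
  have lo2: "lo \<le> 1 / \<beta>"
  proof -
    have "\<kappa> * s * \<beta> \<le> \<gamma> * (\<kappa> * s * \<beta>)"
      using \<gamma> \<beta> \<kappa> s by simp
    then have "\<kappa> * s * \<beta> \<le> d"
      by (simp add: d_def mult_ac)
    then show ?thesis
      using d \<beta> by (simp add: lo_def divide_simps)
  qed
  \<comment> \<open>With this inequality the smallness condition also yields \<kappa> < \<beta>,
    which decides the sign of f at \<open>\<kappa> * s\<close>.\<close>
  have "4 * (\<gamma> - 1) \<le> \<gamma>\<^sup>2"
    using zero_le_power2[of "\<gamma> - 2"] by (simp add: power2_eq_square algebra_simps)
  then have "4 * (\<gamma> - 1) * \<beta> \<le> \<gamma>\<^sup>2 * \<beta>"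
    using \<beta> by (intro mult_right_mono) auto
  then have "\<gamma>\<^sup>2 * \<kappa> < \<gamma>\<^sup>2 * \<beta>"
    using small by linarith
  then have \<kappa>\<beta>: "\<kappa> < \<beta>"
    using \<gamma> by simp
  have "f lo = lo\<^sup>2 * ((\<beta> + \<gamma> * \<kappa>) * s - lo)"
  proof -
    have "(s + \<gamma> * \<beta> * \<kappa> * s\<^sup>2) * lo = s * (d * lo)"
      by (simp add: d_def power2_eq_square algebra_simps)
    also have "d * lo = \<kappa> * s"
      using d by (simp add: lo_def)
    finally show ?thesis
      by (simp add: f_def power2_eq_square power3_eq_cube algebra_simps)
  qed
  also have "\<dots> \<ge> 0"
  proof -
    have "\<kappa> * s \<le> (\<gamma> * \<kappa>) * s" "0 \<le> \<beta> * s"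
      using \<gamma> \<kappa> \<beta> s by auto
    then have "lo \<le> (\<beta> + \<gamma> * \<kappa>) * s"
      using lo1 by (simp only: distrib_right)
    then show ?thesis by simp
  qed
  finally have flo: "f lo \<ge> 0" .
  have "f (\<kappa> * s) = \<kappa>\<^sup>2 * s ^ 3 * ((\<gamma> - 1) * (\<kappa> - \<beta>))"
    by (simp add: f_def power2_eq_square power3_eq_cube algebra_simps)
  also have "\<dots> \<le> 0"
    using \<kappa>\<beta> \<gamma> \<kappa> s by (intro mult_nonneg_nonpos) auto
  finally have fhi1: "f (\<kappa> * s) \<le> 0" .
  \<comment> \<open>As a quadratic in \<open>s\<close>, \<open>f (1 / \<beta>)\<close> has negative discriminant exactly under the smallness condition on \<open>\<kappa>\<close>.\<close>
  have fhi2: "f (1 / \<beta>) \<le> 0"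
  proof -
    define a where "a = (\<gamma> - 1) * \<kappa>"
    have a: "a > 0" using \<gamma> \<kappa> by (simp add: a_def)
    have "\<beta> ^ 4 * (4 * a * f (1 / \<beta>)) = - (\<beta>\<^sup>2 * (2 * a * s) - \<gamma> * \<kappa>)\<^sup>2 + \<kappa> * (\<gamma>\<^sup>2 * \<kappa> - 4 * (\<gamma> - 1) * \<beta>)"
      using \<beta> by (simp add: f_def a_def power2_eq_square power3_eq_cube power4_eq_xxxx field_simps)
    also have "\<dots> \<le> 0"
      using small \<kappa> by (intro add_nonpos_nonpos mult_nonneg_nonpos) auto
    finally show ?thesis
      using a \<beta> by (simp add: mult_le_0_iff)
  qed
  have "\<exists>m. lo \<le> m \<and> m \<le> hi \<and> f m = 0"
  proof (rule IVT2')
    show "f hi \<le> 0" using fhi1 fhi2 by (simp add: hi_def min_def)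
    show "continuous_on {lo..hi} f" unfolding f_def by (intro continuous_intros)
  qed (use flo lo1 lo2 in \<open>auto simp: hi_def\<close>)
  then show thesis
    using that by (auto simp: lo_def hi_def d_def f_def)
qed

text \<open>The three equations compare coefficients in (X + m) (X^2 + p X + q). Since q = \<kappa>
  s^2 / m, each upper bound on m turns into a lower bound on q; the lower bound on m gives the
  expansion m = \<kappa> s + O(s^2).\<close>

lemma cubic_factorization:
  fixes \<beta> \<gamma> \<kappa> s \<delta> :: real
  assumes \<beta>: "\<beta> > 0" and \<gamma>: "\<gamma> > 1" and \<kappa>: "\<kappa> > 0" and small: "\<gamma>\<^sup>2 * \<kappa> < 4 * (\<gamma> - 1) * \<beta>" and s: "s > 0"
    and \<delta>: "\<delta> = \<beta> + (\<gamma> - 1) * \<kappa>"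
  obtains m p q where
    "p + m = (\<delta> + \<kappa>) * s" "q + p * m = s + \<gamma> * \<beta> * \<kappa> * s\<^sup>2" "q * m = \<kappa> * s\<^sup>2"
    "\<kappa> * s / (1 + \<gamma> * \<beta> * \<kappa> * s) \<le> m" "m \<le> \<kappa> * s" "m \<le> 1 / \<beta>"
    "\<kappa> * s - m \<le> \<gamma> * \<beta> * \<kappa>\<^sup>2 * s\<^sup>2" "s \<le> q" "\<beta> * \<kappa> * s\<^sup>2 \<le> q"
proof -
  obtain m where m: "\<kappa> * s / (1 + \<gamma> * \<beta> * \<kappa> * s) \<le> m" "m \<le> \<kappa> * s" "m \<le> 1 / \<beta>"
    and root: "\<kappa> * s\<^sup>2 - (s + \<gamma> * \<beta> * \<kappa> * s\<^sup>2) * m + (\<beta> + \<gamma> * \<kappa>) * s * m\<^sup>2 - m ^ 3 = 0"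
    using cubic_root[OF \<beta> \<gamma> \<kappa> small s] by metis
  define p where "p = (\<delta> + \<kappa>) * s - m"
  define q where "q = s + \<gamma> * \<beta> * \<kappa> * s\<^sup>2 - p * m"
  have d: "1 + \<gamma> * \<beta> * \<kappa> * s \<ge> 1"
    using assms by simp
  have m0: "m > 0"
    using m(1) d \<kappa> s by (intro less_le_trans[OF _ m(1)] divide_pos_pos) auto
  have qm: "q * m = \<kappa> * s\<^sup>2"
    using root by (simp add: q_def p_def \<delta> power2_eq_square power3_eq_cube algebra_simps)
  have q: "q = \<kappa> * s\<^sup>2 / m"
    using qm m0 by (simp add: field_simps)
  have "s * m \<le> \<kappa> * s\<^sup>2"
    using mult_left_mono[OF m(2), of s] s by (simp add: power2_eq_square mult_ac)
  then have q1: "s \<le> q"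
    unfolding q using m0 by (simp add: le_divide_eq)
  have "m * \<beta> \<le> 1"
    using m(3) \<beta> by (simp add: le_divide_eq)
  then have "\<kappa> * s\<^sup>2 * (m * \<beta>) \<le> \<kappa> * s\<^sup>2 * 1"
    using \<kappa> by (intro mult_left_mono) auto
  then have q2: "\<beta> * \<kappa> * s\<^sup>2 \<le> q"
    unfolding q using m0 by (simp add: le_divide_eq mult_ac)
  have "\<kappa> * s \<le> m * (1 + \<gamma> * \<beta> * \<kappa> * s)"
    using m(1) d by (simp add: divide_le_eq)
  then have "\<kappa> * s - m \<le> m * (\<gamma> * \<beta> * \<kappa> * s)"
    by (simp add: algebra_simps)
  also have "\<dots> \<le> (\<kappa> * s) * (\<gamma> * \<beta> * \<kappa> * s)"
    using assms by (intro mult_right_mono m) auto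
  finally have "\<kappa> * s - m \<le> \<gamma> * \<beta> * \<kappa>\<^sup>2 * s\<^sup>2"
    by (simp add: power2_eq_square mult_ac)
  with m qm q1 q2 show thesis
    by (intro that[of p m q]) (auto simp: p_def q_def)
qed

text \<open>Only the second factor w is assumed differentiable, so the derivative of u'' is
  recovered from \<open>u'' = w - s u - \<delta> s u'\<close>. In the coefficient of u' the identity
  \<delta> + (\<gamma> - 1) (b \<nu> - \<kappa>) = \<gamma> b \<nu> removes \<delta>.\<close>

lemma blackstock_ode_third_order:
  assumes "blackstock_ode b \<nu> \<gamma> \<kappa> s u0 u1 u2 u"
  obtains u' u'' where
    "\<And>t. t \<ge> 0 \<Longrightarrow> (u has_vector_derivative u' t) (at t within {0..})"
    "\<And>t. t \<ge> 0 \<Longrightarrow> (u' has_vector_derivative u'' t) (at t within {0..})"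
    "continuous_on {0..} u''" "u 0 = u0" "u' 0 = u1" "u'' 0 = u2"
    "\<And>t. t > 0 \<Longrightarrow> (u'' has_vector_derivative
        - (((delta b \<nu> \<gamma> \<kappa> + \<kappa>) * s) *\<^sub>R u'' t + (s + \<gamma> * (b * \<nu>) * \<kappa> * s\<^sup>2) *\<^sub>R u' t + (\<kappa> * s\<^sup>2) *\<^sub>R u t)) (at t)"
proof -
  define \<delta> where "\<delta> = delta b \<nu> \<gamma> \<kappa>"
  obtain u' u'' where u: "\<And>t. t \<ge> 0 \<Longrightarrow> (u has_vector_derivative u' t) (at t within {0..})"
    and u': "\<And>t. t \<ge> 0 \<Longrightarrow> (u' has_vector_derivative u'' t) (at t within {0..})"
    and rest: "continuous_on {0..} u''" "u 0 = u0" "u' 0 = u1" "u'' 0 = u2"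
    and ode: "\<And>t. t > 0 \<Longrightarrow> \<exists>w'. ((\<lambda>t. u'' t + of_real s * u t + of_real (\<delta> * s) * u' t) has_vector_derivative w') (at t) \<and>
           w' + of_real (\<kappa> * s) * (u'' t + of_real s * u t + of_real (\<delta> * s) * u' t)
              + of_real (\<kappa> * (\<gamma> - 1) * (b * \<nu> - \<kappa>) * s\<^sup>2) * u' t = 0"
    using assms unfolding blackstock_ode_def Let_def \<delta>_def by auto
  have "(u'' has_vector_derivative
        - (((\<delta> + \<kappa>) * s) *\<^sub>R u'' t + (s + \<gamma> * (b * \<nu>) * \<kappa> * s\<^sup>2) *\<^sub>R u' t + (\<kappa> * s\<^sup>2) *\<^sub>R u t)) (at t)" if t: "t > 0" for t
  proof -
    have at: "at t within {0..} = at t"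
      using t by (intro at_within_interior) simp
    have du: "(u has_vector_derivative u' t) (at t)" "(u' has_vector_derivative u'' t) (at t)"
      using u[of t] u'[of t] t by (simp_all add: at)
    obtain w' where w': "((\<lambda>t. u'' t + of_real s * u t + of_real (\<delta> * s) * u' t) has_vector_derivative w') (at t)"
      and eq: "w' + of_real (\<kappa> * s) * (u'' t + of_real s * u t + of_real (\<delta> * s) * u' t)
              + of_real (\<kappa> * (\<gamma> - 1) * (b * \<nu> - \<kappa>) * s\<^sup>2) * u' t = 0"
      using ode[OF t] by blast
    have "((\<lambda>t. (u'' t + of_real s * u t + of_real (\<delta> * s) * u' t) - of_real s * u t - of_real (\<delta> * s) * u' t)
        has_vector_derivative w' - of_real s * u' t - of_real (\<delta> * s) * u'' t) (at t)"
      by (intro has_vector_derivative_diff w' has_vector_derivative_mult_right du)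
    then have "(u'' has_vector_derivative w' - of_real s * u' t - of_real (\<delta> * s) * u'' t) (at t)"
      by simp
    also have "w' = - (of_real (\<kappa> * s) * (u'' t + of_real s * u t + of_real (\<delta> * s) * u' t)
              + of_real (\<kappa> * (\<gamma> - 1) * (b * \<nu> - \<kappa>) * s\<^sup>2) * u' t)"
      using eq by (simp only: eq_neg_iff_add_eq_0 add.assoc)
    finally show ?thesis
      by (rule back_subst[where P = "\<lambda>d. (u'' has_vector_derivative d) (at t)"])
         (simp add: scaleR_conv_of_real \<delta>_def delta_def power2_eq_square algebra_simps)
  qed
  with u u' rest show thesis
    unfolding \<delta>_def by (rule that)
qed

section \<open>Decay and explicit solutions for the first- and second-order factors\<close>

lemma has_real_derivative_norm_sq:
  fixes w :: "real \<Rightarrow> 'a::real_inner"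
  assumes "(w has_vector_derivative w') (at t)"
  shows "((\<lambda>t. (norm (w t))\<^sup>2) has_real_derivative 2 * (w t \<bullet> w')) (at t)"
  using bounded_bilinear.has_vector_derivative[OF bounded_bilinear_inner assms assms]
  by (simp add: power2_norm_eq_inner has_real_derivative_iff_has_vector_derivative inner_commute)

text \<open>An energy argument that never refers to the roots of X^2 + p X + q, and so is
  insensitive to whether they are real, complex or double. The conditions on c say that c V is at
  most the dissipation; with c = 0 the lemma gives uniqueness.\<close>

lemma damped_oscillator_decay:
  fixes w w' :: "real \<Rightarrow> 'a::real_inner"
  assumes cont: "continuous_on {0..} w" "continuous_on {0..} w'"
    and w: "\<And>t. t > 0 \<Longrightarrow> (w has_vector_derivative w' t) (at t)"
    and w': "\<And>t. t > 0 \<Longrightarrow> (w' has_vector_derivative - (p *\<^sub>R w' t + q *\<^sub>R w t)) (at t)"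
    and q: "q \<ge> 0" and c: "c \<ge> 0" "3 * c \<le> 2 * p" "c * (p\<^sup>2 + q) \<le> p * q" and T: "T \<ge> 0"
  shows "2 * q * (norm (w T))\<^sup>2 \<le> exp (- c * T) * (3 * (norm (w' 0))\<^sup>2 + 2 * (p\<^sup>2 + q) * (norm (w 0))\<^sup>2)"
proof -
  \<comment> \<open>The mixed term makes the derivative of \<open>V\<close> equal to \<open>- 2 p (\<bar>w'\<bar>\<^sup>2 + q \<bar>w\<bar>\<^sup>2)\<close>.\<close>
  define V where "V t = (norm (w' t))\<^sup>2 + (norm (w' t + p *\<^sub>R w t))\<^sup>2 + 2 * q * (norm (w t))\<^sup>2" for t
  have V_le: "V t \<le> 3 * (norm (w' t))\<^sup>2 + 2 * (p\<^sup>2 + q) * (norm (w t))\<^sup>2" for t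
  proof -
    have "0 \<le> (norm (w' t - p *\<^sub>R w t))\<^sup>2" by simp
    then have "(norm (w' t + p *\<^sub>R w t))\<^sup>2 \<le> 2 * (norm (w' t))\<^sup>2 + 2 * p\<^sup>2 * (norm (w t))\<^sup>2"
      unfolding power2_norm_eq_inner
      by (simp add: inner_add_left inner_add_right inner_diff_left inner_diff_right inner_commute power2_eq_square)
    then show ?thesis
      by (simp add: V_def algebra_simps)
  qed
  have DV: "(V has_real_derivative - 2 * p * ((norm (w' t))\<^sup>2 + q * (norm (w t))\<^sup>2)) (at t)" if t: "t > 0" for t
  proof -
    let ?a = "- (p *\<^sub>R w' t + q *\<^sub>R w t)"
    have sum: "((\<lambda>t. w' t + p *\<^sub>R w t) has_vector_derivative ?a + p *\<^sub>R w' t) (at t)"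
      using t by (intro has_vector_derivative_add w' bounded_linear.has_vector_derivative[OF bounded_linear_scaleR_right] w)
    have "(V has_real_derivative 2 * (w' t \<bullet> ?a) + 2 * ((w' t + p *\<^sub>R w t) \<bullet> (?a + p *\<^sub>R w' t)) + 2 * q * (2 * (w t \<bullet> w' t))) (at t)"
      unfolding V_def[abs_def]
      by (intro DERIV_add DERIV_cmult has_real_derivative_norm_sq[OF w[OF t]]
          has_real_derivative_norm_sq[OF w'[OF t]] has_real_derivative_norm_sq[OF sum])
    then show ?thesis
      by (rule back_subst[where P = "\<lambda>d. (V has_real_derivative d) (at t)"])
         (simp add: power2_norm_eq_inner inner_add_left inner_add_right inner_commute algebra_simps)
  qed
  have "exp (c * T) * V T \<le> exp (c * 0) * V 0"
  proof (rule DERIV_nonpos_imp_decreasing_open[OF T])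
    fix t assume t: "0 < t" "t < T"
    have "c * V t \<le> c * (3 * (norm (w' t))\<^sup>2 + 2 * (p\<^sup>2 + q) * (norm (w t))\<^sup>2)"
      by (intro mult_left_mono V_le c)
    also have "\<dots> = (3 * c) * (norm (w' t))\<^sup>2 + 2 * (c * (p\<^sup>2 + q)) * (norm (w t))\<^sup>2"
      by (simp add: algebra_simps)
    also have "\<dots> \<le> 2 * p * (norm (w' t))\<^sup>2 + 2 * (p * q) * (norm (w t))\<^sup>2"
      by (intro add_mono mult_right_mono mult_left_mono c) auto
    finally have "c * V t - 2 * p * ((norm (w' t))\<^sup>2 + q * (norm (w t))\<^sup>2) \<le> 0"
      by (simp add: algebra_simps)
    then have "exp (c * t) * (c * V t - 2 * p * ((norm (w' t))\<^sup>2 + q * (norm (w t))\<^sup>2)) \<le> 0"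
      by (intro mult_nonneg_nonpos) auto
    moreover have "((\<lambda>t. exp (c * t) * V t) has_real_derivative exp (c * t) * (c * V t - 2 * p * ((norm (w' t))\<^sup>2 + q * (norm (w t))\<^sup>2))) (at t)"
      by (auto intro!: derivative_eq_intros DV t simp: algebra_simps)
    ultimately show "\<exists>y. ((\<lambda>t. exp (c * t) * V t) has_real_derivative y) (at t) \<and> y \<le> 0"
      by blast
  next
    show "continuous_on {0..T} (\<lambda>t. exp (c * t) * V t)"
      unfolding V_def by (intro continuous_intros continuous_on_subset[OF cont(1)] continuous_on_subset[OF cont(2)]) auto
  qed
  then have "V T \<le> exp (- c * T) * V 0"
    by (simp add: exp_minus field_simps)
  also have "\<dots> \<le> exp (- c * T) * (3 * (norm (w' 0))\<^sup>2 + 2 * (p\<^sup>2 + q) * (norm (w 0))\<^sup>2)"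
    by (intro mult_left_mono V_le) auto
  moreover have "2 * q * (norm (w T))\<^sup>2 \<le> V T"
    by (simp add: V_def)
  ultimately show ?thesis by linarith
qed

text \<open>Multiply by the integrating factor exp (m t). The linear factor T is the price of
  allowing the forcing to decay at the rate m itself, where resonance occurs.\<close>

lemma first_order_decay:
  fixes u w :: "real \<Rightarrow> 'a::real_normed_vector"
  assumes u: "\<And>t. t \<ge> 0 \<Longrightarrow> (u has_vector_derivative w t - m *\<^sub>R u t) (at t within {0..})"
    and w: "\<And>t. t \<ge> 0 \<Longrightarrow> norm (w t) \<le> W * exp (- c * t)"
    and c: "c \<le> m" and T: "T \<ge> 0"
  shows "norm (u T) \<le> exp (- c * T) * (norm (u 0) + W * T)"
proof (cases "T = 0")
  case False
  then have T: "T > 0" using T by simp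
  have W: "W \<ge> 0" using w[of 0] norm_ge_zero[of "w 0"] by (simp del: norm_ge_zero)
  let ?g = "\<lambda>t. exp (m * t) *\<^sub>R u t"
  have g: "(?g has_vector_derivative exp (m * t) *\<^sub>R w t) (at t within {0..})" if "t \<ge> 0" for t
  proof -
    have "((\<lambda>t. exp (m * t)) has_real_derivative m * exp (m * t)) (at t within {0..})"
      by (auto intro!: derivative_eq_intros)
    from has_vector_derivative_scaleR[OF this u[OF that]] show ?thesis
      by (simp add: algebra_simps)
  qed
  \<comment> \<open>Since c <= m, the derivative of \<open>?g\<close> is largest in bound at the
    endpoint T; freezing that bound gives a linear majorant.\<close>
  have "norm (?g T - ?g 0) \<le> W * exp ((m - c) * T) * T - W * exp ((m - c) * T) * 0"
  proof (rule differentiable_bound_general[OF T])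
    show "continuous_on {0..T} ?g"
      by (rule continuous_on_subset[of "{0..}"])
         (use g in \<open>auto simp: continuous_on_eq_continuous_within intro!: has_vector_derivative_continuous\<close>)
    show "continuous_on {0..T} (\<lambda>t. W * exp ((m - c) * T) * t)"
      by (intro continuous_intros)
    fix t assume t: "0 < t" "t < T"
    have "at t within {0..} = at t"
      using t by (intro at_within_interior) simp
    then show "(?g has_vector_derivative exp (m * t) *\<^sub>R w t) (at t)"
      using g[of t] t by simp
    show "((\<lambda>t. W * exp ((m - c) * T) * t) has_vector_derivative W * exp ((m - c) * T)) (at t)"
      unfolding has_real_derivative_iff_has_vector_derivative[symmetric]
      by (auto intro!: derivative_eq_intros)
    have "norm (exp (m * t) *\<^sub>R w t) \<le> exp (m * t) * (W * exp (- c * t))"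
      using w[of t] t by simp
    also have "\<dots> = W * exp ((m - c) * t)"
      by (simp add: algebra_simps exp_add[symmetric] exp_diff exp_minus field_simps)
    also have "\<dots> \<le> W * exp ((m - c) * T)"
      using t c W by (auto intro!: mult_left_mono)
    finally show "norm (exp (m * t) *\<^sub>R w t) \<le> W * exp ((m - c) * T)" .
  qed
  then have "norm (?g T) \<le> norm (u 0) + W * exp ((m - c) * T) * T"
    using norm_triangle_ineq2[of "?g T" "?g 0"] by simp
  also have "\<dots> \<le> norm (u 0) * exp ((m - c) * T) + W * exp ((m - c) * T) * T"
    using mult_left_mono[of 1 "exp ((m - c) * T)" "norm (u 0)"] T c by simp
  also have "\<dots> = exp (m * T) * (exp (- c * T) * (norm (u 0) + W * T))"
  proof -
    have "exp ((m - c) * T) = exp (m * T) * exp (- c * T)"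
      by (simp add: left_diff_distrib flip: exp_add)
    then show ?thesis
      by (simp only:) (simp add: distrib_left mult_ac)
  qed
  finally have "exp (m * T) * norm (u T) \<le> exp (m * T) * (exp (- c * T) * (norm (u 0) + W * T))"
    by simp
  then show ?thesis
    by (rule mult_left_le_imp_le) simp
qed simp

text \<open>Trades a linear factor for half of the exponential rate. It is used with t as time and,
  in the Gaussian moments, with t as the squared frequency.\<close>

lemma times_exp_le:
  fixes a t :: real
  assumes "a > 0"
  shows "t * exp (- (2 * a) * t) \<le> (1 / a) * exp (- a * t)"
proof -
  have "a * t \<le> exp (a * t)"
    using exp_ge_add_one_self[of "a * t"] by linarith
  then have "a * t * exp (- (2 * a) * t) \<le> exp (a * t) * exp (- (2 * a) * t)"
    by (intro mult_right_mono) auto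
  also have "\<dots> = exp (- a * t)"
    by (simp flip: exp_add)
  finally show ?thesis
    using assms by (simp add: field_simps)
qed

lemma first_order_solution:
  fixes v :: "real \<Rightarrow> 'a::real_normed_vector"
  assumes cont: "continuous_on {0..} v"
    and v: "\<And>t. t > 0 \<Longrightarrow> (v has_vector_derivative - (m *\<^sub>R v t)) (at t)" and T: "T \<ge> 0"
  shows "v T = exp (- m * T) *\<^sub>R v 0"
proof (cases "T = 0")
  case False
  then have T: "T > 0" using T by simp
  let ?g = "\<lambda>t. exp (m * t) *\<^sub>R v t"
  have "norm (?g T - ?g 0) \<le> 0 - 0"
  proof (rule differentiable_bound_general[OF T, where f' = "\<lambda>_. 0" and \<phi> = "\<lambda>_. 0" and \<phi>' = "\<lambda>_. 0"])
    show "continuous_on {0..T} ?g"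
      by (intro continuous_intros continuous_on_subset[OF cont]) auto
    fix t assume t: "0 < t" "t < T"
    have "((\<lambda>t. exp (m * t)) has_real_derivative m * exp (m * t)) (at t)"
      by (auto intro!: derivative_eq_intros)
    from has_vector_derivative_scaleR[OF this v[OF t(1)]] show "(?g has_vector_derivative 0) (at t)"
      by (simp add: mult.commute)
  qed auto
  then have "exp (- m * T) *\<^sub>R ?g T = exp (- m * T) *\<^sub>R v 0"
    by simp
  then show ?thesis
    by (simp add: mult_exp_exp)
qed simp

text \<open>The explicit function y solves the same problem, and the energy inequality applied to z
  - y, whose data vanish, forces equality. The condition on \<omega> is that of the underdamped
  case.\<close>

lemma damped_oscillator_solution:
  fixes z z' :: "real \<Rightarrow> 'a::real_inner"
  assumes z: "\<And>t. t \<ge> 0 \<Longrightarrow> (z has_vector_derivative z' t) (at t within {0..})"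
    and z': "\<And>t. t \<ge> 0 \<Longrightarrow> (z' has_vector_derivative - (p *\<^sub>R z' t + q *\<^sub>R z t)) (at t within {0..})"
    and p: "p \<ge> 0" and \<omega>: "\<omega> > 0" "\<omega>\<^sup>2 = q - p\<^sup>2 / 4" and T: "T \<ge> 0"
  shows "z T = (exp (- (p / 2) * T) * cos (\<omega> * T)) *\<^sub>R z 0
           + (exp (- (p / 2) * T) * sin (\<omega> * T)) *\<^sub>R ((1 / \<omega>) *\<^sub>R (z' 0 + (p / 2) *\<^sub>R z 0))"
proof -
  define a where "a = (1 / \<omega>) *\<^sub>R (z' 0 + (p / 2) *\<^sub>R z 0)"
  define C where "C t = exp (- (p / 2) * t) * cos (\<omega> * t)" for t
  define S where "S t = exp (- (p / 2) * t) * sin (\<omega> * t)" for t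
  define C' where "C' t = - (p / 2) * C t - \<omega> * S t" for t
  define S' where "S' t = - (p / 2) * S t + \<omega> * C t" for t
  define y where "y t = C t *\<^sub>R z 0 + S t *\<^sub>R a" for t
  define y' where "y' t = C' t *\<^sub>R z 0 + S' t *\<^sub>R a" for t
  have C: "(C has_real_derivative C' t) (at t within A)" for t A
    unfolding C_def C'_def S_def by (auto intro!: derivative_eq_intros simp: algebra_simps)
  have S: "(S has_real_derivative S' t) (at t within A)" for t A
    unfolding S_def S'_def C_def by (auto intro!: derivative_eq_intros simp: algebra_simps)
  have q: "q = \<omega>\<^sup>2 + p\<^sup>2 / 4"
    using \<omega> by simp
  have C': "(C' has_real_derivative - (p * C' t + q * C t)) (at t within A)" for t A
    unfolding C'_def[abs_def]
    by (auto intro!: derivative_eq_intros C S simp: C'_def S'_def q power2_eq_square field_simps)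
  have S': "(S' has_real_derivative - (p * S' t + q * S t)) (at t within A)" for t A
    unfolding S'_def[abs_def]
    by (auto intro!: derivative_eq_intros C S simp: C'_def S'_def q power2_eq_square field_simps)
  have y: "(y has_vector_derivative y' t) (at t within A)" for t A
    unfolding y_def[abs_def] y'_def
    using has_vector_derivative_add[OF has_vector_derivative_scaleR[OF C has_vector_derivative_const]
      has_vector_derivative_scaleR[OF S has_vector_derivative_const]] by simp
  have y': "(y' has_vector_derivative - (p *\<^sub>R y' t + q *\<^sub>R y t)) (at t within A)" for t A
    using has_vector_derivative_add[OF has_vector_derivative_scaleR[OF C' has_vector_derivative_const[of "z 0"]]
      has_vector_derivative_scaleR[OF S' has_vector_derivative_const[of a]], of t A]
    unfolding y'_def[abs_def] y_def by (simp add: algebra_simps)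
  have zy: "((\<lambda>t. z t - y t) has_vector_derivative z' t - y' t) (at t within {0..})" if "t \<ge> 0" for t
    by (intro has_vector_derivative_diff z y that)
  have zy': "((\<lambda>t. z' t - y' t) has_vector_derivative - (p *\<^sub>R (z' t - y' t) + q *\<^sub>R (z t - y t))) (at t within {0..})" if "t \<ge> 0" for t
    using has_vector_derivative_diff[OF z'[OF that] y'[of t "{0..}"]] by (simp add: algebra_simps)
  have at: "at t within {0..} = at t" if "t > 0" for t :: real
    using that by (intro at_within_interior) simp
  have cont: "continuous_on {0..} (\<lambda>t. z t - y t)" "continuous_on {0..} (\<lambda>t. z' t - y' t)"
    using zy zy' by (auto simp: continuous_on_eq_continuous_within intro!: has_vector_derivative_continuous)
  have init: "y 0 = z 0" "y' 0 = z' 0"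
    using \<omega> by (simp_all add: y_def y'_def C_def S_def C'_def S'_def a_def)
  have q0: "q > 0"
    unfolding q using zero_less_power[OF \<omega>(1), of 2] zero_le_power2[of p] by linarith
  \<comment> \<open>Rate zero suffices: the right-hand side vanishes because the data agree.\<close>
  have "2 * q * (norm (z T - y T))\<^sup>2 \<le> exp (- 0 * T) * (3 * (norm (z' 0 - y' 0))\<^sup>2 + 2 * (p\<^sup>2 + q) * (norm (z 0 - y 0))\<^sup>2)"
  proof (rule damped_oscillator_decay[OF cont])
    fix t :: real assume "t > 0"
    then show "((\<lambda>t. z t - y t) has_vector_derivative z' t - y' t) (at t)"
      "((\<lambda>t. z' t - y' t) has_vector_derivative - (p *\<^sub>R (z' t - y' t) + q *\<^sub>R (z t - y t))) (at t)"
      using zy[of t] zy'[of t] by (simp_all add: at)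
  qed (use p q0 T in auto)
  then have "z T = y T"
    using q0 by (simp add: init mult_le_0_iff)
  then show ?thesis
    by (simp add: y_def C_def S_def a_def)
qed

section \<open>Uniform exponential decay away from frequency zero\<close>

locale blackstock_parameters =
  fixes b \<nu> \<gamma> \<kappa> \<beta> \<delta> :: real
  assumes \<beta>_def: "\<beta> = b * \<nu>" and \<delta>_def: "\<delta> = delta b \<nu> \<gamma> \<kappa>"
    and \<beta>: "\<beta> > 0" and \<gamma>: "\<gamma> > 1" and \<kappa>: "\<kappa> > 0" and small: "\<gamma>\<^sup>2 * \<kappa> < 4 * (\<gamma> - 1) * \<beta>"
begin

lemma \<delta>_eq: "\<delta> = \<beta> + (\<gamma> - 1) * \<kappa>"
  by (simp add: \<delta>_def \<beta>_def delta_def)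

lemma \<delta>: "\<delta> > 0"
  using \<beta> \<gamma> \<kappa> by (simp add: \<delta>_eq add_pos_nonneg)

text \<open>At intermediate frequencies the three roots may coincide, so the solution is recovered from
  \<open>w = u' + m u\<close> by integration and not from a partial fraction expansion.\<close>

lemma high_frequency_decay:
  assumes s0: "s0 > 0"
  shows "\<exists>c>0. \<exists>C>0. \<forall>s\<ge>s0. \<forall>u0 u1 u2 u. blackstock_ode b \<nu> \<gamma> \<kappa> s u0 u1 u2 u \<longrightarrow>
     (\<forall>t\<ge>0. cmod (u t) \<le> C * exp (- c * t) * (cmod u0 + cmod u1 + cmod u2))"
proof -
  \<comment> \<open>The lower bound on the root m increases with s, so its value at s0 serves for
    all s >= s0.\<close>
  define m0 where "m0 = \<kappa> * s0 / (1 + \<gamma> * \<beta> * \<kappa> * s0)"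
  have m0: "m0 > 0"
    unfolding m0_def using \<kappa> \<gamma> \<beta> s0 by (intro divide_pos_pos add_pos_nonneg) auto
  \<comment> \<open>Bounds p^2 / q for every s: p grows at most like s and q at least like \<beta>
    \<kappa> s^2. Thus dividing the energy estimate by q leaves no power of s.\<close>
  define K1 where "K1 = (\<delta> + \<kappa>)\<^sup>2 / (\<beta> * \<kappa>)"
  define K where "K = 3 / (2 * s0) + (K1 + 1)"
  \<comment> \<open>The three entries secure, in this order, 3 c <= 2 p, c (p^2 + q) <= p q, and c /
    2 <= m.\<close>
  define c where "c = min (min (2 / 3 * (\<delta> * s0)) (1 / ((\<delta> + \<kappa>) + 1 / (\<delta> * s0)))) (2 * m0)"
  have K1: "K1 \<ge> 0" unfolding K1_def using \<beta> \<kappa> by simp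
  have K: "K \<ge> 0" unfolding K_def using K1 s0 by simp
  have c: "c > 0"
    unfolding c_def using \<delta> \<kappa> s0 m0 by (auto intro!: divide_pos_pos add_pos_pos)
  define C where "C = 1 + sqrt K * (1 + 1 / \<beta>) * (4 / c)"
  have C: "C > 0"
    unfolding C_def using K \<beta> c by (intro add_pos_nonneg mult_nonneg_nonneg) auto
  have "cmod (u t) \<le> C * exp (- (c / 4) * t) * (cmod u0 + cmod u1 + cmod u2)"
    if s: "s \<ge> s0" and ode: "blackstock_ode b \<nu> \<gamma> \<kappa> s u0 u1 u2 u" and t: "t \<ge> 0" for s u0 u1 u2 u t
  proof -
    obtain u' u'' where u: "\<And>t. t \<ge> 0 \<Longrightarrow> (u has_vector_derivative u' t) (at t within {0..})"
      and u': "\<And>t. t \<ge> 0 \<Longrightarrow> (u' has_vector_derivative u'' t) (at t within {0..})"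
      and u''_cont: "continuous_on {0..} u''" and init: "u 0 = u0" "u' 0 = u1" "u'' 0 = u2"
      and u'': "\<And>t. t > 0 \<Longrightarrow> (u'' has_vector_derivative
        - (((\<delta> + \<kappa>) * s) *\<^sub>R u'' t + (s + \<gamma> * \<beta> * \<kappa> * s\<^sup>2) *\<^sub>R u' t + (\<kappa> * s\<^sup>2) *\<^sub>R u t)) (at t)"
      using blackstock_ode_third_order[OF ode, folded \<delta>_def \<beta>_def] by metis
    have s_pos: "s > 0" using s s0 by simp
    obtain m p q where sum: "p + m = (\<delta> + \<kappa>) * s" and mid: "q + p * m = s + \<gamma> * \<beta> * \<kappa> * s\<^sup>2" and prod: "q * m = \<kappa> * s\<^sup>2"
      and m: "\<kappa> * s / (1 + \<gamma> * \<beta> * \<kappa> * s) \<le> m" "m \<le> \<kappa> * s" "m \<le> 1 / \<beta>" and q: "s \<le> q" "\<beta> * \<kappa> * s\<^sup>2 \<le> q"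
      using cubic_factorization[OF \<beta> \<gamma> \<kappa> small s_pos \<delta>_eq] by metis
    have "m0 \<le> \<kappa> * s / (1 + \<gamma> * \<beta> * \<kappa> * s)"
    proof -
      have d: "1 + \<gamma> * \<beta> * \<kappa> * s > 0" "1 + \<gamma> * \<beta> * \<kappa> * s0 > 0"
        using \<kappa> \<gamma> \<beta> s0 s_pos by (auto intro!: add_pos_nonneg)
      have "\<kappa> * s0 * (1 + \<gamma> * \<beta> * \<kappa> * s) \<le> \<kappa> * s * (1 + \<gamma> * \<beta> * \<kappa> * s0)"
        using s \<kappa> by (simp add: algebra_simps)
      then show ?thesis
        unfolding m0_def using d by (simp add: divide_simps mult_ac)
    qed
    with m have m_ge: "m0 \<le> m" by simp
    with m0 have m_pos: "m > 0" by simp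
    have p_ge: "p \<ge> \<delta> * s"
      using sum m(2) by (simp add: algebra_simps)
    have "\<delta> * s0 \<le> \<delta> * s" using \<delta> s by simp
    with p_ge have p_ge0: "p \<ge> \<delta> * s0" by simp
    have p_le: "p \<le> (\<delta> + \<kappa>) * s" using sum m_pos by simp
    have "\<delta> * s0 > 0" using \<delta> s0 by simp
    with p_ge0 have p_pos: "p > 0" by linarith
    have q_pos: "q > 0" using q(1) s_pos by linarith
    have p2_le: "p\<^sup>2 \<le> K1 * q"
    proof -
      have "p\<^sup>2 \<le> ((\<delta> + \<kappa>) * s)\<^sup>2"
        using p_le p_pos by (intro power_mono) auto
      also have "\<dots> = K1 * (\<beta> * \<kappa> * s\<^sup>2)"
        using \<beta> \<kappa> by (simp add: K1_def power_mult_distrib)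
      also have "\<dots> \<le> K1 * q"
        by (intro mult_left_mono q K1)
      finally show ?thesis .
    qed
    have cpq: "c * (p\<^sup>2 + q) \<le> p * q"
    proof -
      have "p * p \<le> p * ((\<delta> + \<kappa>) * q)"
        using p_pos \<delta> \<kappa> q(1) by (intro mult_left_mono order_trans[OF p_le]) auto
      moreover have "q * (\<delta> * s0) \<le> q * p"
        using q_pos p_ge0 by (intro mult_left_mono) auto
      then have "q \<le> p * q / (\<delta> * s0)"
        using \<delta> s0 by (simp add: le_divide_eq mult_ac)
      ultimately have "p\<^sup>2 + q \<le> (p * q) * ((\<delta> + \<kappa>) + 1 / (\<delta> * s0))"
        by (simp add: power2_eq_square algebra_simps)
      then have "c * (p\<^sup>2 + q) \<le> c * ((p * q) * ((\<delta> + \<kappa>) + 1 / (\<delta> * s0)))"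
        using c by (intro mult_left_mono) auto
      also have "\<dots> \<le> (1 / ((\<delta> + \<kappa>) + 1 / (\<delta> * s0))) * ((p * q) * ((\<delta> + \<kappa>) + 1 / (\<delta> * s0)))"
        using p_pos q_pos \<delta> \<kappa> s0 by (intro mult_right_mono) (auto simp: c_def intro!: mult_nonneg_nonneg add_nonneg_nonneg)
      also have "\<dots> = p * q"
      proof -
        have "(\<delta> + \<kappa>) + 1 / (\<delta> * s0) > 0"
          using \<delta> \<kappa> s0 by (intro add_pos_pos) auto
        then show ?thesis by simp
      qed
      finally show ?thesis .
    qed
    \<comment> \<open>Applying the first-order factor first leaves the damped oscillator equation
      with coefficients p and q for w.\<close>
    define w where "w t = u' t + m *\<^sub>R u t" for t
    define w' where "w' t = u'' t + m *\<^sub>R u' t" for t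
    have at: "at t within {0..} = at t" if "t > 0" for t :: real
      using that by (intro at_within_interior) simp
    have w: "(w has_vector_derivative w' t) (at t within {0..})" if "t \<ge> 0" for t
      unfolding w_def[abs_def] w'_def using that
      by (intro has_vector_derivative_add u' bounded_linear.has_vector_derivative[OF bounded_linear_scaleR_right] u)
    have w': "(w' has_vector_derivative - (p *\<^sub>R w' t + q *\<^sub>R w t)) (at t)" if "t > 0" for t
    proof -
      have "(w' has_vector_derivative
        - (((\<delta> + \<kappa>) * s) *\<^sub>R u'' t + (s + \<gamma> * \<beta> * \<kappa> * s\<^sup>2) *\<^sub>R u' t + (\<kappa> * s\<^sup>2) *\<^sub>R u t) + m *\<^sub>R u'' t) (at t)"
        unfolding w'_def[abs_def] using that u'[of t]
        by (intro has_vector_derivative_add u'' bounded_linear.has_vector_derivative[OF bounded_linear_scaleR_right]) (auto simp: at)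
      then show ?thesis
        by (rule back_subst[where P = "\<lambda>d. (w' has_vector_derivative d) (at t)"])
           (simp only: sum[symmetric] mid[symmetric] prod[symmetric], simp add: w_def w'_def algebra_simps)
    qed
    have u_cont: "continuous_on {0..} u'"
      using u' by (auto simp: continuous_on_eq_continuous_within intro!: has_vector_derivative_continuous)
    have w_cont: "continuous_on {0..} w"
      using w by (auto simp: continuous_on_eq_continuous_within intro!: has_vector_derivative_continuous)
    have w'_cont: "continuous_on {0..} w'"
      unfolding w'_def by (intro continuous_intros u''_cont u_cont)
    define N where "N = cmod u0 + cmod u1 + cmod u2"
    have w_bound: "cmod (w t) \<le> (sqrt K * ((1 + 1 / \<beta>) * N)) * exp (- (c / 2) * t)" if t: "t \<ge> 0" for t
    proof -
      define R where "R = cmod (w 0) + cmod (w' 0)"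
      have R2: "(cmod (w 0))\<^sup>2 \<le> R\<^sup>2" "(cmod (w' 0))\<^sup>2 \<le> R\<^sup>2"
        by (auto simp: R_def intro!: power_mono)
      have "2 * q * (cmod (w t))\<^sup>2 \<le> exp (- c * t) * (3 * (cmod (w' 0))\<^sup>2 + 2 * (p\<^sup>2 + q) * (cmod (w 0))\<^sup>2)"
      proof (rule damped_oscillator_decay[OF w_cont w'_cont])
        show "(w has_vector_derivative w' t) (at t)" if "t > 0" for t
          using w[of t] that by (simp add: at)
        show "3 * c \<le> 2 * p" using p_ge0 by (simp add: c_def min_def)
      qed (use w' q_pos c cpq t in auto)
      also have "\<dots> \<le> exp (- c * t) * (3 * R\<^sup>2 + 2 * (K1 * q + q) * R\<^sup>2)"
        using p2_le R2 q_pos K1 by (intro mult_left_mono add_mono mult_mono) auto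
      also have "\<dots> \<le> exp (- c * t) * ((3 * q / s0 + 2 * (K1 * q + q)) * R\<^sup>2)"
      proof -
        have "3 \<le> 3 * q / s0" using q(1) s s0 by (simp add: le_divide_eq)
        then have "3 * R\<^sup>2 \<le> (3 * q / s0) * R\<^sup>2" by (intro mult_right_mono) auto
        then show ?thesis
          by (intro mult_left_mono) (simp_all add: distrib_right)
      qed
      also have "\<dots> = 2 * q * (exp (- c * t) * (K * R\<^sup>2))"
        using s0 by (simp add: K_def field_simps)
      finally have "(cmod (w t))\<^sup>2 \<le> exp (- c * t) * (K * R\<^sup>2)"
        using q_pos by simp
      also have "\<dots> = (sqrt K * R * exp (- (c / 2) * t))\<^sup>2"
        using K by (simp add: power_mult_distrib power2_eq_square[of "exp _"] mult_exp_exp)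
      finally have "cmod (w t) \<le> sqrt K * R * exp (- (c / 2) * t)"
        using K by (rule_tac power2_le_imp_le) (auto simp: R_def)
      also have "\<dots> \<le> sqrt K * ((1 + 1 / \<beta>) * N) * exp (- (c / 2) * t)"
      proof (intro mult_right_mono mult_left_mono)
        \<comment> \<open>The bound m <= 1 / \<beta> keeps powers of s out of the initial values of
          w and w'; m <= \<kappa> s alone would not.\<close>
        have "cmod (w 0) \<le> cmod u1 + (1 / \<beta>) * cmod u0"
          unfolding w_def init using mult_right_mono[OF m(3) norm_ge_zero[of u0]] m_pos
          by (intro order_trans[OF norm_triangle_ineq]) simp
        moreover have "cmod (w' 0) \<le> cmod u2 + (1 / \<beta>) * cmod u1"
          unfolding w'_def init using mult_right_mono[OF m(3) norm_ge_zero[of u1]] m_pos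
          by (intro order_trans[OF norm_triangle_ineq]) simp
        moreover have "0 \<le> (1 / \<beta>) * cmod u2" using \<beta> by simp
        ultimately show "R \<le> (1 + 1 / \<beta>) * N"
          unfolding R_def N_def distrib_left distrib_right using norm_ge_zero[of u0] by linarith
      qed (use K in auto)
      finally show ?thesis by simp
    qed
    have "norm (u t) \<le> exp (- (c / 2) * t) * (norm (u 0) + (sqrt K * ((1 + 1 / \<beta>) * N)) * t)"
    proof (rule first_order_decay[OF _ w_bound _ t])
      show "(u has_vector_derivative w t - m *\<^sub>R u t) (at t within {0..})" if "t \<ge> 0" for t
        using u[OF that] by (simp add: w_def)
      show "c / 2 \<le> m" using m_ge by (simp add: c_def min_def)
    qed
    \<comment> \<open>The rate is written as 2 (c / 4) so that the factor t can be absorbed, which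
      leaves the final rate c / 4.\<close>
    also have "\<dots> = exp (- (c / 2) * t) * cmod u0 + (sqrt K * ((1 + 1 / \<beta>) * N)) * (t * exp (- (2 * (c / 4)) * t))"
      by (simp add: init algebra_simps)
    also have "\<dots> \<le> exp (- (c / 4) * t) * N + (sqrt K * ((1 + 1 / \<beta>) * N)) * ((1 / (c / 4)) * exp (- (c / 4) * t))"
      using c t K \<beta> by (intro add_mono mult_mono times_exp_le mult_left_mono) (auto simp: N_def)
    also have "\<dots> = C * exp (- (c / 4) * t) * N"
      using c by (simp add: C_def field_simps)
    finally show ?thesis
      by (simp add: N_def)
  qed
  then show ?thesis
    using c C by (intro exI[of _ "c / 4"] conjI exI[of _ C]) auto
qed

end

section \<open>Comparison with the profile near frequency zero\<close>

lemma abs_exp_diff_le: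
  fixes x y L :: real
  assumes "L \<le> x" "L \<le> y"
  shows "\<bar>exp (- x) - exp (- y)\<bar> \<le> \<bar>x - y\<bar> * exp (- L)"
proof -
  have *: "exp (- x) - exp (- y) \<le> (y - x) * exp (- L)" if "L \<le> x" "x \<le> y" for x y
  proof -
    have "exp (- x) - exp (- y) = exp (- x) * (1 - exp (x - y))"
      by (simp add: right_diff_distrib mult_exp_exp)
    also have "\<dots> \<le> exp (- L) * (y - x)"
    proof (rule mult_mono)
      show "1 - exp (x - y) \<le> y - x"
        using exp_ge_add_one_self[of "x - y"] by linarith
    qed (use that in auto)
    finally show ?thesis by (simp add: mult.commute)
  qed
  show ?thesis
    using *[of x y] *[of y x] assms by (cases "x \<le> y") (auto simp: abs_if)
qed

lemma abs_cos_diff_le: "\<bar>cos x - cos y\<bar> \<le> \<bar>x - y\<bar>" for x y :: real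
proof -
  have "\<bar>cos x - cos y\<bar> = 2 * (\<bar>sin ((x + y) / 2)\<bar> * \<bar>sin ((y - x) / 2)\<bar>)"
    by (simp add: cos_diff_cos abs_mult)
  also have "\<dots> \<le> 2 * (1 * \<bar>(y - x) / 2\<bar>)"
    by (intro mult_left_mono mult_mono abs_sin_le_one abs_sin_x_le_abs_x) auto
  finally show ?thesis by simp
qed

lemma abs_sin_diff_le: "\<bar>sin x - sin y\<bar> \<le> \<bar>x - y\<bar>" for x y :: real
proof -
  have "\<bar>sin x - sin y\<bar> = 2 * (\<bar>sin ((x - y) / 2)\<bar> * \<bar>cos ((x + y) / 2)\<bar>)"
    by (simp add: sin_diff_sin abs_mult)
  also have "\<dots> \<le> 2 * (\<bar>(x - y) / 2\<bar> * 1)"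
    by (intro mult_left_mono mult_mono abs_cos_le_one abs_sin_x_le_abs_x) auto
  finally show ?thesis by simp
qed

text \<open>For f = sin or cos: differences of damped oscillations are linear in the differences of
  exponents and of phases, while decay at the slower exponent L is retained.\<close>

lemma abs_damped_diff_le:
  fixes f :: "real \<Rightarrow> real"
  assumes f: "\<And>x. \<bar>f x\<bar> \<le> 1" "\<And>x y. \<bar>f x - f y\<bar> \<le> \<bar>x - y\<bar>"
    and L: "L \<le> x" "L \<le> y"
  shows "\<bar>exp (- x) * f v - exp (- y) * f w\<bar> \<le> (\<bar>x - y\<bar> + \<bar>v - w\<bar>) * exp (- L)"
proof -
  have "exp (- x) * f v - exp (- y) * f w = (exp (- x) - exp (- y)) * f v + exp (- y) * (f v - f w)"
    by (simp add: algebra_simps)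
  also have "\<bar>\<dots>\<bar> \<le> \<bar>exp (- x) - exp (- y)\<bar> * \<bar>f v\<bar> + exp (- y) * \<bar>f v - f w\<bar>"
    by (intro order_trans[OF abs_triangle_ineq]) (simp add: abs_mult)
  also have "\<dots> \<le> (\<bar>x - y\<bar> * exp (- L)) * 1 + exp (- L) * \<bar>v - w\<bar>"
    using L by (intro add_mono mult_mono abs_exp_diff_le f) auto
  finally show ?thesis by (simp add: algebra_simps)
qed

context blackstock_parameters
begin

text \<open>Here the second-order factor is applied first: v = u'' + p u' + q u satisfies v' = - m
  v. A multiple of exp (- m t) reproduces v once v 0 is divided by m^2 - p m + q, the value of the
  quadratic at -m; the rest of u is a free damped oscillation.\<close>

lemma third_order_representation:
  assumes ode: "blackstock_ode b \<nu> \<gamma> \<kappa> s u0 u1 u2 u"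
    and sum: "p + m = (\<delta> + \<kappa>) * s" and mid: "q + p * m = s + \<gamma> * \<beta> * \<kappa> * s\<^sup>2" and prod: "q * m = \<kappa> * s\<^sup>2"
    and p: "p \<ge> 0" and \<omega>: "\<omega> > 0" "\<omega>\<^sup>2 = q - p\<^sup>2 / 4" and M: "m\<^sup>2 - p * m + q \<noteq> 0" and T: "T \<ge> 0"
  defines "\<alpha> \<equiv> (1 / (m\<^sup>2 - p * m + q)) *\<^sub>R (u2 + p *\<^sub>R u1 + q *\<^sub>R u0)"
  shows "u T = exp (- m * T) *\<^sub>R \<alpha> + (exp (- (p / 2) * T) * cos (\<omega> * T)) *\<^sub>R (u0 - \<alpha>)
    + (exp (- (p / 2) * T) * sin (\<omega> * T)) *\<^sub>R ((1 / \<omega>) *\<^sub>R (u1 + m *\<^sub>R \<alpha> + (p / 2) *\<^sub>R (u0 - \<alpha>)))"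
proof -
  obtain u' u'' where u: "\<And>t. t \<ge> 0 \<Longrightarrow> (u has_vector_derivative u' t) (at t within {0..})"
    and u': "\<And>t. t \<ge> 0 \<Longrightarrow> (u' has_vector_derivative u'' t) (at t within {0..})"
    and u''_cont: "continuous_on {0..} u''" and init: "u 0 = u0" "u' 0 = u1" "u'' 0 = u2"
    and u'': "\<And>t. t > 0 \<Longrightarrow> (u'' has_vector_derivative
      - (((\<delta> + \<kappa>) * s) *\<^sub>R u'' t + (s + \<gamma> * \<beta> * \<kappa> * s\<^sup>2) *\<^sub>R u' t + (\<kappa> * s\<^sup>2) *\<^sub>R u t)) (at t)"
    using blackstock_ode_third_order[OF ode, folded \<delta>_def \<beta>_def] by metis
  have at: "at t within {0..} = at t" if "t > 0" for t :: real
    using that by (intro at_within_interior) simp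
  note sc = bounded_linear.has_vector_derivative[OF bounded_linear_scaleR_right]
  have cont: "continuous_on {0..} u" "continuous_on {0..} u'"
    using u u' by (auto simp: continuous_on_eq_continuous_within intro!: has_vector_derivative_continuous)
  define v where "v t = u'' t + p *\<^sub>R u' t + q *\<^sub>R u t" for t
  have dv: "(v has_vector_derivative - (m *\<^sub>R v t)) (at t)" if t: "t > 0" for t
  proof -
    have "(v has_vector_derivative
      - (((\<delta> + \<kappa>) * s) *\<^sub>R u'' t + (s + \<gamma> * \<beta> * \<kappa> * s\<^sup>2) *\<^sub>R u' t + (\<kappa> * s\<^sup>2) *\<^sub>R u t) + p *\<^sub>R u'' t + q *\<^sub>R u' t) (at t)"
      unfolding v_def[abs_def] using u[of t] u'[of t] t
      by (intro has_vector_derivative_add u'' sc) (auto simp: at)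
    then show ?thesis
      by (rule back_subst[where P = "\<lambda>d. (v has_vector_derivative d) (at t)"])
         (simp only: sum[symmetric] mid[symmetric] prod[symmetric], simp add: v_def algebra_simps)
  qed
  have v_cont: "continuous_on {0..} v"
    unfolding v_def by (intro continuous_intros cont u''_cont)
  have v: "v t = exp (- m * t) *\<^sub>R v 0" if "t \<ge> 0" for t
    by (rule first_order_solution[OF v_cont dv that])
  have v0: "v 0 = (m\<^sup>2 - p * m + q) *\<^sub>R \<alpha>"
    using M by (simp add: v_def init \<alpha>_def)
  define z where "z t = u t - exp (- m * t) *\<^sub>R \<alpha>" for t
  define z' where "z' t = u' t + (m * exp (- m * t)) *\<^sub>R \<alpha>" for t
  have e: "((\<lambda>t. (k * exp (- m * t)) *\<^sub>R \<alpha>) has_vector_derivative (- m * (k * exp (- m * t))) *\<^sub>R \<alpha>) (at t within {0..})" for k t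
  proof -
    have "((\<lambda>t. k * exp (- m * t)) has_real_derivative - m * (k * exp (- m * t))) (at t within {0..})"
      by (auto intro!: derivative_eq_intros)
    from has_vector_derivative_scaleR[OF this has_vector_derivative_const[of \<alpha>]] show ?thesis by simp
  qed
  have z: "(z has_vector_derivative z' t) (at t within {0..})" if "t \<ge> 0" for t
    using has_vector_derivative_diff[OF u[OF that] e[of 1 t]] by (simp add: z_def[abs_def] z'_def)
  have z': "(z' has_vector_derivative - (p *\<^sub>R z' t + q *\<^sub>R z t)) (at t within {0..})" if t: "t \<ge> 0" for t
  proof -
    have "(z' has_vector_derivative u'' t + (- m * (m * exp (- m * t))) *\<^sub>R \<alpha>) (at t within {0..})"
      unfolding z'_def[abs_def] by (intro has_vector_derivative_add u' t e)
    also have "u'' t = exp (- m * t) *\<^sub>R ((m\<^sup>2 - p * m + q) *\<^sub>R \<alpha>) - p *\<^sub>R u' t - q *\<^sub>R u t"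
      using v[OF t] unfolding v0 by (simp add: v_def algebra_simps)
    finally show ?thesis
      by (rule back_subst[where P = "\<lambda>d. (z' has_vector_derivative d) (at t within {0..})"])
         (simp add: z_def z'_def power2_eq_square algebra_simps)
  qed
  have "z T = (exp (- (p / 2) * T) * cos (\<omega> * T)) *\<^sub>R z 0
           + (exp (- (p / 2) * T) * sin (\<omega> * T)) *\<^sub>R ((1 / \<omega>) *\<^sub>R (z' 0 + (p / 2) *\<^sub>R z 0))"
    by (rule damped_oscillator_solution[OF z z' p \<omega> T])
  moreover have "z 0 = u0 - \<alpha>" "z' 0 = u1 + m *\<^sub>R \<alpha>"
    by (simp_all add: z_def z'_def init)
  moreover have "u T = exp (- m * T) *\<^sub>R \<alpha> + z T"
    by (simp add: z_def)
  ultimately show ?thesis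
    by (simp only: add.assoc)
qed

text \<open>Since m and p are O(s), the coefficient relations give m^2 - p m + q = s + O(s^2) and an
  oscillation frequency r + O(r s). The condition (\<delta> + \<kappa>) r <= 1/2 makes p^2 and p m
  at most s / 4, which keeps both quantities away from zero.\<close>

lemma low_frequency_roots:
  assumes sum: "p + m = (\<delta> + \<kappa>) * s" and mid: "q + p * m = s + \<gamma> * \<beta> * \<kappa> * s\<^sup>2"
    and m: "0 < m" "m \<le> \<kappa> * s" and q: "s \<le> q"
    and r: "r > 0" "(\<delta> + \<kappa>) * r \<le> 1 / 2" and s: "s = r\<^sup>2"
  shows "p \<ge> \<delta> * s" "p \<le> (\<delta> + \<kappa>) * s"
    and "s / 2 \<le> m\<^sup>2 - p * m + q" "\<bar>m\<^sup>2 - p * m + q - s\<bar> \<le> (\<kappa>\<^sup>2 + \<gamma> * \<beta> * \<kappa> + 2 * (\<delta> + \<kappa>) * \<kappa>) * s\<^sup>2"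
    and "\<bar>q - (m\<^sup>2 - p * m + q)\<bar> \<le> ((\<delta> + \<kappa>) * \<kappa> + \<kappa>\<^sup>2) * s\<^sup>2"
    and "r / 2 \<le> sqrt (q - p\<^sup>2 / 4)"
    and "\<bar>sqrt (q - p\<^sup>2 / 4) - r\<bar> \<le> (\<gamma> * \<beta> * \<kappa> + (\<delta> + \<kappa>) * \<kappa> + (\<delta> + \<kappa>)\<^sup>2) * (r * s)"
proof -
  have s_pos: "s > 0" using r s by simp
  show p_ge: "p \<ge> \<delta> * s" and p_le: "p \<le> (\<delta> + \<kappa>) * s"
    using sum m by (simp_all add: algebra_simps)
  have "\<delta> * s > 0" using \<delta> s_pos by simp
  with p_ge have p_pos: "p > 0" by linarith
  have pm: "p * m \<le> ((\<delta> + \<kappa>) * \<kappa>) * s\<^sup>2"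
    using mult_mono[OF p_le m(2)] p_pos m \<delta> \<kappa> s_pos by (simp add: power2_eq_square mult_ac)
  have pm_pos: "p * m \<ge> 0" using p_pos m by simp
  have mm: "m\<^sup>2 \<le> \<kappa>\<^sup>2 * s\<^sup>2"
    using power_mono[OF m(2), of 2] m by (simp add: power_mult_distrib)
  have pp: "p\<^sup>2 \<le> (\<delta> + \<kappa>)\<^sup>2 * s\<^sup>2"
    using power_mono[OF p_le, of 2] p_pos by (simp add: power_mult_distrib)
  have "((\<delta> + \<kappa>) * r)\<^sup>2 \<le> (1 / 2)\<^sup>2"
    using r \<delta> \<kappa> by (intro power_mono) auto
  then have ds: "(\<delta> + \<kappa>)\<^sup>2 * s \<le> 1 / 4"
    by (simp add: s power_mult_distrib power_divide)
  then have dss: "(\<delta> + \<kappa>)\<^sup>2 * s\<^sup>2 \<le> s / 4"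
    using mult_right_mono[OF ds, of s] s_pos by (simp add: power2_eq_square mult_ac)
  have "(\<delta> + \<kappa>) * \<kappa> \<le> (\<delta> + \<kappa>)\<^sup>2"
    using \<delta> \<kappa> by (simp add: power2_eq_square)
  then have "((\<delta> + \<kappa>) * \<kappa>) * s\<^sup>2 \<le> (\<delta> + \<kappa>)\<^sup>2 * s\<^sup>2"
    by (intro mult_right_mono) auto
  with dss pm have pm4: "p * m \<le> s / 4" by linarith
  show "s / 2 \<le> m\<^sup>2 - p * m + q"
    using pm4 q s_pos zero_le_power2[of m] by linarith
  have "\<gamma> * \<beta> * \<kappa> \<ge> 0" using \<gamma> \<beta> \<kappa> by simp
  then have g: "(\<gamma> * \<beta> * \<kappa>) * s\<^sup>2 \<ge> 0" by simp
  show "\<bar>m\<^sup>2 - p * m + q - s\<bar> \<le> (\<kappa>\<^sup>2 + \<gamma> * \<beta> * \<kappa> + 2 * (\<delta> + \<kappa>) * \<kappa>) * s\<^sup>2"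
  proof -
    have "m\<^sup>2 - p * m + q - s = m\<^sup>2 + (\<gamma> * \<beta> * \<kappa>) * s\<^sup>2 - 2 * (p * m)"
      using mid by linarith
    moreover have "(\<kappa>\<^sup>2 + \<gamma> * \<beta> * \<kappa> + 2 * (\<delta> + \<kappa>) * \<kappa>) * s\<^sup>2 = \<kappa>\<^sup>2 * s\<^sup>2 + (\<gamma> * \<beta> * \<kappa>) * s\<^sup>2 + 2 * (((\<delta> + \<kappa>) * \<kappa>) * s\<^sup>2)"
      by (simp add: algebra_simps)
    ultimately show ?thesis
      using pm pm_pos mm g zero_le_power2[of m] by (simp only: abs_le_iff) linarith
  qed
  show "\<bar>q - (m\<^sup>2 - p * m + q)\<bar> \<le> ((\<delta> + \<kappa>) * \<kappa> + \<kappa>\<^sup>2) * s\<^sup>2"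
    using pm pm_pos mm zero_le_power2[of m] unfolding distrib_right[of _ "\<kappa>\<^sup>2"] abs_le_iff by linarith
  define \<omega> where "\<omega> = sqrt (q - p\<^sup>2 / 4)"
  have ge: "(r / 2)\<^sup>2 \<le> q - p\<^sup>2 / 4"
  proof -
    have "(r / 2)\<^sup>2 = s / 4" by (simp add: s power_divide)
    then show ?thesis
      using pp dss q s_pos by linarith
  qed
  then show half: "r / 2 \<le> sqrt (q - p\<^sup>2 / 4)"
    by (rule real_le_rsqrt)
  have "q - p\<^sup>2 / 4 \<ge> 0"
    using ge zero_le_power2[of "r / 2"] by linarith
  then have w2: "\<omega>\<^sup>2 = q - p\<^sup>2 / 4"
    by (simp add: \<omega>_def)
  let ?K = "\<gamma> * \<beta> * \<kappa> + (\<delta> + \<kappa>) * \<kappa> + (\<delta> + \<kappa>)\<^sup>2"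
  \<comment> \<open>Passing to the squares avoids expanding the square root; dividing by r at the
    end gives order r s.\<close>
  have "\<bar>\<omega> - r\<bar> * r \<le> \<bar>\<omega> - r\<bar> * \<bar>\<omega> + r\<bar>"
    using half[folded \<omega>_def] r by (intro mult_left_mono) auto
  also have "\<dots> = \<bar>\<omega>\<^sup>2 - s\<bar>"
    by (simp add: s flip: abs_mult) (simp add: power2_eq_square algebra_simps)
  also have "\<dots> \<le> ?K * s\<^sup>2"
  proof -
    have "?K * s\<^sup>2 = (\<gamma> * \<beta> * \<kappa>) * s\<^sup>2 + ((\<delta> + \<kappa>) * \<kappa>) * s\<^sup>2 + (\<delta> + \<kappa>)\<^sup>2 * s\<^sup>2"
      by (simp add: distrib_right)
    then show ?thesis
      unfolding w2 abs_le_iff using mid pm pm_pos pp g zero_le_power2[of p] by (intro conjI) linarith+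
  qed
  also have "\<dots> = (?K * (r * s)) * r"
    by (simp add: s power2_eq_square)
  finally have "\<bar>\<omega> - r\<bar> \<le> ?K * (r * s)"
    by (rule mult_right_le_imp_le) (use r in simp)
  then show "\<bar>sqrt (q - p\<^sup>2 / 4) - r\<bar> \<le> ?K * (r * s)"
    by (simp add: \<omega>_def)
qed

end

context blackstock_parameters
begin

text \<open>To leading order \<alpha> is u0 + u2 / s, u0 - \<alpha> is - u2 / s, and the sine
  amplitude \<sigma> is u1 / r; with the limiting exponents and phases this is exactly the profile.
  The amplitude errors are O(N), and the errors in exponents and phases gain enough powers of r to
  offset the singular leading amplitudes.\<close>

lemma low_frequency_estimate:
  obtains \<epsilon> a C where "0 < \<epsilon>" "\<epsilon> \<le> 1" "0 < a" "0 < C"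
    "\<And>r (u0::complex) (u1::complex) (u2::complex) (u :: real \<Rightarrow> complex) t. 0 < r \<Longrightarrow> r \<le> \<epsilon> \<Longrightarrow> blackstock_ode b \<nu> \<gamma> \<kappa> (r\<^sup>2) u0 u1 u2 u \<Longrightarrow> 0 \<le> t \<Longrightarrow>
       cmod (u t - J0_hat \<kappa> t r * u0 - J1_hat \<delta> t r * u1 - J2_hat \<delta> \<kappa> t r * u2)
         \<le> C * exp (- a * r\<^sup>2 * t) * (r * cmod u0 + cmod u1 + cmod u2 / r)"
proof -
  define \<epsilon> where "\<epsilon> = min 1 (1 / (2 * (\<delta> + \<kappa>)))"
  have \<epsilon>: "0 < \<epsilon>" "\<epsilon> \<le> 1" "(\<delta> + \<kappa>) * r \<le> 1 / 2" if "r \<le> \<epsilon>" for r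
  proof -
    have "r \<le> 1 / (2 * (\<delta> + \<kappa>))" using that by (simp add: \<epsilon>_def)
    then show "(\<delta> + \<kappa>) * r \<le> 1 / 2" using \<delta> \<kappa> by (simp add: field_simps)
  qed (use \<delta> \<kappa> in \<open>auto simp: \<epsilon>_def\<close>)
  \<comment> \<open>Chosen so that 2 a s is below all four decay rates m, \<kappa> s, p / 2 and
    \<delta> s / 2 when s <= 1. Half of this rate pays for factors of t.\<close>
  define a where "a = min (\<kappa> / (1 + \<gamma> * \<beta> * \<kappa>) / 2) (\<delta> / 4)"
  have g: "\<gamma> * \<beta> * \<kappa> > 0" using \<gamma> \<beta> \<kappa> by simp
  have a: "a > 0" unfolding a_def using g \<delta> \<kappa> by simp
  define Kw where "Kw = \<gamma> * \<beta> * \<kappa> + (\<delta> + \<kappa>) * \<kappa> + (\<delta> + \<kappa>)\<^sup>2"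
  define KM where "KM = \<kappa>\<^sup>2 + \<gamma> * \<beta> * \<kappa> + 2 * (\<delta> + \<kappa>) * \<kappa>"
  define Kq where "Kq = (\<delta> + \<kappa>) * \<kappa> + \<kappa>\<^sup>2"
  define K1 where "K1 = 2 * KM + 2 * (\<delta> + \<kappa>) + 2 * Kq"
  define K2 where "K2 = \<gamma> * \<beta> * \<kappa>\<^sup>2 / a"
  define K3 where "K3 = (\<gamma> * \<beta> * \<kappa>\<^sup>2 / 2 + Kw) / a"
  define K4 where "K4 = 2 * Kw + 2 * (\<kappa> * (1 + K1) + (\<delta> + \<kappa>) / 2 * (2 + K1))"
  have Kpos: "Kw > 0" "KM > 0" "Kq > 0" "K1 > 0" "K2 > 0" "K3 > 0" "K4 > 0"
    unfolding K1_def K2_def K3_def K4_def Kw_def KM_def Kq_def using g \<delta> \<kappa> \<gamma> \<beta> a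
    by (auto intro!: add_pos_pos divide_pos_pos mult_pos_pos)
  define C where "C = 2 * K1 + K2 + 2 * K3 + K4"
  have C: "C > 0" unfolding C_def using Kpos by simp
  have main: "cmod (u t - J0_hat \<kappa> t r * u0 - J1_hat \<delta> t r * u1 - J2_hat \<delta> \<kappa> t r * u2)
         \<le> C * exp (- a * r\<^sup>2 * t) * (r * cmod u0 + cmod u1 + cmod u2 / r)"
    if r: "0 < r" "r \<le> \<epsilon>" and ode: "blackstock_ode b \<nu> \<gamma> \<kappa> (r\<^sup>2) u0 u1 u2 u" and t: "0 \<le> t" for r t and u0 u1 u2 :: complex and u :: "real \<Rightarrow> complex"
  proof -
    define s where "s = r\<^sup>2"
    have s_pos: "s > 0" using r by (simp add: s_def)
    have r1: "r \<le> 1" using r \<epsilon>(2)[of r] by simp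
    have s_le: "s \<le> r" using r r1 by (simp add: s_def power2_eq_square mult_left_le)
    have s1: "s \<le> 1" using s_le r1 by simp
    have dr: "(\<delta> + \<kappa>) * r \<le> 1 / 2" using \<epsilon>(3)[OF r(2)] .
    obtain m p q where sum: "p + m = (\<delta> + \<kappa>) * s" and mid: "q + p * m = s + \<gamma> * \<beta> * \<kappa> * s\<^sup>2" and prod: "q * m = \<kappa> * s\<^sup>2"
      and m: "\<kappa> * s / (1 + \<gamma> * \<beta> * \<kappa> * s) \<le> m" "m \<le> \<kappa> * s" and m_diff: "\<kappa> * s - m \<le> \<gamma> * \<beta> * \<kappa>\<^sup>2 * s\<^sup>2" and q: "s \<le> q"
      using cubic_factorization[OF \<beta> \<gamma> \<kappa> small s_pos \<delta>_eq] by metis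
    have m_ge: "2 * a * s \<le> m"
    proof -
      have "2 * a \<le> \<kappa> / (1 + \<gamma> * \<beta> * \<kappa>)"
      proof -
        have "a \<le> \<kappa> / (1 + \<gamma> * \<beta> * \<kappa>) / 2"
          by (simp only: a_def min.cobounded1)
        then show ?thesis by (simp only: le_divide_eq_numeral1 mult.commute[of 2])
      qed
      also have "\<dots> \<le> \<kappa> / (1 + \<gamma> * \<beta> * \<kappa> * s)"
        using g \<kappa> \<gamma> \<beta> s_pos s1 by (intro divide_left_mono mult_pos_pos add_left_mono mult_left_le add_pos_pos) auto
      finally have "2 * a * s \<le> \<kappa> / (1 + \<gamma> * \<beta> * \<kappa> * s) * s"
        using s_pos by (intro mult_right_mono) auto
      with m show ?thesis by simp
    qed
    have "2 * a * s > 0" using a s_pos by simp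
    with m_ge have m_pos: "m > 0" by linarith
    note roots = low_frequency_roots[OF sum mid m_pos m(2) q r(1) dr s_def]
    define M where "M = m\<^sup>2 - p * m + q"
    define \<omega> where "\<omega> = sqrt (q - p\<^sup>2 / 4)"
    have p: "p \<ge> \<delta> * s" "p \<le> (\<delta> + \<kappa>) * s" using roots by auto
    have "\<delta> * s > 0" using \<delta> s_pos by simp
    with p have p_pos: "p > 0" by linarith
    have M: "s / 2 \<le> M" "\<bar>M - s\<bar> \<le> KM * s\<^sup>2" "\<bar>q - M\<bar> \<le> Kq * s\<^sup>2"
      using roots by (simp_all add: M_def KM_def Kq_def)
    have \<omega>: "r / 2 \<le> \<omega>" "\<bar>\<omega> - r\<bar> \<le> Kw * (r * s)"
      using roots by (simp_all add: \<omega>_def Kw_def)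
    have \<omega>_pos: "\<omega> > 0" using \<omega>(1) r by linarith
    then have "q - p\<^sup>2 / 4 > 0" by (simp add: \<omega>_def)
    then have \<omega>2: "\<omega>\<^sup>2 = q - p\<^sup>2 / 4" by (simp add: \<omega>_def)
    have M_pos: "M > 0" using M(1) s_pos by linarith
    define \<alpha> where "\<alpha> = (1 / M) *\<^sub>R (u2 + p *\<^sub>R u1 + q *\<^sub>R u0)"
    define \<sigma> where "\<sigma> = (1 / \<omega>) *\<^sub>R (u1 + m *\<^sub>R \<alpha> + (p / 2) *\<^sub>R (u0 - \<alpha>))"
    define E where "E = exp (- (2 * a * s * t))"
    define F where "F = exp (- (a * s * t))"
    define e1 where "e1 = exp (- (m * t))"
    define e2 where "e2 = exp (- (\<kappa> * s * t))"
    define c1 where "c1 = exp (- (p / 2 * t)) * cos (\<omega> * t)"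
    define c2 where "c2 = exp (- (\<delta> / 2 * s * t)) * cos (r * t)"
    define s1 where "s1 = exp (- (p / 2 * t)) * sin (\<omega> * t)"
    define s2 where "s2 = exp (- (\<delta> / 2 * s * t)) * sin (r * t)"
    define N where "N = r * cmod u0 + cmod u1 + cmod u2 / r"
    have N_ge: "r * cmod u0 \<le> N" "cmod u1 \<le> N" "cmod u2 / r \<le> N" "0 \<le> N"
      using r by (simp_all add: N_def)
    have u: "u t = e1 *\<^sub>R \<alpha> + c1 *\<^sub>R (u0 - \<alpha>) + s1 *\<^sub>R \<sigma>"
      using third_order_representation[OF ode[folded s_def] sum mid prod less_imp_le[OF p_pos] \<omega>_pos \<omega>2 _ t] M_pos
      by (simp add: M_def \<alpha>_def \<sigma>_def e1_def c1_def s1_def)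
    have J: "J0_hat \<kappa> t r = e2" "J1_hat \<delta> t r = s2 / r" "J2_hat \<delta> \<kappa> t r = (e2 - c2) / s"
      by (simp_all add: J0_hat_def J1_hat_def J2_hat_def e2_def s2_def c2_def s_def diff_divide_distrib mult_ac)
    \<comment> \<open>Each of the three modes is compared in two stages, first the amplitude and
      then the time factor, giving six terms that are bounded separately.\<close>
    have split: "u t - J0_hat \<kappa> t r * u0 - J1_hat \<delta> t r * u1 - J2_hat \<delta> \<kappa> t r * u2 =
       e1 *\<^sub>R (\<alpha> - u0 - u2 /\<^sub>R s) + (e1 - e2) *\<^sub>R (u0 + u2 /\<^sub>R s) - c1 *\<^sub>R (\<alpha> - u0 - u2 /\<^sub>R s)
         - (c1 - c2) *\<^sub>R (u2 /\<^sub>R s) + s1 *\<^sub>R (\<sigma> - u1 /\<^sub>R r) + (s1 - s2) *\<^sub>R (u1 /\<^sub>R r)"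
      unfolding u J using r s_pos by (simp add: scaleR_conv_of_real algebra_simps divide_simps)
    have ts: "0 \<le> s * t" using s_pos t by simp
    have low: "2 * a * s * t \<le> m * t" "2 * a * s * t \<le> \<kappa> * s * t" "2 * a * s * t \<le> p / 2 * t" "2 * a * s * t \<le> \<delta> / 2 * s * t"
    proof -
      show 1: "2 * a * s * t \<le> m * t"
        using m_ge t by (intro mult_right_mono) auto
      show "2 * a * s * t \<le> \<kappa> * s * t"
        using 1 mult_right_mono[OF m(2) t] by linarith
      have "4 * a \<le> \<delta>" by (simp add: a_def min_le_iff_disj)
      then have \<delta>a: "2 * a * s \<le> \<delta> / 2 * s" using s_pos by (intro mult_right_mono) auto
      then have "2 * a * s \<le> p / 2" using p by linarith
      then show "2 * a * s * t \<le> p / 2 * t" using t by (rule mult_right_mono)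
      show "2 * a * s * t \<le> \<delta> / 2 * s * t" using \<delta>a t by (rule mult_right_mono)
    qed
    have tE: "s * t * E \<le> F / a"
      \<comment> \<open>Converts the factor s t produced by differences of exponents and phases into
        the constant 1 / a, uniformly in t and s.\<close>
      using times_exp_le[of "a * s" t] a s_pos by (simp add: E_def F_def field_simps)
    have EF: "E \<le> F" "0 \<le> F"
      using ts a by (auto simp: E_def F_def mult_ac)
    have abs1: "\<bar>e1\<bar> \<le> F" "\<bar>c1\<bar> \<le> F" "\<bar>s1\<bar> \<le> F"
    proof -
      have "exp (- (m * t)) \<le> E" "exp (- (p / 2 * t)) \<le> E"
        using low by (auto simp: E_def)
      then have *: "exp (- (m * t)) \<le> F" "exp (- (p / 2 * t)) \<le> F" using EF by auto
      show "\<bar>e1\<bar> \<le> F" using * by (simp add: e1_def)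
      have "\<bar>c1\<bar> \<le> exp (- (p / 2 * t)) * 1" "\<bar>s1\<bar> \<le> exp (- (p / 2 * t)) * 1"
        unfolding c1_def s1_def abs_mult by (auto intro!: mult_mono)
      with * show "\<bar>c1\<bar> \<le> F" "\<bar>s1\<bar> \<le> F" by auto
    qed
    have e12: "\<bar>e1 - e2\<bar> \<le> K2 * s * F"
    proof -
      have "\<bar>e1 - e2\<bar> \<le> \<bar>m * t - \<kappa> * s * t\<bar> * E"
        unfolding e1_def e2_def E_def using low by (intro abs_exp_diff_le) auto
      also have "\<bar>m * t - \<kappa> * s * t\<bar> = (\<kappa> * s - m) * t"
        using mult_right_mono[OF m(2) t] by (simp add: algebra_simps)
      also have "\<dots> * E \<le> (\<gamma> * \<beta> * \<kappa>\<^sup>2 * s\<^sup>2) * t * E"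
        using t m_diff by (intro mult_right_mono) (auto simp: E_def)
      also have "\<dots> = (\<gamma> * \<beta> * \<kappa>\<^sup>2 * s) * (s * t * E)"
        by (simp add: power2_eq_square)
      also have "\<dots> \<le> (\<gamma> * \<beta> * \<kappa>\<^sup>2 * s) * (F / a)"
        using tE \<gamma> \<beta> s_pos by (intro mult_left_mono) auto
      finally show ?thesis by (simp add: K2_def mult_ac)
    qed
    have cs: "(\<bar>p / 2 * t - \<delta> / 2 * s * t\<bar> + \<bar>\<omega> * t - r * t\<bar>) * E \<le> K3 * r * F"
    proof -
      have "p - \<delta> * s = \<kappa> * s - m" using sum by (simp add: algebra_simps)
      then have "0 \<le> p - \<delta> * s" "p - \<delta> * s \<le> \<gamma> * \<beta> * \<kappa>\<^sup>2 * s\<^sup>2" using m m_diff by auto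
      moreover have "\<gamma> * \<beta> * \<kappa>\<^sup>2 * s\<^sup>2 \<le> \<gamma> * \<beta> * \<kappa>\<^sup>2 * (r * s)"
        using s_le s_pos \<gamma> \<beta> by (intro mult_left_mono) (auto simp: power2_eq_square)
      ultimately have "\<bar>p / 2 - \<delta> / 2 * s\<bar> \<le> (\<gamma> * \<beta> * \<kappa>\<^sup>2 / 2) * (r * s)" by (simp add: abs_le_iff)
      then have "\<bar>p / 2 - \<delta> / 2 * s\<bar> + \<bar>\<omega> - r\<bar> \<le> (\<gamma> * \<beta> * \<kappa>\<^sup>2 / 2 + Kw) * (r * s)"
        using \<omega>(2) by (simp add: distrib_right)
      then have "(\<bar>p / 2 - \<delta> / 2 * s\<bar> + \<bar>\<omega> - r\<bar>) * (t * E) \<le> (\<gamma> * \<beta> * \<kappa>\<^sup>2 / 2 + Kw) * (r * s) * (t * E)"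
        using t by (intro mult_right_mono) (auto simp: E_def)
      also have "\<dots> = (\<gamma> * \<beta> * \<kappa>\<^sup>2 / 2 + Kw) * r * (s * t * E)"
        by (simp add: mult_ac)
      also have "\<dots> \<le> (\<gamma> * \<beta> * \<kappa>\<^sup>2 / 2 + Kw) * r * (F / a)"
        using tE r \<gamma> \<beta> Kpos by (intro mult_left_mono) auto
      also have "\<dots> = K3 * r * F" by (simp add: K3_def)
      finally have 1: "(\<bar>p / 2 - \<delta> / 2 * s\<bar> + \<bar>\<omega> - r\<bar>) * (t * E) \<le> K3 * r * F" .
      have "\<bar>p / 2 * t - \<delta> / 2 * s * t\<bar> = \<bar>p / 2 - \<delta> / 2 * s\<bar> * t" "\<bar>\<omega> * t - r * t\<bar> = \<bar>\<omega> - r\<bar> * t"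
        by (simp_all only: left_diff_distrib[symmetric] abs_mult abs_of_nonneg[OF t])
      then show ?thesis using 1 by (simp only: distrib_right mult.assoc)
    qed
    have c12: "\<bar>c1 - c2\<bar> \<le> K3 * r * F"
      unfolding c1_def c2_def
      by (rule order_trans[OF abs_damped_diff_le cs[unfolded E_def]]) (use low abs_cos_diff_le in auto)
    have s12: "\<bar>s1 - s2\<bar> \<le> K3 * r * F"
      unfolding s1_def s2_def
      by (rule order_trans[OF abs_damped_diff_le cs[unfolded E_def]]) (use low abs_sin_diff_le in auto)
    have inv_M: "1 / M \<le> 2 / s" using M(1) s_pos M_pos by (simp add: field_simps)
    have T1: "cmod (\<alpha> - u0 - u2 /\<^sub>R s) \<le> K1 * N"
    proof -
      have "\<alpha> - u0 - u2 /\<^sub>R s = (1 / M - 1 / s) *\<^sub>R u2 + (p / M) *\<^sub>R u1 + ((q - M) / M) *\<^sub>R u0"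
        using M_pos by (simp add: \<alpha>_def algebra_simps diff_divide_distrib inverse_eq_divide)
      also have "cmod \<dots> \<le> \<bar>1 / M - 1 / s\<bar> * cmod u2 + \<bar>p / M\<bar> * cmod u1 + \<bar>(q - M) / M\<bar> * cmod u0"
        by (intro order_trans[OF norm_triangle_ineq] add_mono) simp_all
      also have "\<bar>1 / M - 1 / s\<bar> \<le> 2 * KM / r"
      proof -
        have "\<bar>1 / M - 1 / s\<bar> = \<bar>M - s\<bar> / s * (1 / M)"
          using M_pos s_pos by (simp add: diff_frac_eq abs_mult abs_minus_commute mult_ac)
        also have "\<dots> \<le> (KM * s\<^sup>2) / s * (2 / s)"
          using M(2) inv_M M_pos s_pos by (intro mult_mono divide_right_mono) auto
        also have "\<dots> = 2 * KM" using s_pos by (simp add: power2_eq_square)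
        also have "\<dots> \<le> 2 * KM / r" using r r1 Kpos by (simp add: le_divide_eq mult_left_le)
        finally show ?thesis .
      qed
      also have "\<bar>p / M\<bar> \<le> 2 * (\<delta> + \<kappa>)"
      proof -
        have "\<bar>p / M\<bar> = p * (1 / M)" using p_pos M_pos by simp
        also have "\<dots> \<le> ((\<delta> + \<kappa>) * s) * (2 / s)"
          using p p_pos inv_M M_pos by (intro mult_mono) auto
        finally show ?thesis using s_pos by simp
      qed
      also have "\<bar>(q - M) / M\<bar> \<le> 2 * Kq * r"
      proof -
        have "\<bar>(q - M) / M\<bar> = \<bar>q - M\<bar> * (1 / M)" using M_pos by (simp add: abs_divide)
        also have "\<dots> \<le> (Kq * s\<^sup>2) * (2 / s)"
          using M(3) inv_M M_pos by (intro mult_mono) auto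
        also have "\<dots> = 2 * Kq * s" using s_pos by (simp add: power2_eq_square)
        also have "\<dots> \<le> 2 * Kq * r" using s_le Kpos by (intro mult_left_mono) auto
        finally show ?thesis .
      qed
      finally have "cmod (\<alpha> - u0 - u2 /\<^sub>R s) \<le> 2 * KM * (cmod u2 / r) + 2 * (\<delta> + \<kappa>) * cmod u1 + 2 * Kq * (r * cmod u0)"
        by (simp add: mult_right_mono mult_ac)
      also have "\<dots> \<le> 2 * KM * N + 2 * (\<delta> + \<kappa>) * N + 2 * Kq * N"
        using N_ge Kpos \<delta> \<kappa> by (intro add_mono mult_left_mono) auto
      finally show ?thesis by (simp add: K1_def algebra_simps)
    qed
    have s_u2: "s * cmod (u2 /\<^sub>R s) = r * (cmod u2 / r)"
      using s_pos r by simp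
    have s_u0: "s * cmod u0 = r * (r * cmod u0)"
      by (simp add: s_def power2_eq_square)
    \<comment> \<open>The leading amplitude has size N / r, but \<open>e1 - e2\<close> carries a
      factor s = r^2, which compensates the singularity.\<close>
    have T2: "s * cmod (u0 + u2 /\<^sub>R s) \<le> r * N"
    proof -
      have "s * cmod (u0 + u2 /\<^sub>R s) \<le> s * cmod u0 + s * cmod (u2 /\<^sub>R s)"
        unfolding distrib_left[symmetric] using s_pos by (intro mult_left_mono norm_triangle_ineq) auto
      also have "\<dots> = r * (r * cmod u0 + cmod u2 / r)"
        unfolding s_u0 s_u2 by (simp only: distrib_left)
      also have "\<dots> \<le> r * N" using r by (intro mult_left_mono) (auto simp: N_def)
      finally show ?thesis .
    qed
    have s\<alpha>: "s * cmod \<alpha> \<le> (1 + K1) * (r * N)"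
    proof -
      have "s * cmod \<alpha> \<le> s * cmod (u0 + u2 /\<^sub>R s) + s * cmod (\<alpha> - u0 - u2 /\<^sub>R s)"
        unfolding distrib_left[symmetric] using s_pos norm_triangle_ineq[of "u0 + u2 /\<^sub>R s" "\<alpha> - u0 - u2 /\<^sub>R s"]
        by (intro mult_left_mono) (auto simp: algebra_simps)
      also have "\<dots> \<le> r * N + r * (K1 * N)"
        using T1 s_le s_pos r by (intro add_mono T2 mult_mono) auto
      finally show ?thesis by (simp add: algebra_simps)
    qed
    have sz: "s * cmod (u0 - \<alpha>) \<le> (2 + K1) * (r * N)"
    proof -
      have "s * cmod (u0 - \<alpha>) \<le> s * cmod u0 + s * cmod \<alpha>"
        unfolding distrib_left[symmetric] using s_pos by (intro mult_left_mono norm_triangle_ineq4) auto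
      also have "\<dots> \<le> r * N + (1 + K1) * (r * N)"
        unfolding s_u0 using N_ge r by (intro add_mono s\<alpha> mult_left_mono) auto
      finally show ?thesis by (simp add: algebra_simps)
    qed
    have inv_\<omega>: "1 / \<omega> \<le> 2 / r" using \<omega>(1) \<omega>_pos r by (simp add: field_simps)
    \<comment> \<open>The coefficients m and p are O(s), so multiplying the singular amplitudes by
      them leaves O(r N); the factor 1 / \<omega> <= 2 / r then gives O(N).\<close>
    have T5: "cmod (\<sigma> - u1 /\<^sub>R r) \<le> K4 * N"
    proof -
      have "\<sigma> - u1 /\<^sub>R r = (1 / \<omega> - 1 / r) *\<^sub>R u1 + (1 / \<omega>) *\<^sub>R (m *\<^sub>R \<alpha> + (p / 2) *\<^sub>R (u0 - \<alpha>))"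
        by (simp add: \<sigma>_def algebra_simps inverse_eq_divide)
      also have "cmod \<dots> \<le> \<bar>1 / \<omega> - 1 / r\<bar> * cmod u1 + (1 / \<omega>) * (m * cmod \<alpha> + p / 2 * cmod (u0 - \<alpha>))"
        using \<omega>_pos m_pos p_pos norm_triangle_ineq[of "m *\<^sub>R \<alpha>" "(p / 2) *\<^sub>R (u0 - \<alpha>)"]
        by (intro order_trans[OF norm_triangle_ineq] add_mono) (simp_all add: divide_right_mono)
      also have "\<bar>1 / \<omega> - 1 / r\<bar> \<le> 2 * Kw"
      proof -
        have "\<bar>1 / \<omega> - 1 / r\<bar> = \<bar>\<omega> - r\<bar> / r * (1 / \<omega>)"
          using \<omega>_pos r by (simp add: diff_frac_eq abs_mult abs_minus_commute mult_ac)
        also have "\<dots> \<le> (Kw * (r * s)) / r * (2 / r)"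
          using \<omega>(2) inv_\<omega> \<omega>_pos r Kpos s_pos by (intro mult_mono divide_right_mono) auto
        also have "\<dots> = 2 * Kw * r" using r by (simp add: s_def power2_eq_square)
        also have "\<dots> \<le> 2 * Kw" using r1 Kpos r by (simp add: mult_left_le)
        finally show ?thesis .
      qed
      also have "m * cmod \<alpha> \<le> \<kappa> * ((1 + K1) * (r * N))"
      proof -
        have "m * cmod \<alpha> \<le> (\<kappa> * s) * cmod \<alpha>" by (intro mult_right_mono m) auto
        also have "\<dots> = \<kappa> * (s * cmod \<alpha>)" by simp
        also have "\<dots> \<le> \<kappa> * ((1 + K1) * (r * N))" using \<kappa> by (intro mult_left_mono s\<alpha>) auto
        finally show ?thesis .
      qed
      also have "p / 2 * cmod (u0 - \<alpha>) \<le> (\<delta> + \<kappa>) / 2 * ((2 + K1) * (r * N))"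
      proof -
        have "p / 2 * cmod (u0 - \<alpha>) \<le> ((\<delta> + \<kappa>) / 2 * s) * cmod (u0 - \<alpha>)" using p by (intro mult_right_mono) auto
        also have "\<dots> = (\<delta> + \<kappa>) / 2 * (s * cmod (u0 - \<alpha>))" by simp
        also have "\<dots> \<le> (\<delta> + \<kappa>) / 2 * ((2 + K1) * (r * N))" using \<delta> \<kappa> by (intro mult_left_mono sz) auto
        finally show ?thesis .
      qed
      finally have "cmod (\<sigma> - u1 /\<^sub>R r) \<le> 2 * Kw * cmod u1 +
          (1 / \<omega>) * (\<kappa> * ((1 + K1) * (r * N)) + (\<delta> + \<kappa>) / 2 * ((2 + K1) * (r * N)))"
        using \<omega>_pos by (simp add: mult_right_mono divide_right_mono)
      also have "\<dots> \<le> 2 * Kw * N + (2 / r) * (\<kappa> * ((1 + K1) * (r * N)) + (\<delta> + \<kappa>) / 2 * ((2 + K1) * (r * N)))"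
        using N_ge Kpos \<delta> \<kappa> r inv_\<omega> by (intro add_mono mult_left_mono mult_right_mono) auto
      also have "\<dots> = K4 * N"
        using r by (simp add: K4_def field_simps)
      finally show ?thesis .
    qed
    have "cmod (u t - J0_hat \<kappa> t r * u0 - J1_hat \<delta> t r * u1 - J2_hat \<delta> \<kappa> t r * u2)
       \<le> \<bar>e1\<bar> * cmod (\<alpha> - u0 - u2 /\<^sub>R s) + \<bar>e1 - e2\<bar> * cmod (u0 + u2 /\<^sub>R s) + \<bar>c1\<bar> * cmod (\<alpha> - u0 - u2 /\<^sub>R s)
         + \<bar>c1 - c2\<bar> * cmod (u2 /\<^sub>R s) + \<bar>s1\<bar> * cmod (\<sigma> - u1 /\<^sub>R r) + \<bar>s1 - s2\<bar> * cmod (u1 /\<^sub>R r)"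
      unfolding split
      by (intro order_trans[OF norm_triangle_ineq] order_trans[OF norm_triangle_ineq4] add_mono) (simp_all only: norm_scaleR order_refl)
    also have "\<dots> \<le> F * (K1 * N) + (K2 * F) * (1 * N) + F * (K1 * N) + (K3 * F) * N + F * (K4 * N) + (K3 * F) * N"
    proof (intro add_mono)
      show "\<bar>e1 - e2\<bar> * cmod (u0 + u2 /\<^sub>R s) \<le> (K2 * F) * (1 * N)"
      proof -
        have "\<bar>e1 - e2\<bar> * cmod (u0 + u2 /\<^sub>R s) \<le> (K2 * s * F) * cmod (u0 + u2 /\<^sub>R s)"
          by (intro mult_right_mono e12) auto
        also have "\<dots> = (K2 * F) * (s * cmod (u0 + u2 /\<^sub>R s))" by simp
        also have "\<dots> \<le> (K2 * F) * (1 * N)"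
          using Kpos EF N_ge by (intro mult_left_mono order_trans[OF T2] mult_right_mono r1) auto
        finally show ?thesis .
      qed
      show "\<bar>c1 - c2\<bar> * cmod (u2 /\<^sub>R s) \<le> (K3 * F) * N"
      proof -
        have "\<bar>c1 - c2\<bar> * cmod (u2 /\<^sub>R s) \<le> (K3 * r * F) * cmod (u2 /\<^sub>R s)"
          by (intro mult_right_mono c12) auto
        also have "\<dots> = (K3 * F) * (cmod u2 / r)"
          using r by (simp add: s_def power2_eq_square field_simps)
        also have "\<dots> \<le> (K3 * F) * N"
          using Kpos EF N_ge by (intro mult_left_mono) auto
        finally show ?thesis .
      qed
      show "\<bar>s1 - s2\<bar> * cmod (u1 /\<^sub>R r) \<le> (K3 * F) * N"
      proof -
        have "\<bar>s1 - s2\<bar> * cmod (u1 /\<^sub>R r) \<le> (K3 * r * F) * cmod (u1 /\<^sub>R r)"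
          by (intro mult_right_mono s12) auto
        also have "\<dots> = (K3 * F) * cmod u1"
          using r by simp
        also have "\<dots> \<le> (K3 * F) * N"
          using Kpos EF N_ge by (intro mult_left_mono) auto
        finally show ?thesis .
      qed
    qed (use abs1 EF T1 T5 in \<open>auto intro: mult_mono\<close>)
    also have "\<dots> = C * F * N"
      by (simp add: C_def algebra_simps)
    finally show ?thesis
      by (simp add: F_def N_def s_def)
  qed
  show thesis
    by (rule that[OF \<epsilon>(1)[OF order_refl] \<epsilon>(2)[OF order_refl] a C]) (rule main)
qed

end

section \<open>Gaussian moments\<close>

lemma integrable_powr_gaussian_real:
  fixes a c :: real
  assumes a: "0 \<le> a" "a < 1" and c: "c > 0"
  shows "integrable lborel (\<lambda>x. \<bar>x\<bar> powr (- a) * exp (- (c * x\<^sup>2)))"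
proof -
  define k where "k x = (if x \<in> {0..1} then x powr (- a) else 0)" for x :: real
  have [measurable]: "k \<in> borel_measurable borel"
    unfolding k_def by measurable
  have "((\<lambda>x. x powr (- a)) has_integral 1 powr (- a + 1) / (- a + 1)) {0..1}"
    using a by (intro has_integral_powr_from_0) auto
  then have has_int: "(k has_integral 1 powr (- a + 1) / (- a + 1)) UNIV"
    unfolding k_def[abs_def] by (simp only: has_integral_restrict_UNIV)
  have k0: "0 \<le> k x" for x
    by (simp add: k_def)
  have "(\<integral>\<^sup>+x. ennreal (k x) \<partial>lborel) = ennreal (1 powr (- a + 1) / (- a + 1))"
    by (rule nn_integral_has_integral_lborel[OF _ k0 has_int]) measurable
  then have k: "integrable lborel k"
    by (intro integrableI_nn_integral_finite[OF _ _ \<open>_ = ennreal (1 powr (- a + 1) / (- a + 1))\<close>]) (simp_all add: k0)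
  have "integrable lborel (\<lambda>x. k (0 + (-1) * x))"
    by (rule lborel_integrable_real_affine[OF k]) simp
  \<comment> \<open>The first two terms dominate on [-1, 1], where the Gaussian is at most 1;
    outside, the power is at most 1 and the Gaussian dominates.\<close>
  then have "integrable lborel (\<lambda>x. k x + k (- x) + exp (- (c * x\<^sup>2)))"
    using k integrable_gaussian_real[OF c] by simp
  then show ?thesis
  proof (rule Bochner_Integration.integrable_bound)
    have "\<bar>x\<bar> powr (- a) * exp (- (c * x\<^sup>2)) \<le> k x + k (- x) + exp (- (c * x\<^sup>2))" for x
    proof (cases "\<bar>x\<bar> \<le> 1")
      case True
      have "\<bar>x\<bar> powr (- a) * exp (- (c * x\<^sup>2)) \<le> \<bar>x\<bar> powr (- a)"
        using c by (intro mult_left_le) auto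
      also have "\<dots> \<le> k x + k (- x)"
        using True by (auto simp: k_def abs_if)
      finally show ?thesis
        using exp_ge_zero[of "- (c * x\<^sup>2)"] by linarith
    next
      case False
      then have "\<bar>x\<bar> powr (- a) \<le> \<bar>x\<bar> powr 0"
        using a by (intro powr_mono) auto
      then have "\<bar>x\<bar> powr (- a) * exp (- (c * x\<^sup>2)) \<le> 1 * exp (- (c * x\<^sup>2))"
        using False by (intro mult_right_mono) (auto split: if_splits)
      then show ?thesis
        by (simp add: k_def add_increasing)
    qed
    then show "AE x in lborel. norm (\<bar>x\<bar> powr (- a) * exp (- (c * x\<^sup>2))) \<le> norm (k x + k (- x) + exp (- (c * x\<^sup>2)))"
      by (intro AE_I2) (simp add: abs_mult order_trans[OF _ abs_ge_self])
  qed measurable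
qed

lemma AE_lborel_inner_nonzero:
  fixes b :: "'a::euclidean_space"
  assumes "b \<noteq> 0"
  shows "AE x in lborel. x \<bullet> b \<noteq> 0"
proof -
  have "negligible {x. b \<bullet> x = 0}"
    using assms by (intro negligible_hyperplane) auto
  then have "AE x in lebesgue. x \<notin> {x. b \<bullet> x = 0}"
    by (intro AE_not_in) (simp add: negligible_iff_null_sets)
  then show ?thesis
    by (simp add: AE_completion_iff inner_commute)
qed

text \<open>Since \<open>\<bar>x \<bullet> i\<bar> \<le> norm x\<close>, the singularity is dominated by the product of the
  \<open>\<bar>x \<bullet> i\<bar> powr (- 2 / n)\<close>, whose factors are locally integrable exactly when \<open>n > 2\<close>.\<close>

lemma integrable_inverse_sq_gaussian:
  assumes n: "DIM('a::euclidean_space) \<ge> 3" and c: "c > 0"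
  shows "integrable lborel (\<lambda>x::'a. exp (- (c * (norm x)\<^sup>2)) / (norm x)\<^sup>2)"
proof -
  define a where "a = 2 / real DIM('a)"
  have a: "0 \<le> a" "a < 1" using n by (auto simp: a_def)
  have "integrable lborel (\<lambda>x::'a. \<Prod>b\<in>Basis. \<bar>x \<bullet> b\<bar> powr (- a) * exp (- (c * (x \<bullet> b)\<^sup>2)))"
    by (intro integrable_lborel_prod integrable_powr_gaussian_real a c)
  then show ?thesis
  proof (rule Bochner_Integration.integrable_bound)
    \<comment> \<open>The coordinate hyperplanes must be removed: there
      \<open>0 powr (- a) = 0\<close> would make the majorant vanish.\<close>
    have "AE x::'a in lborel. \<forall>b\<in>Basis. x \<bullet> b \<noteq> 0"
      by (intro AE_finite_allI) (auto intro!: AE_lborel_inner_nonzero)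
    then show "AE x::'a in lborel. norm (exp (- (c * (norm x)\<^sup>2)) / (norm x)\<^sup>2)
        \<le> norm (\<Prod>b\<in>Basis. \<bar>x \<bullet> b\<bar> powr (- a) * exp (- (c * (x \<bullet> b)\<^sup>2)))"
    proof eventually_elim
      case (elim x)
      have x: "norm x > 0"
        using elim SOME_Basis by fastforce
      have "1 / (norm x)\<^sup>2 = norm x powr (- 2)"
        using x by (simp add: powr_minus_divide powr_numeral)
      also have "- 2 = - a * real DIM('a)"
        using n by (simp add: a_def)
      also have "norm x powr (- a * real DIM('a)) = (norm x powr (- a)) ^ DIM('a)"
        using x by (simp only: powr_powr[symmetric]) (simp add: powr_realpow)
      also have "\<dots> = (\<Prod>b\<in>(Basis :: 'a set). norm x powr (- a))"
        by simp
      also have "\<dots> \<le> (\<Prod>b\<in>Basis. \<bar>x \<bullet> b\<bar> powr (- a))"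
        using elim a by (intro prod_mono conjI powr_mono2') (auto simp: Basis_le_norm)
      finally have "exp (- (c * (norm x)\<^sup>2)) * (1 / (norm x)\<^sup>2)
          \<le> (\<Prod>b\<in>Basis. exp (- (c * (x \<bullet> b)\<^sup>2))) * (\<Prod>b\<in>Basis. \<bar>x \<bullet> b\<bar> powr (- a))"
        unfolding exp_norm_eq_prod by (intro mult_left_mono prod_nonneg) auto
      then show ?case
        by (simp add: prod.distrib abs_mult mult.commute prod_nonneg)
    qed
  qed measurable
qed

lemma gaussian_integral_scale:
  fixes c s :: real
  assumes s: "s > 0"
  shows "(LINT x|lborel. exp (- (c * s * (norm (x::'a::euclidean_space))\<^sup>2))) =
      s powr (- real DIM('a) / 2) * (LINT x|lborel. exp (- (c * (norm (x::'a))\<^sup>2)))"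
    and "(LINT x|lborel. exp (- (c * s * (norm (x::'a))\<^sup>2)) / (norm x)\<^sup>2) =
      s powr (1 - real DIM('a) / 2) * (LINT x|lborel. exp (- (c * (norm (x::'a))\<^sup>2)) / (norm x)\<^sup>2)"
proof -
  define k where "k = 1 / sqrt s"
  have k: "k > 0" "k\<^sup>2 = 1 / s" using s by (auto simp: k_def power_divide)
  have kn: "k ^ DIM('a) = s powr (- real DIM('a) / 2)"
  proof -
    have "k = s powr (- (1 / 2))"
      using s by (simp add: k_def powr_minus_divide powr_half_sqrt)
    then show ?thesis
      using s by (simp add: powr_powr flip: powr_realpow)
  qed
  have e: "c * s * (norm (k *\<^sub>R x))\<^sup>2 = c * (norm x)\<^sup>2" for x :: 'a
    using s by (simp add: power_mult_distrib k)
  have "(LINT x|lborel. exp (- (c * s * (norm (x::'a))\<^sup>2))) = \<bar>k\<bar> ^ DIM('a) *\<^sub>R (LINT x|lborel. exp (- (c * s * (norm (0 + k *\<^sub>R (x::'a)))\<^sup>2)))"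
    using k by (intro integral_lborel_affine) auto
  then show "(LINT x|lborel. exp (- (c * s * (norm (x::'a))\<^sup>2))) =
      s powr (- real DIM('a) / 2) * (LINT x|lborel. exp (- (c * (norm (x::'a))\<^sup>2)))"
    using k unfolding kn[symmetric] add_0 e by simp
  have "(LINT x|lborel. exp (- (c * s * (norm (x::'a))\<^sup>2)) / (norm x)\<^sup>2)
     = \<bar>k\<bar> ^ DIM('a) *\<^sub>R (LINT x|lborel. exp (- (c * s * (norm (0 + k *\<^sub>R (x::'a)))\<^sup>2)) / (norm (0 + k *\<^sub>R x))\<^sup>2)"
    using k by (intro integral_lborel_affine) auto
  also have "\<dots> = k ^ DIM('a) * (LINT x|lborel. s * (exp (- (c * (norm (x::'a))\<^sup>2)) / (norm x)\<^sup>2))"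
    unfolding add_0 e using k s by (simp add: power_mult_distrib mult_ac)
  also have "\<dots> = (k ^ DIM('a) * s) * (LINT x|lborel. exp (- (c * (norm (x::'a))\<^sup>2)) / (norm x)\<^sup>2)"
    by (simp only: integral_mult_right_zero mult.assoc)
  also have "k ^ DIM('a) * s = s powr (1 - real DIM('a) / 2)"
    using s unfolding kn by (simp add: powr_diff powr_minus_divide)
  finally show "(LINT x|lborel. exp (- (c * s * (norm (x::'a))\<^sup>2)) / (norm x)\<^sup>2) =
      s powr (1 - real DIM('a) / 2) * (LINT x|lborel. exp (- (c * (norm (x::'a))\<^sup>2)) / (norm x)\<^sup>2)" .
qed

text \<open>The powers of \<tau> come from scaling. The weight |xi|^2 is first removed at the price
  of 1 / (a \<tau>) and half the Gaussian rate, so only a plain Gaussian and the inverse-square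
  moment have to be scaled. The constant K is uniform in \<tau>.\<close>

lemma low_frequency_integral:
  assumes n: "CARD('n::finite) \<ge> 3" and a: "a > 0"
  obtains K where "K > 0" "\<And>\<tau> A0 A1 A2. \<tau> > 0 \<Longrightarrow> 0 \<le> A0 \<Longrightarrow> 0 \<le> A1 \<Longrightarrow> 0 \<le> A2 \<Longrightarrow>
     integrable lborel (\<lambda>\<xi>::real^'n. exp (- (2 * a * \<tau> * (norm \<xi>)\<^sup>2)) * ((norm \<xi>)\<^sup>2 * A0 + A1 + A2 / (norm \<xi>)\<^sup>2)) \<and>
     (LINT \<xi>|lborel. exp (- (2 * a * \<tau> * (norm (\<xi>::real^'n))\<^sup>2)) * ((norm \<xi>)\<^sup>2 * A0 + A1 + A2 / (norm \<xi>)\<^sup>2))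
      \<le> K * (\<tau> powr (- 1 - real CARD('n) / 2) * A0 + \<tau> powr (- real CARD('n) / 2) * A1 + \<tau> powr (1 - real CARD('n) / 2) * A2)"
proof -
  let ?n = "real CARD('n)"
  let ?G = "\<lambda>c. LINT \<xi>|lborel. exp (- (c * (norm (\<xi>::real^'n))\<^sup>2))"
  let ?H = "LINT \<xi>|lborel. exp (- (2 * a * (norm (\<xi>::real^'n))\<^sup>2)) / (norm \<xi>)\<^sup>2"
  define K where "K = ?G a / a + ?G (2 * a) + ?H + 1"
  have nn: "0 \<le> ?G c" "0 \<le> ?H" for c by (auto intro!: integral_nonneg_AE)
  have K: "K > 0" using nn a by (auto simp: K_def intro!: add_nonneg_pos)
  have main: "integrable lborel (\<lambda>\<xi>::real^'n. exp (- (2 * a * \<tau> * (norm \<xi>)\<^sup>2)) * ((norm \<xi>)\<^sup>2 * A0 + A1 + A2 / (norm \<xi>)\<^sup>2)) \<and>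
     (LINT \<xi>|lborel. exp (- (2 * a * \<tau> * (norm (\<xi>::real^'n))\<^sup>2)) * ((norm \<xi>)\<^sup>2 * A0 + A1 + A2 / (norm \<xi>)\<^sup>2))
      \<le> K * (\<tau> powr (- 1 - ?n / 2) * A0 + \<tau> powr (- ?n / 2) * A1 + \<tau> powr (1 - ?n / 2) * A2)"
    if \<tau>: "\<tau> > 0" and A: "0 \<le> A0" "0 \<le> A1" "0 \<le> A2" for \<tau> A0 A1 A2
  proof -
    define f where "f \<xi> = exp (- (2 * a * \<tau> * (norm \<xi>)\<^sup>2)) * ((norm \<xi>)\<^sup>2 * A0 + A1 + A2 / (norm \<xi>)\<^sup>2)" for \<xi> :: "real^'n"
    define g where "g \<xi> = A0 / (a * \<tau>) * exp (- (a * \<tau> * (norm \<xi>)\<^sup>2)) + A1 * exp (- (2 * a * \<tau> * (norm \<xi>)\<^sup>2))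
        + A2 * (exp (- (2 * a * \<tau> * (norm \<xi>)\<^sup>2)) / (norm \<xi>)\<^sup>2)" for \<xi> :: "real^'n"
    have ga: "integrable lborel (\<lambda>\<xi>::real^'n. exp (- (a * \<tau> * (norm \<xi>)\<^sup>2)))"
      "integrable lborel (\<lambda>\<xi>::real^'n. exp (- (2 * a * \<tau> * (norm \<xi>)\<^sup>2)))"
      "integrable lborel (\<lambda>\<xi>::real^'n. exp (- (2 * a * \<tau> * (norm \<xi>)\<^sup>2)) / (norm \<xi>)\<^sup>2)"
      using a \<tau> n by (auto intro!: integrable_gaussian integrable_inverse_sq_gaussian)
    have g: "integrable lborel g"
      unfolding g_def[abs_def] by (intro Bochner_Integration.integrable_add integrable_mult_right ga)
    have fg: "f \<xi> \<le> g \<xi>" for \<xi>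
    proof -
      have "(norm \<xi>)\<^sup>2 * exp (- (2 * (a * \<tau>)) * (norm \<xi>)\<^sup>2) \<le> 1 / (a * \<tau>) * exp (- (a * \<tau>) * (norm \<xi>)\<^sup>2)"
        using a \<tau> by (intro times_exp_le) simp
      then have "A0 * ((norm \<xi>)\<^sup>2 * exp (- (2 * (a * \<tau>)) * (norm \<xi>)\<^sup>2)) \<le> A0 * (1 / (a * \<tau>) * exp (- (a * \<tau>) * (norm \<xi>)\<^sup>2))"
        using A by (intro mult_left_mono)
      then show ?thesis
        by (simp add: f_def g_def algebra_simps)
    qed
    have f0: "0 \<le> f \<xi>" for \<xi>
      using A by (simp add: f_def)
    have f: "integrable lborel f"
      by (rule Bochner_Integration.integrable_bound[OF g])
         (use fg f0 in \<open>auto simp: f_def[abs_def] intro!: AE_I2 order_trans[OF _ abs_ge_self]\<close>)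
    have "integral\<^sup>L lborel f \<le> integral\<^sup>L lborel g"
      by (intro integral_mono f g fg)
    also have "\<dots> = A0 / (a * \<tau>) * (LINT \<xi>|lborel. exp (- (a * \<tau> * (norm (\<xi>::real^'n))\<^sup>2)))
        + A1 * (LINT \<xi>|lborel. exp (- (2 * a * \<tau> * (norm (\<xi>::real^'n))\<^sup>2)))
        + A2 * (LINT \<xi>|lborel. exp (- (2 * a * \<tau> * (norm (\<xi>::real^'n))\<^sup>2)) / (norm \<xi>)\<^sup>2)"
      unfolding g_def[abs_def]
      by (simp only: Bochner_Integration.integral_add integrable_mult_right integral_mult_right_zero
          Bochner_Integration.integrable_add ga)
    also have "\<dots> = (\<tau> powr (- 1 - ?n / 2) * A0) * (?G a / a) + (\<tau> powr (- ?n / 2) * A1) * ?G (2 * a) + (\<tau> powr (1 - ?n / 2) * A2) * ?H"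
    proof -
      have "\<tau> powr (- ?n / 2) / \<tau> = \<tau> powr (- 1 - ?n / 2)"
        using \<tau> by (simp add: powr_diff powr_minus_divide)
      then show ?thesis
        unfolding gaussian_integral_scale[OF \<tau>] using a \<tau> by (simp add: field_simps)
    qed
    also have "\<dots> \<le> (\<tau> powr (- 1 - ?n / 2) * A0) * K + (\<tau> powr (- ?n / 2) * A1) * K + (\<tau> powr (1 - ?n / 2) * A2) * K"
      using nn a A by (intro add_mono mult_left_mono) (auto simp: K_def intro!: add_nonneg_nonneg)
    also have "\<dots> = K * (\<tau> powr (- 1 - ?n / 2) * A0 + \<tau> powr (- ?n / 2) * A1 + \<tau> powr (1 - ?n / 2) * A2)"
      by (simp add: algebra_simps)
    finally show ?thesis
      using f by (simp add: f_def[abs_def])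
  qed
  show thesis
    by (rule that[OF K main])
qed

section \<open>Estimates in frequency space and the conclusion\<close>

text \<open>Raise x <= exp x to the power p at x = (c / p) (1 + t); this also produces the explicit
  constant.\<close>

lemma exp_decay_le_powr:
  fixes c p :: real
  assumes c: "c > 0" and p: "p > 0"
  obtains K where "K > 0" "\<And>t. t \<ge> 0 \<Longrightarrow> exp (- c * t) \<le> K * (1 + t) powr (- p)"
proof -
  define d where "d = c / p"
  have d: "d > 0" "d * p = c" using c p by (auto simp: d_def)
  have "exp (- c * t) \<le> (d powr (- p) * exp c) * (1 + t) powr (- p)" if t: "t \<ge> 0" for t
  proof -
    have "d * (1 + t) \<le> exp (d * (1 + t))"
      using exp_ge_add_one_self[of "d * (1 + t)"] by linarith
    then have "(d * (1 + t)) powr p \<le> exp (d * (1 + t)) powr p"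
      using d t p by (intro powr_mono2) auto
    also have "\<dots> = exp (d * p * (1 + t))"
      by (simp add: powr_def mult_ac)
    also have "\<dots> = exp c * exp (c * t)"
      by (simp add: d exp_add distrib_left)
    finally have "d powr p * (1 + t) powr p \<le> exp c * exp (c * t)"
      using d t by (simp add: powr_mult)
    then show ?thesis
      using d t by (simp add: exp_minus powr_minus field_simps)
  qed
  then show thesis
    using d by (intro that[of "d powr (- p) * exp c"]) auto
qed

lemma in_L11_integrable:
  assumes "in_L11 f"
  shows "integrable lborel f" and "(LINT x|lborel. cmod (f x)) \<le> L11_norm f"
proof -
  have f: "f \<in> borel_measurable lborel" "integrable lborel (\<lambda>x. (1 + norm x) * cmod (f x))"
    using assms by (auto simp: in_L11_def)
  have le: "cmod (f x) \<le> (1 + norm x) * cmod (f x)" for x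
    by (simp add: distrib_right)
  show int: "integrable lborel f"
    by (rule Bochner_Integration.integrable_bound[OF f(2,1)])
       (use le in \<open>auto simp: abs_mult\<close>)
  show "(LINT x|lborel. cmod (f x)) \<le> L11_norm f"
    unfolding L11_norm_def by (intro integral_mono le f integrable_norm int)
qed

lemma L2_L11_bounds:
  fixes f :: "real^'n \<Rightarrow> complex"
  assumes "in_L2 f" "in_L11 f"
  shows "0 \<le> L2_L11_norm f"
    and "cmod (fourier f \<xi>) \<le> L2_L11_norm f"
    and "integrable lborel (\<lambda>\<xi>. (cmod (fourier f \<xi>))\<^sup>2)"
    and "(LINT \<xi>|lborel. (cmod (fourier f \<xi>))\<^sup>2) \<le> (2 * pi) ^ CARD('n) * (L2_L11_norm f)\<^sup>2"
proof -
  have f: "integrable lborel f" by (rule in_L11_integrable(1)[OF assms(2)])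
  have nn: "0 \<le> L2_norm f" "0 \<le> L11_norm f"
    by (auto simp: L2_norm_def L11_norm_def intro!: integral_nonneg_AE)
  then show "0 \<le> L2_L11_norm f" by (simp add: L2_L11_norm_def)
  show "cmod (fourier f \<xi>) \<le> L2_L11_norm f"
    using fourier_bound[OF f, of \<xi>] in_L11_integrable(2)[OF assms(2)] nn by (simp add: L2_L11_norm_def)
  show "integrable lborel (\<lambda>\<xi>. (cmod (fourier f \<xi>))\<^sup>2)"
    using in_L2_fourier(1)[OF f assms(1)] by (simp add: in_L2_def)
  have "(LINT \<xi>|lborel. (cmod (fourier f \<xi>))\<^sup>2) = (2 * pi) ^ CARD('n) * (L2_norm f)\<^sup>2"
    using in_L2_fourier(2)[OF f assms(1)] by (simp add: L2_norm_sq)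
  also have "\<dots> \<le> (2 * pi) ^ CARD('n) * (L2_L11_norm f)\<^sup>2"
    using nn by (intro mult_left_mono power_mono) (auto simp: L2_L11_norm_def)
  finally show "(LINT \<xi>|lborel. (cmod (fourier f \<xi>))\<^sup>2) \<le> (2 * pi) ^ CARD('n) * (L2_L11_norm f)\<^sup>2" .
qed

lemma power2_sum3_le: "(x + y + z)\<^sup>2 \<le> 3 * (x\<^sup>2 + y\<^sup>2 + z\<^sup>2)" for x y z :: real
  using zero_le_power2[of "x - y"] zero_le_power2[of "y - z"] zero_le_power2[of "x - z"]
  by (simp add: power2_eq_square algebra_simps)

context blackstock_parameters
begin

definition profile_error ::
    "real \<Rightarrow> real \<Rightarrow> complex \<Rightarrow> complex \<Rightarrow> complex \<Rightarrow> complex \<Rightarrow> complex" where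
  "profile_error t r u0 u1 u2 y =
    y - of_real (J0_hat \<kappa> t r) * u0 - of_real (J1_hat \<delta> t r) * u1 - of_real (J2_hat \<delta> \<kappa> t r) * u2"

lemma high_frequency_estimate:
  assumes \<epsilon>: "\<epsilon> > 0"
  obtains c C where "0 < c" "0 < C"
    "\<And>r u0 u1 u2 u t. r \<ge> \<epsilon> \<Longrightarrow> blackstock_ode b \<nu> \<gamma> \<kappa> (r\<^sup>2) u0 u1 u2 u \<Longrightarrow> 0 \<le> t \<Longrightarrow>
       cmod (profile_error t r u0 u1 u2 (u t)) \<le> C * exp (- c * t) * (cmod u0 + cmod u1 + cmod u2)"
proof -
  obtain c' C' where c': "c' > 0" and C': "C' > 0" and decay: "\<And>s u0 u1 u2 u t. s \<ge> \<epsilon>\<^sup>2 \<Longrightarrow> blackstock_ode b \<nu> \<gamma> \<kappa> s u0 u1 u2 u \<Longrightarrow>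
      t \<ge> 0 \<Longrightarrow> cmod (u t) \<le> C' * exp (- c' * t) * (cmod u0 + cmod u1 + cmod u2)"
    using high_frequency_decay[of "\<epsilon>\<^sup>2"] \<epsilon> by (metis zero_less_power)
  define c where "c = min c' (min (\<kappa> * \<epsilon>\<^sup>2) (\<delta> / 2 * \<epsilon>\<^sup>2))"
  have c: "c > 0" "c \<le> c'" "c \<le> \<kappa> * \<epsilon>\<^sup>2" "c \<le> \<delta> / 2 * \<epsilon>\<^sup>2"
    using c' \<kappa> \<delta> \<epsilon> by (auto simp: c_def)
  define C where "C = C' + 1 + 1 / \<epsilon> + 2 / \<epsilon>\<^sup>2"
  have C: "C > 0" using C' \<epsilon> by (auto simp: C_def intro!: add_pos_nonneg)
  have main: "cmod (profile_error t r u0 u1 u2 (u t)) \<le> C * exp (- c * t) * (cmod u0 + cmod u1 + cmod u2)"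
    if r: "r \<ge> \<epsilon>" and ode: "blackstock_ode b \<nu> \<gamma> \<kappa> (r\<^sup>2) u0 u1 u2 u" and t: "0 \<le> t" for r u0 u1 u2 u t
  proof -
    have r2: "\<epsilon>\<^sup>2 \<le> r\<^sup>2" using r \<epsilon> by (intro power_mono) auto
    let ?E = "exp (- c * t)"
    have ex: "exp (- (k * r\<^sup>2 * t)) \<le> ?E" if "c \<le> k * \<epsilon>\<^sup>2" "k \<ge> 0" for k
    proof -
      have "c \<le> k * r\<^sup>2" using that mult_left_mono[OF r2, of k] by linarith
      then show ?thesis using t by (simp add: mult_right_mono)
    qed
    have e\<kappa>: "exp (- \<kappa> * r\<^sup>2 * t) \<le> ?E" and e\<delta>: "exp (- (\<delta> / 2) * r\<^sup>2 * t) \<le> ?E"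
      using ex[of \<kappa>] ex[of "\<delta> / 2"] c \<kappa> \<delta> by simp_all
    have J0: "\<bar>J0_hat \<kappa> t r\<bar> \<le> 1 * ?E"
      using e\<kappa> by (simp add: J0_hat_def)
    have J1: "\<bar>J1_hat \<delta> t r\<bar> \<le> 1 / \<epsilon> * ?E"
    proof -
      have "\<bar>J1_hat \<delta> t r\<bar> = \<bar>sin (r * t)\<bar> / r * exp (- (\<delta> / 2) * r\<^sup>2 * t)"
        using r \<epsilon> by (simp add: J1_hat_def abs_mult)
      also have "\<dots> \<le> 1 / \<epsilon> * ?E"
        using r \<epsilon> e\<delta> by (intro mult_mono frac_le) auto
      finally show ?thesis .
    qed
    have J2: "\<bar>J2_hat \<delta> \<kappa> t r\<bar> \<le> 2 / \<epsilon>\<^sup>2 * ?E"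
    proof -
      have "\<bar>J2_hat \<delta> \<kappa> t r\<bar> \<le> \<bar>cos (r * t)\<bar> / r\<^sup>2 * exp (- (\<delta> / 2) * r\<^sup>2 * t) + 1 / r\<^sup>2 * exp (- \<kappa> * r\<^sup>2 * t)"
        unfolding J2_hat_def by (intro order_trans[OF abs_triangle_ineq] add_mono) (simp_all add: abs_mult)
      also have "\<dots> \<le> 1 / \<epsilon>\<^sup>2 * ?E + 1 / \<epsilon>\<^sup>2 * ?E"
        using r2 \<epsilon> e\<delta> e\<kappa> by (intro add_mono mult_mono frac_le) auto
      finally show ?thesis by simp
    qed
    have E': "exp (- c' * t) \<le> ?E" using c t by (simp add: mult_right_mono)
    let ?N = "cmod u0 + cmod u1 + cmod u2"
    have "cmod (profile_error t r u0 u1 u2 (u t))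
      \<le> cmod (u t) + \<bar>J0_hat \<kappa> t r\<bar> * cmod u0 + \<bar>J1_hat \<delta> t r\<bar> * cmod u1 + \<bar>J2_hat \<delta> \<kappa> t r\<bar> * cmod u2"
      unfolding profile_error_def by (intro order_trans[OF norm_triangle_ineq4] add_mono) (simp_all add: norm_mult)
    also have "\<dots> \<le> C' * ?E * ?N + (1 * ?E) * ?N + (1 / \<epsilon> * ?E) * ?N + (2 / \<epsilon>\<^sup>2 * ?E) * ?N"
    proof (intro add_mono)
      show "cmod (u t) \<le> C' * ?E * ?N"
        using C' E' by (intro order_trans[OF decay[OF r2 ode t]] mult_right_mono mult_left_mono) auto
      show "\<bar>J0_hat \<kappa> t r\<bar> * cmod u0 \<le> (1 * ?E) * ?N" by (intro mult_mono J0) auto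
      show "\<bar>J1_hat \<delta> t r\<bar> * cmod u1 \<le> (1 / \<epsilon> * ?E) * ?N" using \<epsilon> by (intro mult_mono J1) auto
      show "\<bar>J2_hat \<delta> \<kappa> t r\<bar> * cmod u2 \<le> (2 / \<epsilon>\<^sup>2 * ?E) * ?N" using \<epsilon> by (intro mult_mono J2) auto
    qed
    also have "\<dots> = C * ?E * ?N"
      by (simp add: C_def algebra_simps)
    finally show ?thesis .
  qed
  show thesis
    by (rule that[OF c(1) C]) (rule main)
qed

text \<open>At low frequencies the transforms of the data are bounded in the supremum norm and the
  Gaussian weight is integrated; at high frequencies Plancherel is applied to the data. Working with
  squares keeps the three contributions additive.\<close>

lemma profile_error_L2:
  assumes n: "CARD('n::finite) \<ge> 3"
  obtains C where "C > 0"
    "\<And>(f0 :: real^'n \<Rightarrow> complex) f1 f2 v t.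
      in_L2 f0 \<Longrightarrow> in_L11 f0 \<Longrightarrow> in_L2 f1 \<Longrightarrow> in_L11 f1 \<Longrightarrow> in_L2 f2 \<Longrightarrow> in_L11 f2 \<Longrightarrow>
      (\<And>\<xi>. blackstock_ode b \<nu> \<gamma> \<kappa> ((norm \<xi>)\<^sup>2) (fourier f0 \<xi>) (fourier f1 \<xi>) (fourier f2 \<xi>) (\<lambda>t. v t \<xi>)) \<Longrightarrow>
      t \<ge> 0 \<Longrightarrow> in_L2 (\<lambda>\<xi>. profile_error t (norm \<xi>) (fourier f0 \<xi>) (fourier f1 \<xi>) (fourier f2 \<xi>) (v t \<xi>)) \<Longrightarrow>
      (L2_norm (\<lambda>\<xi>. profile_error t (norm \<xi>) (fourier f0 \<xi>) (fourier f1 \<xi>) (fourier f2 \<xi>) (v t \<xi>)))\<^sup>2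
        \<le> C * ((1 + t) powr (- 1 - real CARD('n) / 2) * (L2_L11_norm f0)\<^sup>2
             + (1 + t) powr (- real CARD('n) / 2) * (L2_L11_norm f1)\<^sup>2
             + (1 + t) powr (1 - real CARD('n) / 2) * (L2_L11_norm f2)\<^sup>2)"
proof -
  let ?n = "real CARD('n)"
  obtain \<epsilon> a Cl where \<epsilon>: "0 < \<epsilon>" "\<epsilon> \<le> 1" and a: "0 < a" and Cl: "0 < Cl"
    and low: "\<And>r u0 u1 u2 u t. 0 < r \<Longrightarrow> r \<le> \<epsilon> \<Longrightarrow> blackstock_ode b \<nu> \<gamma> \<kappa> (r\<^sup>2) u0 u1 u2 u \<Longrightarrow> 0 \<le> t \<Longrightarrow>
       cmod (profile_error t r u0 u1 u2 (u t)) \<le> Cl * exp (- a * r\<^sup>2 * t) * (r * cmod u0 + cmod u1 + cmod u2 / r)"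
    unfolding profile_error_def by (rule low_frequency_estimate) blast
  obtain c Ch where c: "0 < c" and Ch: "0 < Ch"
    and high: "\<And>r u0 u1 u2 u t. r \<ge> \<epsilon> \<Longrightarrow> blackstock_ode b \<nu> \<gamma> \<kappa> (r\<^sup>2) u0 u1 u2 u \<Longrightarrow> 0 \<le> t \<Longrightarrow>
       cmod (profile_error t r u0 u1 u2 (u t)) \<le> Ch * exp (- c * t) * (cmod u0 + cmod u1 + cmod u2)"
    using high_frequency_estimate[OF \<epsilon>(1)] by blast
  obtain Ki where Ki: "Ki > 0" and int: "\<And>\<tau> A0 A1 A2. \<tau> > 0 \<Longrightarrow> 0 \<le> A0 \<Longrightarrow> 0 \<le> A1 \<Longrightarrow> 0 \<le> A2 \<Longrightarrow>
     integrable lborel (\<lambda>\<xi>::real^'n. exp (- (2 * a * \<tau> * (norm \<xi>)\<^sup>2)) * ((norm \<xi>)\<^sup>2 * A0 + A1 + A2 / (norm \<xi>)\<^sup>2)) \<and>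
     (LINT \<xi>|lborel. exp (- (2 * a * \<tau> * (norm (\<xi>::real^'n))\<^sup>2)) * ((norm \<xi>)\<^sup>2 * A0 + A1 + A2 / (norm \<xi>)\<^sup>2))
      \<le> Ki * (\<tau> powr (- 1 - ?n / 2) * A0 + \<tau> powr (- ?n / 2) * A1 + \<tau> powr (1 - ?n / 2) * A2)"
    by (fact low_frequency_integral[OF n a])
  \<comment> \<open>The exponent is the fastest of the three target rates, so the high-frequency
    part fits under all of them.\<close>
  obtain Ke where Ke: "Ke > 0" and decay: "\<And>t. t \<ge> 0 \<Longrightarrow> exp (- (2 * c) * t) \<le> Ke * (1 + t) powr (- (1 + ?n / 2))"
    using exp_decay_le_powr[OF mult_pos_pos[OF zero_less_numeral c] add_pos_nonneg[OF zero_less_one], of "?n / 2"]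
    by (metis divide_nonneg_nonneg of_nat_0_le_iff zero_le_numeral)
  \<comment> \<open>The 3 comes from squaring a sum of three terms, and \<open>exp (2 * a)\<close>
    from replacing t by 1 + t in the Gaussian, which is possible because |xi| <= 1 on this
    region.\<close>
  define Kl where "Kl = 3 * Cl\<^sup>2 * exp (2 * a)"
  define Kh where "Kh = 3 * Ch\<^sup>2"
  define Kp where "Kp = (2 * pi) ^ CARD('n)"
  define C where "C = Kl * Ki + Kh * Ke * Kp"
  have pos: "Kl > 0" "Kh > 0" "Kp > 0" using Cl Ch by (auto simp: Kl_def Kh_def Kp_def)
  have C: "C > 0" using pos Ki Ke by (auto simp: C_def intro!: add_pos_pos)
  have main: "(L2_norm (\<lambda>\<xi>. profile_error t (norm \<xi>) (fourier f0 \<xi>) (fourier f1 \<xi>) (fourier f2 \<xi>) (v t \<xi>)))\<^sup>2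
        \<le> C * ((1 + t) powr (- 1 - ?n / 2) * (L2_L11_norm f0)\<^sup>2
             + (1 + t) powr (- ?n / 2) * (L2_L11_norm f1)\<^sup>2
             + (1 + t) powr (1 - ?n / 2) * (L2_L11_norm f2)\<^sup>2)"
    if f0: "in_L2 f0" "in_L11 f0" and f1: "in_L2 f1" "in_L11 f1" and f2: "in_L2 f2" "in_L11 f2"
      and ode: "\<And>\<xi>. blackstock_ode b \<nu> \<gamma> \<kappa> ((norm \<xi>)\<^sup>2) (fourier f0 \<xi>) (fourier f1 \<xi>) (fourier f2 \<xi>) (\<lambda>t. v t \<xi>)"
      and t: "t \<ge> 0" and L2: "in_L2 (\<lambda>\<xi>. profile_error t (norm \<xi>) (fourier f0 \<xi>) (fourier f1 \<xi>) (fourier f2 \<xi>) (v t \<xi>))"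
    for f0 f1 f2 :: "real^'n \<Rightarrow> complex" and v t
  proof -
    define D where "D \<xi> = profile_error t (norm \<xi>) (fourier f0 \<xi>) (fourier f1 \<xi>) (fourier f2 \<xi>) (v t \<xi>)" for \<xi>
    define N0 where "N0 = (L2_L11_norm f0)\<^sup>2"
    define N1 where "N1 = (L2_L11_norm f1)\<^sup>2"
    define N2 where "N2 = (L2_L11_norm f2)\<^sup>2"
    note N_defs = N0_def N1_def N2_def
    have N: "0 \<le> N0" "0 \<le> N1" "0 \<le> N2" by (simp_all add: N_defs)
    have F: "(cmod (fourier f0 \<xi>))\<^sup>2 \<le> N0" "(cmod (fourier f1 \<xi>))\<^sup>2 \<le> N1" "(cmod (fourier f2 \<xi>))\<^sup>2 \<le> N2" for \<xi>
      unfolding N_defs by (intro power_mono L2_L11_bounds f0 f1 f2 norm_ge_zero)+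
    \<comment> \<open>With 1 + t in place of t the majorant is integrable over all of space down to
      t = 0, so no cut-off at \<epsilon> is needed.\<close>
    define L where "L \<xi> = exp (- (2 * a * (1 + t) * (norm \<xi>)\<^sup>2)) * ((norm \<xi>)\<^sup>2 * N0 + N1 + N2 / (norm \<xi>)\<^sup>2)" for \<xi> :: "real^'n"
    define H where "H \<xi> = exp (- (2 * c) * t) * ((cmod (fourier f0 \<xi>))\<^sup>2 + (cmod (fourier f1 \<xi>))\<^sup>2 + (cmod (fourier f2 \<xi>))\<^sup>2)" for \<xi>
    have nn: "0 \<le> L \<xi>" "0 \<le> H \<xi>" for \<xi>
      using N by (auto simp: L_def H_def)
    have bound: "(cmod (D \<xi>))\<^sup>2 \<le> Kl * L \<xi> + Kh * H \<xi>" if \<xi>: "\<xi> \<noteq> 0" for \<xi>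
    proof (cases "norm \<xi> \<le> \<epsilon>")
      case True
      define r where "r = norm \<xi>"
      have r: "0 < r" "r \<le> \<epsilon>" using \<xi> True by (auto simp: r_def)
      have r1: "r\<^sup>2 \<le> 1" using r \<epsilon> by (simp add: power_le_one)
      have "(cmod (D \<xi>))\<^sup>2 \<le> (Cl * exp (- a * r\<^sup>2 * t) * (r * cmod (fourier f0 \<xi>) + cmod (fourier f1 \<xi>) + cmod (fourier f2 \<xi>) / r))\<^sup>2"
        unfolding D_def using low[OF r ode[of \<xi>, folded r_def] t] by (intro power_mono) (auto simp: r_def)
      also have "\<dots> = Cl\<^sup>2 * (exp (- a * r\<^sup>2 * t))\<^sup>2 * (r * cmod (fourier f0 \<xi>) + cmod (fourier f1 \<xi>) + cmod (fourier f2 \<xi>) / r)\<^sup>2"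
        by (simp only: power_mult_distrib)
      also have "\<dots> \<le> Cl\<^sup>2 * (exp (2 * a) * exp (- (2 * a * (1 + t) * r\<^sup>2))) * (3 * (r\<^sup>2 * N0 + N1 + N2 / r\<^sup>2))"
      proof (intro mult_mono order_refl)
        have "(exp (- a * r\<^sup>2 * t))\<^sup>2 = exp (- (2 * a * r\<^sup>2 * t))"
          by (simp add: power2_eq_square[of "exp _"] mult_exp_exp)
        also have "\<dots> \<le> exp (2 * a) * exp (- (2 * a * (1 + t) * r\<^sup>2))"
          using mult_left_mono[OF r1, of "2 * a"] a by (simp add: mult_exp_exp algebra_simps)
        finally show "(exp (- a * r\<^sup>2 * t))\<^sup>2 \<le> exp (2 * a) * exp (- (2 * a * (1 + t) * r\<^sup>2))" .
        have "(r * cmod (fourier f0 \<xi>) + cmod (fourier f1 \<xi>) + cmod (fourier f2 \<xi>) / r)\<^sup>2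
            \<le> 3 * ((r * cmod (fourier f0 \<xi>))\<^sup>2 + (cmod (fourier f1 \<xi>))\<^sup>2 + (cmod (fourier f2 \<xi>) / r)\<^sup>2)"
          by (rule power2_sum3_le)
        also have "\<dots> \<le> 3 * (r\<^sup>2 * N0 + N1 + N2 / r\<^sup>2)"
          unfolding power_mult_distrib power_divide using F
          by (intro mult_left_mono add_mono divide_right_mono) auto
        finally show "(r * cmod (fourier f0 \<xi>) + cmod (fourier f1 \<xi>) + cmod (fourier f2 \<xi>) / r)\<^sup>2 \<le> 3 * (r\<^sup>2 * N0 + N1 + N2 / r\<^sup>2)" .
      qed auto
      also have "\<dots> = Kl * L \<xi>"
        by (simp add: Kl_def L_def r_def)
      finally show ?thesis
        using nn pos by (simp add: add_increasing2)
    next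
      case False
      have "(cmod (D \<xi>))\<^sup>2 \<le> (Ch * exp (- c * t) * (cmod (fourier f0 \<xi>) + cmod (fourier f1 \<xi>) + cmod (fourier f2 \<xi>)))\<^sup>2"
        unfolding D_def using high[OF _ ode t] False by (intro power_mono) auto
      also have "\<dots> = Ch\<^sup>2 * exp (- (2 * c) * t) * (cmod (fourier f0 \<xi>) + cmod (fourier f1 \<xi>) + cmod (fourier f2 \<xi>))\<^sup>2"
        by (simp add: power_mult_distrib power2_eq_square[of "exp _"] mult_exp_exp)
      also have "\<dots> \<le> Ch\<^sup>2 * exp (- (2 * c) * t) * (3 * ((cmod (fourier f0 \<xi>))\<^sup>2 + (cmod (fourier f1 \<xi>))\<^sup>2 + (cmod (fourier f2 \<xi>))\<^sup>2))"
        by (intro mult_left_mono power2_sum3_le) auto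
      also have "\<dots> = Kh * H \<xi>"
        by (simp add: Kh_def H_def)
      finally show ?thesis
        using nn pos by (simp add: add_increasing)
    qed
    have iL: "integrable lborel L" "integral\<^sup>L lborel L \<le> Ki * ((1 + t) powr (- 1 - ?n / 2) * N0 + (1 + t) powr (- ?n / 2) * N1 + (1 + t) powr (1 - ?n / 2) * N2)"
      unfolding L_def[abs_def] using int[of "1 + t" N0 N1 N2] N t by auto
    note iF = L2_L11_bounds(3)[OF f0] L2_L11_bounds(3)[OF f1] L2_L11_bounds(3)[OF f2]
    have iH: "integrable lborel H"
      unfolding H_def[abs_def] by (intro integrable_mult_right Bochner_Integration.integrable_add iF)
    have "integral\<^sup>L lborel H = exp (- (2 * c) * t) * ((LINT \<xi>|lborel. (cmod (fourier f0 \<xi>))\<^sup>2) + (LINT \<xi>|lborel. (cmod (fourier f1 \<xi>))\<^sup>2) + (LINT \<xi>|lborel. (cmod (fourier f2 \<xi>))\<^sup>2))"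
      unfolding H_def[abs_def] by (simp only: integral_mult_right_zero Bochner_Integration.integral_add Bochner_Integration.integrable_add iF)
    also have "\<dots> \<le> (Ke * (1 + t) powr (- (1 + ?n / 2))) * (Kp * N0 + Kp * N1 + Kp * N2)"
      unfolding N_defs Kp_def using t Ke
      by (intro mult_mono decay add_mono L2_L11_bounds f0 f1 f2) (auto intro!: add_nonneg_nonneg integral_nonneg_AE)
    also have "\<dots> = (Ke * Kp) * ((1 + t) powr (- 1 - ?n / 2) * N0 + (1 + t) powr (- 1 - ?n / 2) * N1 + (1 + t) powr (- 1 - ?n / 2) * N2)"
      by (simp add: algebra_simps)
    also have "\<dots> \<le> (Ke * Kp) * ((1 + t) powr (- 1 - ?n / 2) * N0 + (1 + t) powr (- ?n / 2) * N1 + (1 + t) powr (1 - ?n / 2) * N2)"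
      using t N Ke pos by (intro mult_left_mono add_mono mult_right_mono powr_mono) auto
    finally have iH_le: "integral\<^sup>L lborel H \<le> (Ke * Kp) * ((1 + t) powr (- 1 - ?n / 2) * N0 + (1 + t) powr (- ?n / 2) * N1 + (1 + t) powr (1 - ?n / 2) * N2)" .
    have "(L2_norm D)\<^sup>2 = (LINT \<xi>|lborel. (cmod (D \<xi>))\<^sup>2)"
      by (rule L2_norm_sq)
    also have "\<dots> \<le> (LINT \<xi>|lborel. Kl * L \<xi> + Kh * H \<xi>)"
    proof (rule integral_mono_AE)
      show "integrable lborel (\<lambda>\<xi>. (cmod (D \<xi>))\<^sup>2)"
        using L2 by (simp add: in_L2_def D_def)
      show "integrable lborel (\<lambda>\<xi>. Kl * L \<xi> + Kh * H \<xi>)"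
        using iL iH by simp
      show "AE \<xi> in lborel. (cmod (D \<xi>))\<^sup>2 \<le> Kl * L \<xi> + Kh * H \<xi>"
        using AE_lborel_singleton[of "0 :: real^'n"] by eventually_elim (rule bound)
    qed
    also have "\<dots> = Kl * integral\<^sup>L lborel L + Kh * integral\<^sup>L lborel H"
      using iL iH by simp
    also have "\<dots> \<le> Kl * (Ki * ((1 + t) powr (- 1 - ?n / 2) * N0 + (1 + t) powr (- ?n / 2) * N1 + (1 + t) powr (1 - ?n / 2) * N2))
        + Kh * ((Ke * Kp) * ((1 + t) powr (- 1 - ?n / 2) * N0 + (1 + t) powr (- ?n / 2) * N1 + (1 + t) powr (1 - ?n / 2) * N2))"
      using pos by (intro add_mono mult_left_mono iL iH_le) auto
    also have "\<dots> = C * ((1 + t) powr (- 1 - ?n / 2) * N0 + (1 + t) powr (- ?n / 2) * N1 + (1 + t) powr (1 - ?n / 2) * N2)"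
      by (simp only: C_def distrib_right mult.assoc)
    finally show ?thesis
      unfolding D_def[abs_def] N_defs .
  qed
  show thesis
    by (rule that[OF C]) (rule main)
qed

end

theorem theorem2p2:
  fixes b \<nu> \<gamma> :: real
  assumes "CARD('n::finite) \<ge> 3"
    and "b > 0" and "\<nu> > 0" and "1 < \<gamma>" and "\<gamma> \<le> 5 / 3"
  shows "\<exists>\<kappa>0>0. \<forall>\<kappa>. 0 < \<kappa> \<and> \<kappa> < \<kappa>0 \<longrightarrow>
    (\<exists>C>0. \<forall>(\<psi>0 :: real^'n \<Rightarrow> complex) \<psi>1 \<psi>2 \<psi>.
       in_L2 \<psi>0 \<and> in_L11 \<psi>0 \<and> in_L2 \<psi>1 \<and> in_L11 \<psi>1 \<and> in_L2 \<psi>2 \<and> in_L11 \<psi>2 \<and>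
       \<not> (AE x in lborel. \<psi>2 x = 0) \<and>
       blackstock_solution b \<nu> \<gamma> \<kappa> \<psi>0 \<psi>1 \<psi>2 \<psi> \<longrightarrow>
       (\<forall>t\<ge>0. \<forall>J0\<psi>0 J1\<psi>1 J2\<psi>2.
          multiplier_image (J0_hat \<kappa> t) \<psi>0 J0\<psi>0 \<and>
          multiplier_image (J1_hat (delta b \<nu> \<gamma> \<kappa>) t) \<psi>1 J1\<psi>1 \<and>
          multiplier_image (J2_hat (delta b \<nu> \<gamma> \<kappa>) \<kappa> t) \<psi>2 J2\<psi>2 \<longrightarrow>
          L2_norm (\<lambda>x. \<psi> t x - J0\<psi>0 x - J1\<psi>1 x - J2\<psi>2 x)
            \<le> C * ((1 + t) powr (- 1 / 2 - real CARD('n) / 4) * L2_L11_norm \<psi>0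
                 + (1 + t) powr (- real CARD('n) / 4) * L2_L11_norm \<psi>1
                 + (1 + t) powr (1 / 2 - real CARD('n) / 4) * L2_L11_norm \<psi>2)))"
proof -
  let ?n = "real CARD('n)"
  \<comment> \<open>The condition \<kappa> < \<kappa>0 is exactly the locale assumption
    \<open>small\<close>, that is, the discriminant condition from the cubic.\<close>
  define \<kappa>0 where "\<kappa>0 = 4 * (\<gamma> - 1) * (b * \<nu>) / \<gamma>\<^sup>2"
  have \<kappa>0: "\<kappa>0 > 0" using assms by (simp add: \<kappa>0_def)
  have "\<exists>C>0. \<forall>(\<psi>0 :: real^'n \<Rightarrow> complex) \<psi>1 \<psi>2 \<psi>.
       in_L2 \<psi>0 \<and> in_L11 \<psi>0 \<and> in_L2 \<psi>1 \<and> in_L11 \<psi>1 \<and> in_L2 \<psi>2 \<and> in_L11 \<psi>2 \<and>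
       \<not> (AE x in lborel. \<psi>2 x = 0) \<and>
       blackstock_solution b \<nu> \<gamma> \<kappa> \<psi>0 \<psi>1 \<psi>2 \<psi> \<longrightarrow>
       (\<forall>t\<ge>0. \<forall>J0\<psi>0 J1\<psi>1 J2\<psi>2.
          multiplier_image (J0_hat \<kappa> t) \<psi>0 J0\<psi>0 \<and>
          multiplier_image (J1_hat (delta b \<nu> \<gamma> \<kappa>) t) \<psi>1 J1\<psi>1 \<and>
          multiplier_image (J2_hat (delta b \<nu> \<gamma> \<kappa>) \<kappa> t) \<psi>2 J2\<psi>2 \<longrightarrow>
          L2_norm (\<lambda>x. \<psi> t x - J0\<psi>0 x - J1\<psi>1 x - J2\<psi>2 x)
            \<le> C * ((1 + t) powr (- 1 / 2 - ?n / 4) * L2_L11_norm \<psi>0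
                 + (1 + t) powr (- ?n / 4) * L2_L11_norm \<psi>1
                 + (1 + t) powr (1 / 2 - ?n / 4) * L2_L11_norm \<psi>2))"
    if \<kappa>: "0 < \<kappa>" "\<kappa> < \<kappa>0" for \<kappa>
  proof -
    interpret blackstock_parameters b \<nu> \<gamma> \<kappa> "b * \<nu>" "delta b \<nu> \<gamma> \<kappa>"
      using assms \<kappa> by unfold_locales (auto simp: \<kappa>0_def field_simps)
    obtain C where C: "C > 0" and est: "\<And>(f0 :: real^'n \<Rightarrow> complex) f1 f2 v t.
      in_L2 f0 \<Longrightarrow> in_L11 f0 \<Longrightarrow> in_L2 f1 \<Longrightarrow> in_L11 f1 \<Longrightarrow> in_L2 f2 \<Longrightarrow> in_L11 f2 \<Longrightarrow>
      (\<And>\<xi>. blackstock_ode b \<nu> \<gamma> \<kappa> ((norm \<xi>)\<^sup>2) (fourier f0 \<xi>) (fourier f1 \<xi>) (fourier f2 \<xi>) (\<lambda>t. v t \<xi>)) \<Longrightarrow>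
      t \<ge> 0 \<Longrightarrow> in_L2 (\<lambda>\<xi>. profile_error t (norm \<xi>) (fourier f0 \<xi>) (fourier f1 \<xi>) (fourier f2 \<xi>) (v t \<xi>)) \<Longrightarrow>
      (L2_norm (\<lambda>\<xi>. profile_error t (norm \<xi>) (fourier f0 \<xi>) (fourier f1 \<xi>) (fourier f2 \<xi>) (v t \<xi>)))\<^sup>2
        \<le> C * ((1 + t) powr (- 1 - ?n / 2) * (L2_L11_norm f0)\<^sup>2
             + (1 + t) powr (- ?n / 2) * (L2_L11_norm f1)\<^sup>2
             + (1 + t) powr (1 - ?n / 2) * (L2_L11_norm f2)\<^sup>2)"
      using profile_error_L2[OF assms(1)] by blast
    have "L2_norm (\<lambda>x. \<psi> t x - J0\<psi>0 x - J1\<psi>1 x - J2\<psi>2 x)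
            \<le> sqrt (2 * C) * ((1 + t) powr (- 1 / 2 - ?n / 4) * L2_L11_norm \<psi>0
                 + (1 + t) powr (- ?n / 4) * L2_L11_norm \<psi>1
                 + (1 + t) powr (1 / 2 - ?n / 4) * L2_L11_norm \<psi>2)"
      if \<psi>: "in_L2 \<psi>0" "in_L11 \<psi>0" "in_L2 \<psi>1" "in_L11 \<psi>1" "in_L2 \<psi>2" "in_L11 \<psi>2"
        and sol: "blackstock_solution b \<nu> \<gamma> \<kappa> \<psi>0 \<psi>1 \<psi>2 \<psi>" and t: "t \<ge> 0"
        and J: "multiplier_image (J0_hat \<kappa> t) \<psi>0 J0\<psi>0" "multiplier_image (J1_hat (delta b \<nu> \<gamma> \<kappa>) t) \<psi>1 J1\<psi>1"
          "multiplier_image (J2_hat (delta b \<nu> \<gamma> \<kappa>) \<kappa> t) \<psi>2 J2\<psi>2"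
      for \<psi>0 \<psi>1 \<psi>2 :: "real^'n \<Rightarrow> complex" and \<psi> t J0\<psi>0 J1\<psi>1 J2\<psi>2
    proof -
      obtain v where v: "has_L2_fourier (\<psi> t) (v t)"
        and ode: "\<And>\<xi>. blackstock_ode b \<nu> \<gamma> \<kappa> ((norm \<xi>)\<^sup>2) (fourier \<psi>0 \<xi>) (fourier \<psi>1 \<xi>) (fourier \<psi>2 \<xi>) (\<lambda>t. v t \<xi>)"
        using sol t unfolding blackstock_solution_def by blast
      let ?D = "\<lambda>\<xi>. profile_error t (norm \<xi>) (fourier \<psi>0 \<xi>) (fourier \<psi>1 \<xi>) (fourier \<psi>2 \<xi>) (v t \<xi>)"
      \<comment> \<open>Besides moving the problem to the frequency side, this supplies the square
        integrability of \<open>?D\<close> required by the estimate.\<close>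
      have D: "has_L2_fourier (\<lambda>x. \<psi> t x - J0\<psi>0 x - J1\<psi>1 x - J2\<psi>2 x) ?D"
        unfolding profile_error_def using J v unfolding multiplier_image_def by (intro has_L2_fourier_diff)
      then have "in_L2 ?D" by (simp add: has_L2_fourier_def)
      note est' = est[OF \<psi> ode t this]
      define x0 where "x0 = (1 + t) powr (- 1 / 2 - ?n / 4) * L2_L11_norm \<psi>0"
      define x1 where "x1 = (1 + t) powr (- ?n / 4) * L2_L11_norm \<psi>1"
      define x2 where "x2 = (1 + t) powr (1 / 2 - ?n / 4) * L2_L11_norm \<psi>2"
      have x: "0 \<le> x0" "0 \<le> x1" "0 \<le> x2"
        unfolding x0_def x1_def x2_def by (intro mult_nonneg_nonneg L2_L11_bounds \<psi> powr_ge_zero)+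
      have sq: "((1 + t) powr p)\<^sup>2 = (1 + t) powr (2 * p)" for p
        by (simp add: power2_eq_square flip: powr_add)
      have "(L2_norm (\<lambda>x. \<psi> t x - J0\<psi>0 x - J1\<psi>1 x - J2\<psi>2 x))\<^sup>2 \<le> 2 * (L2_norm ?D)\<^sup>2"
        by (rule has_L2_fourier_norm_le[OF D])
      also have "\<dots> \<le> 2 * (C * (x0\<^sup>2 + x1\<^sup>2 + x2\<^sup>2))"
        using est' by (simp add: x0_def x1_def x2_def power_mult_distrib sq right_diff_distrib)
      \<comment> \<open>The mixed products are nonnegative. Taking the square root afterwards halves
        the exponents of the squared estimate and gives the stated rates.\<close>
      also have "\<dots> \<le> 2 * (C * (x0 + x1 + x2)\<^sup>2)"
        using C x by (intro mult_left_mono) (auto simp: power2_eq_square algebra_simps)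
      also have "\<dots> = (sqrt (2 * C) * (x0 + x1 + x2))\<^sup>2"
        using C by (simp add: power_mult_distrib)
      finally have "L2_norm (\<lambda>x. \<psi> t x - J0\<psi>0 x - J1\<psi>1 x - J2\<psi>2 x) \<le> sqrt (2 * C) * (x0 + x1 + x2)"
        by (rule power2_le_imp_le) (use C x in auto)
      then show ?thesis
        by (simp add: x0_def x1_def x2_def)
    qed
    then show ?thesis
      using C by (intro exI[of _ "sqrt (2 * C)"]) auto
  qed
  with \<kappa>0 show ?thesis
    by blast
qed

end
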